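(* Let $K$ be an algebraically closed field and let $\mathscr S=(D_i,\,{}_jM_i)_{i,j\in I}$ be a superspecies over $K$ with quiver $Q_{\mathscr S}$. Then the category $\mathrm{rep}\,\mathscr S$ of finite-dimensional representations of $\mathscr S$ and the category $\mathrm{rep}\,Q_{\mathscr S}$ of finite-dimensional $K$-representations of the quiver $Q_{\mathscr S}$ are equivalent.
   Context: Superalgebras, super vector spaces and graded modules are $\mathbb Z_2$-graded; graded morphisms preserve degree. A gr-division superalgebra is a superalgebra in which every nonzero homogeneous element is invertible. Over the algebraically closed field $K$, every finite-dimensional gr-division superalgebra is, up to isomorphism, either $K$ (trivially graded) or $D=D_{\bar0}\oplus D_{\bar1}$ with $D_{\bar0}=K$, $D_{\bar1}=K\varepsilon$, $\varepsilon^2=1$; so each $D_i$ below is taken to be $K$ or $D$. A superspecies $\mathscr S=(D_i,\,{}_jM_i)_{i,j\in I}$, $I=\{1,\dots,n\}$, is a collection of finite-dimensional gr-division superalgebras $D_i$ and finite-dimensional graded $D_j$-$D_i$-bimodules ${}_jM_i$ on which $K$ acts centrally. A representation $V=(V_i,\,{}_j\phi_i)_{i,j\in I}$ of $\mathscr S$ is a collection of graded left $D_i$-modules $V_i$ and graded $D_j$-module morphisms ${}_j\phi_i:{}_jM_i\otimes_{D_i}V_i\to V_j$; it is finite-dimensional if all $V_i$ are. A morphism $(\alpha_i):(V_i,{}_j\phi_i)\to(W_i,{}_j\psi_i)$ is a collection of graded $D_i$-module morphisms $\alpha_i:V_i\to W_i$ with ${}_j\psi_i\circ(1\otimes\alpha_i)=\alpha_j\circ{}_j\phi_i$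 for all $i,j\in I$. For all $i,j\in I$ fix a homogeneous basis $\{m_l\mid l\in I_{{}_jM_i}\}$ of ${}_jM_i$ as a free left $D_j$-module, chosen of degree $\bar0$ if $D_j=D$ (this is always possible), and put $z_l=\deg m_l\in\mathbb Z_2$. The quiver $Q_{\mathscr S}$ has vertices $(i,\bar0)$ for all $i\in I$ and $(i,\bar1)$ for all $i\in I$ with $D_i=K$. Its arrows are: for all $i,j\in I$, each $l\in I_{{}_jM_i}$ and each $z\in\mathbb Z_2$ such that $(i,z)$ is a vertex, one arrow $a^z_l$, where $a^z_l:(i,z)\to(j,z+z_l)$ unless $D_i=K$ and $D_j=D$, in which case $a^z_l:(i,z)\to(j,\bar0)$ for both $z=\bar0,\bar1$. *)

theory Defs
  imports
    "HOL-Library.Z2"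
    "HOL-Library.FuncSet"
    "HOL-Algebra.Algebraic_Closure"
    "HOL-Algebra.Free_Abelian_Groups"
    "Jordan_Normal_Form.Missing_VectorSpace"
    "Graph_Theory.Digraph"
begin

section \<open>Categories\<close>

record ('o, 'm) cat =
  Ob :: "'o set"
  Hom :: "'o \<Rightarrow> 'o \<Rightarrow> 'm set"
  Ident :: "'o \<Rightarrow> 'm"
  Comp :: "'o \<Rightarrow> 'o \<Rightarrow> 'o \<Rightarrow> 'm \<Rightarrow> 'm \<Rightarrow> 'm"
    \<comment> \<open>\<open>Comp C V Y Z g f\<close> is the composite of \<open>f : V \<rightarrow> Y\<close> and \<open>g : Y \<rightarrow> Z\<close>; hom-sets need not be disjoint.\<close>

locale category =
  fixes C :: "('o, 'm) cat"
  assumes ident_closed: "V \<in> Ob C \<Longrightarrow> Ident C V \<in> Hom C V V"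
    and comp_closed:
      "\<lbrakk>V \<in> Ob C; Y \<in> Ob C; Z \<in> Ob C; f \<in> Hom C V Y; g \<in> Hom C Y Z\<rbrakk>
        \<Longrightarrow> Comp C V Y Z g f \<in> Hom C V Z"
    and comp_ident_right:
      "\<lbrakk>V \<in> Ob C; Y \<in> Ob C; f \<in> Hom C V Y\<rbrakk> \<Longrightarrow> Comp C V V Y f (Ident C V) = f"
    and comp_ident_left:
      "\<lbrakk>V \<in> Ob C; Y \<in> Ob C; f \<in> Hom C V Y\<rbrakk> \<Longrightarrow> Comp C V Y Y (Ident C Y) f = f"
    and comp_assoc:
      "\<lbrakk>W \<in> Ob C; V \<in> Ob C; Y \<in> Ob C; Z \<in> Ob C;
        f \<in> Hom C W V; g \<in> Hom C V Y; h \<in> Hom C Y Z\<rbrakk>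
        \<Longrightarrow> Comp C W V Z (Comp C V Y Z h g) f = Comp C W Y Z h (Comp C W V Y g f)"

record ('o1, 'm1, 'o2, 'm2) cat_map =
  on_ob :: "'o1 \<Rightarrow> 'o2"
  on_hom :: "'o1 \<Rightarrow> 'o1 \<Rightarrow> 'm1 \<Rightarrow> 'm2"

locale covariant_functor = source: category C + target: category D
  for C :: "('o1, 'm1) cat" and D :: "('o2, 'm2) cat" +
  fixes F :: "('o1, 'm1, 'o2, 'm2) cat_map"
  assumes ob_closed: "V \<in> Ob C \<Longrightarrow> on_ob F V \<in> Ob D"
    and hom_closed:
      "\<lbrakk>V \<in> Ob C; Y \<in> Ob C; f \<in> Hom C V Y\<rbrakk>
        \<Longrightarrow> on_hom F V Y f \<in> Hom D (on_ob F V) (on_ob F Y)"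
    and map_ident: "V \<in> Ob C \<Longrightarrow> on_hom F V V (Ident C V) = Ident D (on_ob F V)"
    and map_comp:
      "\<lbrakk>V \<in> Ob C; Y \<in> Ob C; Z \<in> Ob C; f \<in> Hom C V Y; g \<in> Hom C Y Z\<rbrakk>
        \<Longrightarrow> on_hom F V Z (Comp C V Y Z g f) =
            Comp D (on_ob F V) (on_ob F Y) (on_ob F Z) (on_hom F Y Z g) (on_hom F V Y f)"

definition id_functor :: "('o, 'm, 'o, 'm) cat_map" where
  "id_functor = \<lparr>on_ob = (\<lambda>V. V), on_hom = (\<lambda>V Y f. f)\<rparr>"

definition comp_functor ::
  "('o2, 'm2, 'o3, 'm3) cat_map \<Rightarrow> ('o1, 'm1, 'o2, 'm2) cat_map \<Rightarrow> ('o1, 'm1, 'o3, 'm3) cat_map"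
  where
  "comp_functor G F =
    \<lparr>on_ob = (\<lambda>V. on_ob G (on_ob F V)),
     on_hom = (\<lambda>V Y f. on_hom G (on_ob F V) (on_ob F Y) (on_hom F V Y f))\<rparr>"

definition iso_hom :: "('o, 'm) cat \<Rightarrow> 'o \<Rightarrow> 'o \<Rightarrow> 'm \<Rightarrow> bool" where
  "iso_hom C V Y f \<longleftrightarrow> f \<in> Hom C V Y \<and>
    (\<exists>g \<in> Hom C Y V. Comp C V Y V g f = Ident C V \<and> Comp C Y V Y f g = Ident C Y)"

definition naturally_isomorphic ::
  "('o1, 'm1) cat \<Rightarrow> ('o2, 'm2) cat \<Rightarrow> ('o1, 'm1, 'o2, 'm2) cat_map \<Rightarrow>
    ('o1, 'm1, 'o2, 'm2) cat_map \<Rightarrow> bool" where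
  "naturally_isomorphic C D F G \<longleftrightarrow>
    (\<exists>\<eta> :: 'o1 \<Rightarrow> 'm2.
      (\<forall>V \<in> Ob C. iso_hom D (on_ob F V) (on_ob G V) (\<eta> V)) \<and>
      (\<forall>V \<in> Ob C. \<forall>Y \<in> Ob C. \<forall>f \<in> Hom C V Y.
        Comp D (on_ob F V) (on_ob F Y) (on_ob G Y) (\<eta> Y) (on_hom F V Y f) =
        Comp D (on_ob F V) (on_ob G V) (on_ob G Y) (on_hom G V Y f) (\<eta> V)))"

definition equivalent_categories :: "('o1, 'm1) cat \<Rightarrow> ('o2, 'm2) cat \<Rightarrow> bool" where
  "equivalent_categories C D \<longleftrightarrow>
    category C \<and> category D \<and>
    (\<exists>F G. covariant_functor C D F \<and> covariant_functor D C G \<and>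
      naturally_isomorphic C C (comp_functor G F) id_functor \<and>
      naturally_isomorphic D D (comp_functor F G) id_functor)"

section \<open>Superalgebras, graded modules and bimodules\<close>

text \<open>The type \<^typ>\<open>bit\<close> plays the role of the group of integers modulo 2.  A single record type
  serves for superalgebras and for graded modules; as always in HOL-Algebra, the fields
  \<^const>\<open>monoid.mult\<close> and \<^const>\<open>monoid.one\<close> carry no information in the case of modules.\<close>

record ('a, 'b) graded = "('a, 'b) module" +
  hcomp :: "bit \<Rightarrow> 'b set"

record ('a, 'b) graded_bimod = "('a, 'b) graded" +
  rsmult :: "'b \<Rightarrow> 'a \<Rightarrow> 'b"

definition z2_grading :: "('a, 'b, 'c) graded_scheme \<Rightarrow> bool" where
  "z2_grading V \<longleftrightarrow>
    (\<forall>z. additive_subgroup (hcomp V z) V) \<and>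
    hcomp V 0 <+>\<^bsub>V\<^esub> hcomp V 1 = carrier V \<and>
    hcomp V 0 \<inter> hcomp V 1 = {\<zero>\<^bsub>V\<^esub>}"

definition deg :: "('a, 'b, 'c) graded_scheme \<Rightarrow> 'b \<Rightarrow> bit" where
  "deg V x = (THE z. x \<in> hcomp V z)"

locale superalgebra = vectorspace K A + A?: ring A
  for K :: "('k, 'r) ring_scheme" and A :: "('k, 'a) graded" +
  assumes smult_mult_left:
      "\<lbrakk>c \<in> carrier K; x \<in> carrier A; y \<in> carrier A\<rbrakk>
        \<Longrightarrow> (c \<odot>\<^bsub>A\<^esub> x) \<otimes>\<^bsub>A\<^esub> y = c \<odot>\<^bsub>A\<^esub> (x \<otimes>\<^bsub>A\<^esub> y)"
    and smult_mult_right: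
      "\<lbrakk>c \<in> carrier K; x \<in> carrier A; y \<in> carrier A\<rbrakk>
        \<Longrightarrow> x \<otimes>\<^bsub>A\<^esub> (c \<odot>\<^bsub>A\<^esub> y) = c \<odot>\<^bsub>A\<^esub> (x \<otimes>\<^bsub>A\<^esub> y)"
    and grading: "z2_grading A"
    and smult_graded:
      "\<lbrakk>c \<in> carrier K; x \<in> hcomp A z\<rbrakk> \<Longrightarrow> c \<odot>\<^bsub>A\<^esub> x \<in> hcomp A z"
    and mult_graded:
      "\<lbrakk>x \<in> hcomp A a; y \<in> hcomp A b\<rbrakk> \<Longrightarrow> x \<otimes>\<^bsub>A\<^esub> y \<in> hcomp A (a + b)"
    and one_graded: "\<one>\<^bsub>A\<^esub> \<in> hcomp A 0"

locale gr_division_superalgebra = superalgebra +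
  assumes nontrivial: "\<one>\<^bsub>A\<^esub> \<noteq> \<zero>\<^bsub>A\<^esub>"
    and homogeneous_invertible: "\<lbrakk>x \<in> hcomp A z; x \<noteq> \<zero>\<^bsub>A\<^esub>\<rbrakk> \<Longrightarrow> x \<in> Units A"

locale graded_left_module =
  fixes A :: "('k, 'a) graded" and V :: "('a, 'v, 'c) graded_scheme"
  assumes group: "abelian_group V"
    and smult_closed: "\<lbrakk>a \<in> carrier A; x \<in> carrier V\<rbrakk> \<Longrightarrow> a \<odot>\<^bsub>V\<^esub> x \<in> carrier V"
    and smult_l_distr:
      "\<lbrakk>a \<in> carrier A; b \<in> carrier A; x \<in> carrier V\<rbrakk>
        \<Longrightarrow> (a \<oplus>\<^bsub>A\<^esub> b) \<odot>\<^bsub>V\<^esub> x = a \<odot>\<^bsub>V\<^esub> x \<oplus>\<^bsub>V\<^esub> b \<odot>\<^bsub>V\<^esub> x"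
    and smult_r_distr:
      "\<lbrakk>a \<in> carrier A; x \<in> carrier V; y \<in> carrier V\<rbrakk>
        \<Longrightarrow> a \<odot>\<^bsub>V\<^esub> (x \<oplus>\<^bsub>V\<^esub> y) = a \<odot>\<^bsub>V\<^esub> x \<oplus>\<^bsub>V\<^esub> a \<odot>\<^bsub>V\<^esub> y"
    and smult_assoc:
      "\<lbrakk>a \<in> carrier A; b \<in> carrier A; x \<in> carrier V\<rbrakk>
        \<Longrightarrow> (a \<otimes>\<^bsub>A\<^esub> b) \<odot>\<^bsub>V\<^esub> x = a \<odot>\<^bsub>V\<^esub> (b \<odot>\<^bsub>V\<^esub> x)"
    and smult_one: "x \<in> carrier V \<Longrightarrow> \<one>\<^bsub>A\<^esub> \<odot>\<^bsub>V\<^esub> x = x"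
    and grading: "z2_grading V"
    and smult_graded:
      "\<lbrakk>a \<in> hcomp A s; x \<in> hcomp V t\<rbrakk> \<Longrightarrow> a \<odot>\<^bsub>V\<^esub> x \<in> hcomp V (s + t)"

text \<open>\<open>graded_bimodule K B A M\<close>: \<open>M\<close> is a graded \<open>B\<close>-\<open>A\<close>-bimodule with \<open>K\<close> acting centrally.\<close>

locale graded_bimodule = left: graded_left_module B M
  for K :: "('k, 'r) ring_scheme" and B :: "('k, 'a) graded" and A :: "('k, 'a) graded"
    and M :: "('a, 'm) graded_bimod" +
  assumes rsmult_closed: "\<lbrakk>x \<in> carrier M; a \<in> carrier A\<rbrakk> \<Longrightarrow> rsmult M x a \<in> carrier M"
    and rsmult_l_distr:
      "\<lbrakk>x \<in> carrier M; y \<in> carrier M; a \<in> carrier A\<rbrakk>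
        \<Longrightarrow> rsmult M (x \<oplus>\<^bsub>M\<^esub> y) a = rsmult M x a \<oplus>\<^bsub>M\<^esub> rsmult M y a"
    and rsmult_r_distr:
      "\<lbrakk>x \<in> carrier M; a \<in> carrier A; b \<in> carrier A\<rbrakk>
        \<Longrightarrow> rsmult M x (a \<oplus>\<^bsub>A\<^esub> b) = rsmult M x a \<oplus>\<^bsub>M\<^esub> rsmult M x b"
    and rsmult_assoc:
      "\<lbrakk>x \<in> carrier M; a \<in> carrier A; b \<in> carrier A\<rbrakk>
        \<Longrightarrow> rsmult M x (a \<otimes>\<^bsub>A\<^esub> b) = rsmult M (rsmult M x a) b"
    and rsmult_one: "x \<in> carrier M \<Longrightarrow> rsmult M x \<one>\<^bsub>A\<^esub> = x"
    and bimodule_assoc: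
      "\<lbrakk>b \<in> carrier B; x \<in> carrier M; a \<in> carrier A\<rbrakk>
        \<Longrightarrow> rsmult M (b \<odot>\<^bsub>M\<^esub> x) a = b \<odot>\<^bsub>M\<^esub> rsmult M x a"
    and rsmult_graded:
      "\<lbrakk>x \<in> hcomp M s; a \<in> hcomp A t\<rbrakk> \<Longrightarrow> rsmult M x a \<in> hcomp M (s + t)"
    and central:
      "\<lbrakk>c \<in> carrier K; x \<in> carrier M\<rbrakk>
        \<Longrightarrow> (c \<odot>\<^bsub>B\<^esub> \<one>\<^bsub>B\<^esub>) \<odot>\<^bsub>M\<^esub> x = rsmult M x (c \<odot>\<^bsub>A\<^esub> \<one>\<^bsub>A\<^esub>)"

text \<open>The \<open>K\<close>-vector space underlying a left \<open>A\<close>-module, through the unit map \<open>c \<mapsto> c 1\<close> of \<open>A\<close>.\<close>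

definition restrict_scalars ::
  "('k, 'a) graded \<Rightarrow> ('a, 'v, 'c) graded_scheme \<Rightarrow> ('k, 'v) module" where
  "restrict_scalars A V =
    \<lparr>carrier = carrier V, monoid.mult = monoid.mult V, monoid.one = monoid.one V, ring.zero = ring.zero V, ring.add = ring.add V,
     smult = (\<lambda>c x. (c \<odot>\<^bsub>A\<^esub> \<one>\<^bsub>A\<^esub>) \<odot>\<^bsub>V\<^esub> x)\<rparr>"

definition fin_dim_module ::
  "('k, 'r) ring_scheme \<Rightarrow> ('k, 'a) graded \<Rightarrow> ('a, 'v, 'c) graded_scheme \<Rightarrow> bool" where
  "fin_dim_module K A V \<longleftrightarrow> vectorspace.fin_dim K (restrict_scalars A V)"

definition graded_hom ::
  "('k, 'a) graded \<Rightarrow> ('a, 'v, 'c) graded_scheme \<Rightarrow> ('a, 'w, 'e) graded_scheme \<Rightarrow> ('v \<Rightarrow> 'w) set"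
  where
  "graded_hom A V W = {f \<in> module_hom A V W. \<forall>z. f ` hcomp V z \<subseteq> hcomp W z}"

definition superalgebra_iso ::
  "('k, 'r) ring_scheme \<Rightarrow> ('k, 'a) graded \<Rightarrow> ('k, 'b) graded \<Rightarrow> bool" where
  "superalgebra_iso K A B \<longleftrightarrow>
    (\<exists>h. bij_betw h (carrier A) (carrier B) \<and> h \<in> ring_hom A B \<and> h \<in> module_hom K A B \<and>
      (\<forall>z. h ` hcomp A z = hcomp B z))"

text \<open>The two model gr-division superalgebras: \<open>K\<close> itself, and \<open>D = K \<oplus> K\<epsilon>\<close> with \<open>\<epsilon>\<close> odd and
  \<open>\<epsilon>\<^sup>2 = 1\<close>, where the pair \<open>(a, b)\<close> stands for \<open>a + b \<epsilon>\<close>.\<close>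

definition ground_superalgebra :: "('k, 'r) ring_scheme \<Rightarrow> ('k, 'k) graded" where
  "ground_superalgebra K =
    \<lparr>carrier = carrier K, monoid.mult = monoid.mult K, monoid.one = monoid.one K, ring.zero = ring.zero K, ring.add = ring.add K,
     smult = monoid.mult K, hcomp = (\<lambda>z. if z = 0 then carrier K else {\<zero>\<^bsub>K\<^esub>})\<rparr>"

definition odd_superalgebra :: "('k, 'r) ring_scheme \<Rightarrow> ('k, 'k \<times> 'k) graded" where
  "odd_superalgebra K =
    \<lparr>carrier = carrier K \<times> carrier K,
     monoid.mult = (\<lambda>(a, b) (c, d).
       (a \<otimes>\<^bsub>K\<^esub> c \<oplus>\<^bsub>K\<^esub> b \<otimes>\<^bsub>K\<^esub> d, a \<otimes>\<^bsub>K\<^esub> d \<oplus>\<^bsub>K\<^esub> b \<otimes>\<^bsub>K\<^esub> c)),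
     monoid.one = (\<one>\<^bsub>K\<^esub>, \<zero>\<^bsub>K\<^esub>),
     ring.zero = (\<zero>\<^bsub>K\<^esub>, \<zero>\<^bsub>K\<^esub>),
     ring.add = (\<lambda>(a, b) (c, d). (a \<oplus>\<^bsub>K\<^esub> c, b \<oplus>\<^bsub>K\<^esub> d)),
     smult = (\<lambda>x (a, b). (x \<otimes>\<^bsub>K\<^esub> a, x \<otimes>\<^bsub>K\<^esub> b)),
     hcomp = (\<lambda>z. if z = 0 then carrier K \<times> {\<zero>\<^bsub>K\<^esub>} else {\<zero>\<^bsub>K\<^esub>} \<times> carrier K)\<rparr>"

abbreviation is_ground :: "('k, 'r) ring_scheme \<Rightarrow> ('k, 'a) graded \<Rightarrow> bool" where
  "is_ground K A \<equiv> superalgebra_iso K A (ground_superalgebra K)"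

abbreviation is_odd :: "('k, 'r) ring_scheme \<Rightarrow> ('k, 'a) graded \<Rightarrow> bool" where
  "is_odd K A \<equiv> superalgebra_iso K A (odd_superalgebra K)"

section \<open>Tensor products\<close>

text \<open>\<open>M \<otimes>\<^sub>A V\<close> is the free abelian group on \<open>M \<times> V\<close> modulo the subgroup generated by the relators
  of biadditivity and \<open>A\<close>-balancedness.\<close>

definition tensor_free ::
  "('a, 'm) graded_bimod \<Rightarrow> ('a, 'v) graded \<Rightarrow> ('m \<times> 'v \<Rightarrow>\<^sub>0 int) monoid" where
  "tensor_free M V = free_Abelian_group (carrier M \<times> carrier V)"

definition tensor_relators ::
  "('k, 'a) graded \<Rightarrow> ('a, 'm) graded_bimod \<Rightarrow> ('a, 'v) graded \<Rightarrow> ('m \<times> 'v \<Rightarrow>\<^sub>0 int) set" where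
  "tensor_relators A M V =
    {frag_of (m \<oplus>\<^bsub>M\<^esub> m', v) - frag_of (m, v) - frag_of (m', v) | m m' v.
      m \<in> carrier M \<and> m' \<in> carrier M \<and> v \<in> carrier V} \<union>
    {frag_of (m, v \<oplus>\<^bsub>V\<^esub> v') - frag_of (m, v) - frag_of (m, v') | m v v'.
      m \<in> carrier M \<and> v \<in> carrier V \<and> v' \<in> carrier V} \<union>
    {frag_of (rsmult M m a, v) - frag_of (m, a \<odot>\<^bsub>V\<^esub> v) | m a v.
      m \<in> carrier M \<and> a \<in> carrier A \<and> v \<in> carrier V}"

definition tensor_null ::
  "('k, 'a) graded \<Rightarrow> ('a, 'm) graded_bimod \<Rightarrow> ('a, 'v) graded \<Rightarrow> ('m \<times> 'v \<Rightarrow>\<^sub>0 int) set" where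
  "tensor_null A M V = generate (tensor_free M V) (tensor_relators A M V)"

definition tensor_group ::
  "('k, 'a) graded \<Rightarrow> ('a, 'm) graded_bimod \<Rightarrow> ('a, 'v) graded \<Rightarrow>
    ('m \<times> 'v \<Rightarrow>\<^sub>0 int) set monoid" where
  "tensor_group A M V = tensor_free M V Mod tensor_null A M V"

definition tensor_class ::
  "('k, 'a) graded \<Rightarrow> ('a, 'm) graded_bimod \<Rightarrow> ('a, 'v) graded \<Rightarrow>
    ('m \<times> 'v \<Rightarrow>\<^sub>0 int) \<Rightarrow> ('m \<times> 'v \<Rightarrow>\<^sub>0 int) set" where
  "tensor_class A M V c = tensor_null A M V #>\<^bsub>tensor_free M V\<^esub> c"

definition pure_tensor ::
  "('k, 'a) graded \<Rightarrow> ('a, 'm) graded_bimod \<Rightarrow> ('a, 'v) graded \<Rightarrow>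
    'm \<Rightarrow> 'v \<Rightarrow> ('m \<times> 'v \<Rightarrow>\<^sub>0 int) set" where
  "pure_tensor A M V m v = tensor_class A M V (frag_of (m, v))"

text \<open>The map \<open>f \<otimes> g\<close> out of \<open>M \<otimes>\<^sub>A V\<close>; the arguments \<open>M\<close> and \<open>V\<close> below are the factors of the
  \<^emph>\<open>target\<close> tensor product.  Whenever \<open>f \<otimes> g\<close> is well-defined, all members of the coset \<open>T\<close> give
  the same class, so the union is that class.\<close>

definition tensor_map ::
  "('k, 'a) graded \<Rightarrow> ('a, 'm) graded_bimod \<Rightarrow> ('a, 'w) graded \<Rightarrow>
    ('m \<Rightarrow> 'm) \<Rightarrow> ('v \<Rightarrow> 'w) \<Rightarrow> ('m \<times> 'v \<Rightarrow>\<^sub>0 int) set \<Rightarrow> ('m \<times> 'w \<Rightarrow>\<^sub>0 int) set" where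
  "tensor_map A M V f g T =
    (\<Union>c\<in>T. tensor_class A M V (frag_extend (\<lambda>(m, v). frag_of (f m, g v)) c))"

text \<open>As a graded left module, \<open>b (m \<otimes> v) = b m \<otimes> v\<close>, and the component of degree \<open>z\<close> is spanned
  by the \<open>m \<otimes> v\<close> with \<open>m\<close>, \<open>v\<close> homogeneous and \<open>deg m + deg v = z\<close>.\<close>

definition tensor ::
  "('k, 'a) graded \<Rightarrow> ('a, 'm) graded_bimod \<Rightarrow> ('a, 'v) graded \<Rightarrow>
    ('a, ('m \<times> 'v \<Rightarrow>\<^sub>0 int) set) graded" where
  "tensor A M V =
    \<lparr>carrier = carrier (tensor_group A M V),
     monoid.mult = undefined, monoid.one = undefined,
     ring.zero = monoid.one (tensor_group A M V),
     ring.add = monoid.mult (tensor_group A M V),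
     smult = (\<lambda>b. tensor_map A M V (\<lambda>m. b \<odot>\<^bsub>M\<^esub> m) (\<lambda>v. v)),
     hcomp = (\<lambda>z. generate (tensor_group A M V)
       {pure_tensor A M V m v | m v s t. m \<in> hcomp M s \<and> v \<in> hcomp V t \<and> s + t = z})\<rparr>"

section \<open>Superspecies and their representations\<close>

text \<open>\<open>bimod S j i\<close> is the bimodule written with \<open>j\<close> on its left and \<open>i\<close> on its right.\<close>

record ('k, 'a, 'm) superspecies =
  num_indices :: nat
  dalg :: "nat \<Rightarrow> ('k, 'a) graded"
  bimod :: "nat \<Rightarrow> nat \<Rightarrow> ('a, 'm) graded_bimod"

abbreviation index_set :: "('k, 'a, 'm) superspecies \<Rightarrow> nat set" where
  "index_set S \<equiv> {1..num_indices S}"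

definition is_superspecies :: "('k, 'r) ring_scheme \<Rightarrow> ('k, 'a, 'm) superspecies \<Rightarrow> bool" where
  "is_superspecies K S \<longleftrightarrow>
    (\<forall>i\<in>index_set S. gr_division_superalgebra K (dalg S i) \<and> vectorspace.fin_dim K (dalg S i)) \<and>
    (\<forall>i\<in>index_set S. \<forall>j\<in>index_set S.
      graded_bimodule K (dalg S j) (dalg S i) (bimod S j i) \<and>
      fin_dim_module K (dalg S j) (bimod S j i))"

text \<open>The carriers of the representing spaces are subsets of a type \<open>'v\<close>, which serves as the
  universe: once \<open>'k\<close> embeds into \<open>'v\<close> and \<open>'v\<close> is infinite, every finite-dimensional
  representation is isomorphic to one of this kind.  Values of the families of spaces and maps
  outside their index sets and carriers carry no information; morphisms, in contrast, are
  extensional, so that equality of morphisms is equality of functions.\<close>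

record ('a, 'm, 'v) species_rep =
  sspace :: "nat \<Rightarrow> ('a, 'v) graded"
  smap :: "nat \<Rightarrow> nat \<Rightarrow> ('m \<times> 'v \<Rightarrow>\<^sub>0 int) set \<Rightarrow> 'v"

definition is_species_rep ::
  "('k, 'a, 'm) superspecies \<Rightarrow> ('a, 'm, 'v) species_rep \<Rightarrow> bool" where
  "is_species_rep S V \<longleftrightarrow>
    (\<forall>i\<in>index_set S. graded_left_module (dalg S i) (sspace V i)) \<and>
    (\<forall>i\<in>index_set S. \<forall>j\<in>index_set S.
      smap V j i \<in>
        graded_hom (dalg S j) (tensor (dalg S i) (bimod S j i) (sspace V i)) (sspace V j))"

definition species_rep_hom ::
  "('k, 'a, 'm) superspecies \<Rightarrow> ('a, 'm, 'v) species_rep \<Rightarrow> ('a, 'm, 'v) species_rep \<Rightarrow>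
    (nat \<Rightarrow> 'v \<Rightarrow> 'v) set" where
  "species_rep_hom S V W =
    {\<alpha> \<in> (\<Pi>\<^sub>E i\<in>index_set S.
        graded_hom (dalg S i) (sspace V i) (sspace W i) \<inter> extensional (carrier (sspace V i))).
      \<forall>i\<in>index_set S. \<forall>j\<in>index_set S.
        \<forall>T\<in>carrier (tensor (dalg S i) (bimod S j i) (sspace V i)).
          smap W j i (tensor_map (dalg S i) (bimod S j i) (sspace W i) (\<lambda>m. m) (\<alpha> i) T) =
          \<alpha> j (smap V j i T)}"

definition rep_superspecies ::
  "('k, 'r) ring_scheme \<Rightarrow> ('k, 'a, 'm) superspecies \<Rightarrow>
    (('a, 'm, 'v) species_rep, nat \<Rightarrow> 'v \<Rightarrow> 'v) cat" where
  "rep_superspecies K S =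
    \<lparr>Ob = {V. is_species_rep S V \<and>
       (\<forall>i\<in>index_set S. fin_dim_module K (dalg S i) (sspace V i))},
     Hom = species_rep_hom S,
     Ident = (\<lambda>V. \<lambda>i\<in>index_set S. \<lambda>x\<in>carrier (sspace V i). x),
     Comp = (\<lambda>U V W \<beta> \<alpha>. \<lambda>i\<in>index_set S. compose (carrier (sspace U i)) (\<beta> i) (\<alpha> i))\<rparr>"

section \<open>Quivers and their representations\<close>

text \<open>A quiver is a directed multigraph in the sense of Graph_Theory; an arrow \<open>a\<close> points from
  \<open>tail Q a\<close> to \<open>head Q a\<close>.\<close>

record ('k, 'x, 'e, 'v) quiver_rep =
  qspace :: "'x \<Rightarrow> ('k, 'v) module"
  qmap :: "'e \<Rightarrow> 'v \<Rightarrow> 'v"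

definition is_quiver_rep ::
  "('k, 'r) ring_scheme \<Rightarrow> ('x, 'e) pre_digraph \<Rightarrow> ('k, 'x, 'e, 'v) quiver_rep \<Rightarrow> bool" where
  "is_quiver_rep K Q V \<longleftrightarrow>
    (\<forall>x\<in>verts Q. vectorspace K (qspace V x)) \<and>
    (\<forall>a\<in>arcs Q. qmap V a \<in> module_hom K (qspace V (tail Q a)) (qspace V (head Q a)))"

definition quiver_rep_hom ::
  "('k, 'r) ring_scheme \<Rightarrow> ('x, 'e) pre_digraph \<Rightarrow> ('k, 'x, 'e, 'v) quiver_rep \<Rightarrow>
    ('k, 'x, 'e, 'v) quiver_rep \<Rightarrow> ('x \<Rightarrow> 'v \<Rightarrow> 'v) set" where
  "quiver_rep_hom K Q V W =
    {\<alpha> \<in> (\<Pi>\<^sub>E x\<in>verts Q.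
        module_hom K (qspace V x) (qspace W x) \<inter> extensional (carrier (qspace V x))).
      \<forall>a\<in>arcs Q. \<forall>v\<in>carrier (qspace V (tail Q a)).
        qmap W a (\<alpha> (tail Q a) v) = \<alpha> (head Q a) (qmap V a v)}"

definition rep_quiver ::
  "('k, 'r) ring_scheme \<Rightarrow> ('x, 'e) pre_digraph \<Rightarrow>
    (('k, 'x, 'e, 'v) quiver_rep, 'x \<Rightarrow> 'v \<Rightarrow> 'v) cat" where
  "rep_quiver K Q =
    \<lparr>Ob = {V. is_quiver_rep K Q V \<and> (\<forall>x\<in>verts Q. vectorspace.fin_dim K (qspace V x))},
     Hom = quiver_rep_hom K Q,
     Ident = (\<lambda>V. \<lambda>x\<in>verts Q. \<lambda>v\<in>carrier (qspace V x). v),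
     Comp = (\<lambda>U V W \<beta> \<alpha>. \<lambda>x\<in>verts Q. compose (carrier (qspace U x)) (\<beta> x) (\<alpha> x))\<rparr>"

section \<open>The quiver of a superspecies\<close>

text \<open>A basis is a finite family \<open>(m l)\<close>, \<open>l \<in> L\<close>.  Finiteness is part of the definition because
  \<^const>\<open>finsum\<close> is degenerate on infinite sets; for the finite-dimensional bimodules and
  nonzero algebras used here it is automatic.\<close>

definition homogeneous_basis ::
  "('k, 'a) graded \<Rightarrow> ('a, 'm, 'c) graded_scheme \<Rightarrow> 'l set \<Rightarrow> ('l \<Rightarrow> 'm) \<Rightarrow> bool" where
  "homogeneous_basis A M L m \<longleftrightarrow>
    finite L \<and> (\<forall>l\<in>L. \<exists>z. m l \<in> hcomp M z) \<and>
    (\<forall>x\<in>carrier M. \<exists>!c. c \<in> (\<Pi>\<^sub>E l\<in>L. carrier A) \<and> x = (\<Oplus>\<^bsub>M\<^esub>l\<in>L. c l \<odot>\<^bsub>M\<^esub> m l))"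

definition admissible_bases ::
  "('k, 'r) ring_scheme \<Rightarrow> ('k, 'a, 'm) superspecies \<Rightarrow> (nat \<Rightarrow> nat \<Rightarrow> 'l set) \<Rightarrow>
    (nat \<Rightarrow> nat \<Rightarrow> 'l \<Rightarrow> 'm) \<Rightarrow> bool" where
  "admissible_bases K S L m \<longleftrightarrow>
    (\<forall>i\<in>index_set S. \<forall>j\<in>index_set S.
      homogeneous_basis (dalg S j) (bimod S j i) (L j i) (m j i) \<and>
      (is_odd K (dalg S j) \<longrightarrow> (\<forall>l\<in>L j i. deg (bimod S j i) (m j i l) = 0)))"

definition quiver_verts :: "('k, 'r) ring_scheme \<Rightarrow> ('k, 'a, 'm) superspecies \<Rightarrow> (nat \<times> bit) set"
  where
  "quiver_verts K S =
    {(i, 0) | i. i \<in> index_set S} \<union> {(i, 1) | i. i \<in> index_set S \<and> is_ground K (dalg S i)}"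

text \<open>The quadruple \<open>(j, i, l, z)\<close> encodes the arrow \<open>a\<^sub>l\<^sup>z\<close> starting at \<open>(i, z)\<close>, where \<open>l\<close> belongs
  to the index set of the basis of \<open>bimod S j i\<close>.\<close>

definition superspecies_quiver ::
  "('k, 'r) ring_scheme \<Rightarrow> ('k, 'a, 'm) superspecies \<Rightarrow> (nat \<Rightarrow> nat \<Rightarrow> 'l set) \<Rightarrow>
    (nat \<Rightarrow> nat \<Rightarrow> 'l \<Rightarrow> 'm) \<Rightarrow> (nat \<times> bit, nat \<times> nat \<times> 'l \<times> bit) pre_digraph" where
  "superspecies_quiver K S L m =
    \<lparr>verts = quiver_verts K S,
     arcs = {(j, i, l, z). i \<in> index_set S \<and> j \<in> index_set S \<and> l \<in> L j i \<and>
       (i, z) \<in> quiver_verts K S},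
     tail = (\<lambda>(j, i, l, z). (i, z)),
     head = (\<lambda>(j, i, l, z).
       if is_ground K (dalg S i) \<and> is_odd K (dalg S j) then (j, 0)
       else (j, z + deg (bimod S j i) (m j i l)))\<rparr>"

end

theory Submission
  imports Defs
begin

text \<open>
  Over the algebraically closed field \<open>K\<close> each \<open>D\<^sub>i\<close> is \<open>K\<close> or \<open>K + K\<epsilon>\<close>: its even part is a
  finite-dimensional division algebra, hence \<open>K\<close> (\<open>even_is_scalar\<close>), and a nonzero odd element can be
  scaled to have square 1 (\<open>odd_unit_exists\<close>).  A graded \<open>D\<^sub>i\<close>-module \<open>V\<close> is therefore the pair of
  its components \<open>V\<^sub>0\<close>, \<open>V\<^sub>1\<close> if \<open>D\<^sub>i = K\<close>, and it is determined by \<open>V\<^sub>0\<close> alone otherwise, because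
  \<open>\<epsilon>\<close> maps \<open>V\<^sub>0\<close> isomorphically onto \<open>V\<^sub>1\<close>.  Exactly these components sit at the vertices of the quiver.

  A graded morphism \<open>M \<otimes> V \<rightarrow> W\<close> out of a tensor product is a balanced map \<open>b(x, v)\<close> that is linear in
  \<open>x\<close> over the left algebra (\<open>bihom_of_hom\<close>, \<open>hom_of_bihom\<close>).  As \<open>M\<close> is free with basis \<open>m\<^sub>l\<close>, the
  values \<open>b(m\<^sub>l, v)\<close> determine \<open>b\<close>, and \<open>v\<close> may be restricted to the components that belong to a
  vertex: if \<open>(i, 1)\<close> is no vertex then \<open>b(x, \<epsilon> v) = b(x \<epsilon>, v)\<close> (\<open>bihom_eqI\<close>).  So \<open>b\<close> amounts to
  linear maps \<open>v \<mapsto> b(m\<^sub>l, v)\<close> from \<open>V\<^sub>z\<close> to the component of \<open>W\<close> of degree \<open>z + deg m\<^sub>l\<close>.  The latter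
  belongs to a vertex except when \<open>D\<^sub>i = K\<close>, \<open>D\<^sub>j = K + K\<epsilon>\<close> and \<open>z = 1\<close>; then multiplication by
  \<open>\<epsilon>\<close> moves the value to degree 0.  These maps are the maps on the arrows.

  This assignment is a functor, and it is an equivalence because it is fully faithful and essentially
  surjective (\<open>full_faithful_surjective_imp_equivalent\<close>).  A family of linear maps on the components at
  the vertices extends uniquely to graded module maps (\<open>graded_hom_eqI\<close>, \<open>extend_vertex_pieces\<close>), and
  compatibility with the structure maps need only be tested where the arrows test it.
  Conversely, a quiver representation \<open>U\<close> comes from the modules \<open>U(i, 0) \<oplus> U(i, 1)\<close> for \<open>D\<^sub>i = K\<close> and
  \<open>U(i, 0) \<oplus> U(i, 0)\<close>, with \<open>\<epsilon>\<close> exchanging the summands, for \<open>D\<^sub>i = K + K\<epsilon>\<close>; the balanced maps are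
  obtained by prescribing their values on basis elements and components (\<open>glue_bihom\<close>,
  \<open>glue_basis\<close>).  The underlying sets of these direct sums fit into the universe \<open>'v\<close> because an infinite
  type admits an injective pairing.
\<close>

section \<open>Equivalences of categories\<close>

text \<open>The quasi-inverse chooses a preimage up to isomorphism of every object and transports
  morphisms along the chosen isomorphisms.  Identities between morphisms of \<open>C\<close> are verified after
  applying the faithful functor \<open>F\<close>.\<close>

lemma full_faithful_surjective_imp_equivalent:
  fixes C :: "('o1, 'm1) cat" and D :: "('o2, 'm2) cat" and F :: "('o1, 'm1, 'o2, 'm2) cat_map"
  assumes F: "covariant_functor C D F"
    and bij: "\<And>V Y. \<lbrakk>V \<in> Ob C; Y \<in> Ob C\<rbrakk>
      \<Longrightarrow> bij_betw (on_hom F V Y) (Hom C V Y) (Hom D (on_ob F V) (on_ob F Y))"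
    and surj: "\<And>P. P \<in> Ob D \<Longrightarrow> \<exists>V \<in> Ob C. \<exists>f. iso_hom D (on_ob F V) P f"
  shows "equivalent_categories C D"
proof -
  interpret F: covariant_functor C D F by (rule F)
  let ?c = "Comp D"
  note cl = F.target.comp_closed and idl = F.target.comp_ident_left
    and idr = F.target.comp_ident_right and ass = F.target.comp_assoc
  define lft where "lft V Y = inv_into (Hom C V Y) (on_hom F V Y)" for V Y
  have inv_mem: "lft V Y h \<in> Hom C V Y" and F_inv: "on_hom F V Y (lft V Y h) = h"
    if "V \<in> Ob C" "Y \<in> Ob C" "h \<in> Hom D (on_ob F V) (on_ob F Y)" for V Y h
    using bij[OF that(1,2)] that(3) unfolding lft_def bij_betw_def
    by (auto intro: inv_into_into f_inv_into_f)
  have inj: "f = g" if "V \<in> Ob C" "Y \<in> Ob C" "f \<in> Hom C V Y" "g \<in> Hom C V Y"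
    "on_hom F V Y f = on_hom F V Y g" for V Y f g
    using bij[OF that(1,2)] that(3-) unfolding bij_betw_def inj_on_def by blast
  have "\<forall>P. \<exists>V e d. P \<in> Ob D \<longrightarrow> V \<in> Ob C \<and> e \<in> Hom D (on_ob F V) P \<and> d \<in> Hom D P (on_ob F V) \<and>
      ?c (on_ob F V) P (on_ob F V) d e = Ident D (on_ob F V) \<and> ?c P (on_ob F V) P e d = Ident D P"
    using surj unfolding iso_hom_def by meson
  then obtain G0 e d where G0: "\<And>P. P \<in> Ob D \<Longrightarrow> G0 P \<in> Ob C"
    and e: "\<And>P. P \<in> Ob D \<Longrightarrow> e P \<in> Hom D (on_ob F (G0 P)) P"
    and d: "\<And>P. P \<in> Ob D \<Longrightarrow> d P \<in> Hom D P (on_ob F (G0 P))"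
    and de: "\<And>P. P \<in> Ob D \<Longrightarrow> ?c (on_ob F (G0 P)) P (on_ob F (G0 P)) (d P) (e P) = Ident D (on_ob F (G0 P))"
    and ed: "\<And>P. P \<in> Ob D \<Longrightarrow> ?c P (on_ob F (G0 P)) P (e P) (d P) = Ident D P"
    by metis
  \<comment> \<open>The morphism \<open>f\<close> transported along the isomorphisms \<open>e\<close>; fullness lifts it to \<open>C\<close>.\<close>
  define h where "h P Y f = ?c (on_ob F (G0 P)) Y (on_ob F (G0 Y)) (d Y) (?c (on_ob F (G0 P)) P Y f (e P))" for P Y f
  define G where "G = \<lparr>on_ob = G0, on_hom = (\<lambda>P Y f. lft (G0 P) (G0 Y) (h P Y f))\<rparr>"
  have G_ob: "on_ob G P = G0 P" and G_hom: "on_hom G P Y f = lft (G0 P) (G0 Y) (h P Y f)" for P Y f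
    by (simp_all add: G_def)
  have FG: "on_ob F (G0 P) \<in> Ob D" if "P \<in> Ob D" for P using G0[OF that] F.ob_closed by blast
  note mems = G0 FG e d cl F.ob_closed F.hom_closed
  have h_mem: "h P Y f \<in> Hom D (on_ob F (G0 P)) (on_ob F (G0 Y))"
    if "P \<in> Ob D" "Y \<in> Ob D" "f \<in> Hom D P Y" for P Y f
    unfolding h_def using that by (intro cl[of _ Y] cl[of _ P] mems)
  have e_h: "?c (on_ob F (G0 P)) (on_ob F (G0 Y)) Y (e Y) (h P Y f) = ?c (on_ob F (G0 P)) P Y f (e P)"
    if [simp]: "P \<in> Ob D" "Y \<in> Ob D" "f \<in> Hom D P Y" for P Y f
  proof -
    have m: "?c (on_ob F (G0 P)) P Y f (e P) \<in> Hom D (on_ob F (G0 P)) Y"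
      by (intro mems) auto
    show ?thesis unfolding h_def
      by (subst ass[symmetric]) (auto simp: mems ed m idl)
  qed
  have h_id: "h P P (Ident D P) = Ident D (on_ob F (G0 P))" if [simp]: "P \<in> Ob D" for P
    unfolding h_def by (subst idl) (auto simp: mems de)
  have h_comp: "h P Z (?c P Y Z g f) =
      ?c (on_ob F (G0 P)) (on_ob F (G0 Y)) (on_ob F (G0 Z)) (h Y Z g) (h P Y f)"
    if [simp]: "P \<in> Ob D" "Y \<in> Ob D" "Z \<in> Ob D" "f \<in> Hom D P Y" "g \<in> Hom D Y Z" for P Y Z f g
  proof -
    let ?P = "on_ob F (G0 P)" let ?Y = "on_ob F (G0 Y)" let ?Z = "on_ob F (G0 Z)"
    have ge: "?c ?Y Y Z g (e Y) \<in> Hom D ?Y Z" and fe: "?c ?P P Y f (e P) \<in> Hom D ?P Y"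
      by (intro mems; simp)+
    have "?c ?P ?Y ?Z (h Y Z g) (h P Y f) = ?c ?P Z ?Z (d Z) (?c ?P ?Y Z (?c ?Y Y Z g (e Y)) (h P Y f))"
      unfolding h_def[of Y Z] by (rule ass) (auto simp: mems ge h_mem)
    also have "?c ?P ?Y Z (?c ?Y Y Z g (e Y)) (h P Y f) = ?c ?P Y Z g (?c ?P ?Y Y (e Y) (h P Y f))"
      by (rule ass) (auto simp: mems h_mem)
    also have "\<dots> = ?c ?P Y Z g (?c ?P P Y f (e P))" by (simp add: e_h)
    also have "\<dots> = ?c ?P P Z (?c P Y Z g f) (e P)"
      by (rule ass[symmetric]) (auto simp: mems)
    finally show ?thesis unfolding h_def[of P Z] by simp
  qed
  have Gfun: "covariant_functor D C G"
  proof (unfold_locales, goal_cases)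
    case (1 V) then show ?case by (simp add: G_ob G0)
  next
    case (2 V Y f) then show ?case by (simp add: G_ob G_hom G0 h_mem inv_mem)
  next
    case (3 V)
    then show ?case unfolding G_ob G_hom h_id[OF 3]
      by (intro inj[of "G0 V" "G0 V"]) (auto simp: G0 inv_mem F_inv F.map_ident FG F.target.ident_closed F.source.ident_closed)
  next
    case (4 V Y Z f g)
    have "?c V Y Z g f \<in> Hom D V Z" by (rule cl[OF 4])
    then show ?case using 4 unfolding G_ob G_hom
      by (intro inj[of "G0 V" "G0 Z"])
         (auto simp: G0 inv_mem F_inv F.map_comp FG h_mem h_comp[OF 4, symmetric] F.source.comp_closed[of _ "G0 Y"])
  qed
  have FGiso: "naturally_isomorphic D D (comp_functor F G) id_functor"
    unfolding naturally_isomorphic_def comp_functor_def id_functor_def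
    apply (rule exI[of _ e])
    using e d de ed by (auto simp: iso_hom_def G_ob G_hom F_inv G0 h_mem e_h intro!: bexI[of _ "d _"])
  \<comment> \<open>The isomorphism of \<open>G (F V)\<close> with \<open>V\<close> lifts \<open>e (F V)\<close>.\<close>
  define nu where "nu V = lft (G0 (on_ob F V)) V (e (on_ob F V))" for V
  define nu' where "nu' V = lft V (G0 (on_ob F V)) (d (on_ob F V))" for V
  have n_mem: "nu V \<in> Hom C (G0 (on_ob F V)) V" and n'_mem: "nu' V \<in> Hom C V (G0 (on_ob F V))"
    and Fn: "on_hom F (G0 (on_ob F V)) V (nu V) = e (on_ob F V)"
    and Fn': "on_hom F V (G0 (on_ob F V)) (nu' V) = d (on_ob F V)"
    if "V \<in> Ob C" for V
    unfolding nu_def nu'_def using that by (auto simp: mems inv_mem F_inv)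
  have 1: "Comp C (G0 (on_ob F V)) V (G0 (on_ob F V)) (nu' V) (nu V) = Ident C (G0 (on_ob F V))" if "V \<in> Ob C" for V
    using that by (intro inj[of "G0 (on_ob F V)" "G0 (on_ob F V)"])
      (auto simp: mems n_mem n'_mem F.map_comp F.map_ident Fn Fn' de F.source.ident_closed F.source.comp_closed[of _ V])
  have 2: "Comp C V (G0 (on_ob F V)) V (nu V) (nu' V) = Ident C V" if "V \<in> Ob C" for V
    using that by (intro inj[of V V])
      (auto simp: mems n_mem n'_mem F.map_comp F.map_ident Fn Fn' ed F.source.ident_closed F.source.comp_closed[of _ "G0 (on_ob F V)"])
  have 3: "Comp C (G0 (on_ob F V)) (G0 (on_ob F Y)) Y (nu Y) (lft (G0 (on_ob F V)) (G0 (on_ob F Y)) (h (on_ob F V) (on_ob F Y) (on_hom F V Y f)))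
     = Comp C (G0 (on_ob F V)) V Y f (nu V)" if that: "V \<in> Ob C" "Y \<in> Ob C" "f \<in> Hom C V Y" for V Y f
    using that by (intro inj[of "G0 (on_ob F V)" Y])
      (auto simp: mems n_mem n'_mem F.map_comp F.map_ident Fn Fn' ed inv_mem F_inv h_mem e_h F.source.ident_closed F.source.comp_closed[of _ V] F.source.comp_closed[of _ "G0 (on_ob F Y)"])
  have GFiso: "naturally_isomorphic C C (comp_functor G F) id_functor"
    unfolding naturally_isomorphic_def comp_functor_def id_functor_def
    apply (rule exI[of _ nu])
    using n_mem n'_mem 1 2 3 by (auto simp: iso_hom_def G_ob G_hom intro!: bexI[of _ "nu' _"])
  show ?thesis unfolding equivalent_categories_def
    using F.source.category_axioms F.target.category_axioms F Gfun FGiso GFiso by blast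
qed

section \<open>Gr-division superalgebras over an algebraically closed field\<close>

lemma (in field) algebraically_closed_root:
  assumes "algebraically_closed R" "p \<noteq> []" "set p \<subseteq> carrier R" "hd p \<noteq> \<zero>" "length p \<ge> 2"
  obtains r where "r \<in> carrier R" "eval p r = \<zero>"
proof -
  have p: "p \<in> carrier (poly_ring R)"
    using assms by (simp add: univ_poly_carrier[symmetric] polynomial_def)
  then have "splitted p" using assms(1) algebraically_closed.roots_over_carrier by blast
  then have "size (roots p) \<noteq> 0" using assms(5) by (simp add: splitted_def)
  then obtain r where "r \<in># roots p" by (metis multiset_nonemptyE size_empty)
  then have "is_root p r" using roots_mem_iff_is_root[OF p] by simp
  then show thesis using that by (auto simp: is_root_def)
qed

lemma (in ring) eval_append_single:
  assumes "set p \<subseteq> carrier R" "c \<in> carrier R" "r \<in> carrier R"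
  shows "eval (p @ [c]) r = eval p r \<otimes> r \<oplus> c"
  using assms
proof (induction p)
  case (Cons b p)
  have e: "eval p r \<in> carrier R" using Cons.prems by (auto intro: eval_in_carrier)
  have "eval ((b # p) @ [c]) r = b \<otimes> (r [^] length p \<otimes> r) \<oplus> (eval p r \<otimes> r \<oplus> c)"
    using Cons by simp
  also have "\<dots> = (b \<otimes> r [^] length p \<oplus> eval p r) \<otimes> r \<oplus> c"
    using Cons.prems e by (simp add: l_distr a_assoc m_assoc)
  finally show ?case by simp
qed simp

text \<open>An isomorphism of \<open>A\<close> with a model algebra is required to start from \<open>A\<close>, whereas the
  natural formula, linear combinations of chosen elements of \<open>A\<close>, starts from the model.\<close>

lemma superalgebra_iso_via_inverse:
  assumes g: "bij_betw g (carrier B) (carrier A)" "g \<in> ring_hom B A" "g \<in> module_hom K B A"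
    and h: "\<And>z. g ` hcomp B z = hcomp A z" "\<And>z. hcomp B z \<subseteq> carrier B"
    and B: "\<And>x y. \<lbrakk>x \<in> carrier B; y \<in> carrier B\<rbrakk> \<Longrightarrow> x \<otimes>\<^bsub>B\<^esub> y \<in> carrier B"
      "\<And>x y. \<lbrakk>x \<in> carrier B; y \<in> carrier B\<rbrakk> \<Longrightarrow> x \<oplus>\<^bsub>B\<^esub> y \<in> carrier B"
      "\<And>c y. \<lbrakk>c \<in> carrier K; y \<in> carrier B\<rbrakk> \<Longrightarrow> c \<odot>\<^bsub>B\<^esub> y \<in> carrier B"
      "\<one>\<^bsub>B\<^esub> \<in> carrier B"
  shows "superalgebra_iso K A B"
proof -
  let ?h = "inv_into (carrier B) g"
  have inj: "inj_on g (carrier B)" and im: "g ` carrier B = carrier A"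
    using g(1) by (auto simp: bij_betw_def)
  have hg: "?h (g x) = x" if "x \<in> carrier B" for x using inj that by simp
  have ex: "\<exists>x'\<in>carrier B. x = g x'" if "x \<in> carrier A" for x using im that by blast
  have "?h \<in> ring_hom A B"
  proof (rule ring_hom_memI)
    fix x assume "x \<in> carrier A" then show "?h x \<in> carrier B" using ex hg by force
  next
    fix x y assume "x \<in> carrier A" "y \<in> carrier A"
    then obtain x' y' where [simp]: "x' \<in> carrier B" "y' \<in> carrier B" "x = g x'" "y = g y'"
      using ex by metis
    show "?h (x \<otimes>\<^bsub>A\<^esub> y) = ?h x \<otimes>\<^bsub>B\<^esub> ?h y" "?h (x \<oplus>\<^bsub>A\<^esub> y) = ?h x \<oplus>\<^bsub>B\<^esub> ?h y"
      using ring_hom_mult[OF g(2), of x' y'] ring_hom_add[OF g(2), of x' y']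
      by (simp_all add: B hg flip: ring_hom_mult[OF g(2)] ring_hom_add[OF g(2)])
  next
    show "?h \<one>\<^bsub>A\<^esub> = \<one>\<^bsub>B\<^esub>" using ring_hom_one[OF g(2)] hg B(4) by metis
  qed
  moreover have "?h \<in> module_hom K A B"
    unfolding module_hom_def
  proof (intro CollectI conjI allI impI; (elim conjE)?)
    show "?h \<in> carrier A \<rightarrow> carrier B" using ex hg by force
  next
    fix x y assume "x \<in> carrier A" "y \<in> carrier A"
    then obtain x' y' where [simp]: "x' \<in> carrier B" "y' \<in> carrier B" "x = g x'" "y = g y'"
      using ex by metis
    show "?h (x \<oplus>\<^bsub>A\<^esub> y) = ?h x \<oplus>\<^bsub>B\<^esub> ?h y"
      by (simp add: B hg flip: ring_hom_add[OF g(2)])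
  next
    fix c x assume [simp]: "c \<in> carrier K" "x \<in> carrier A"
    then obtain x' where [simp]: "x' \<in> carrier B" "x = g x'"
      using ex by metis
    show "?h (c \<odot>\<^bsub>A\<^esub> x) = c \<odot>\<^bsub>B\<^esub> ?h x"
      by (simp add: B hg flip: module_hom_smult[OF g(3)])
  qed
  moreover have "?h ` hcomp A z = hcomp B z" for z
    using h(1)[of z, symmetric] inv_into_image_cancel[OF inj h(2)[of z]] by simp
  moreover have "bij_betw ?h (carrier A) (carrier B)" using g(1) by (rule bij_betw_inv_into)
  ultimately show ?thesis unfolding superalgebra_iso_def by blast
qed

lemma (in abelian_group) add_eq_imp_minus_eq:
  assumes "x \<in> carrier G" "y \<in> carrier G" "x' \<in> carrier G" "y' \<in> carrier G" "x \<oplus> y = x' \<oplus> y'"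
  shows "x \<ominus> x' = y' \<ominus> y"
proof -
  have "x \<ominus> x' = (x \<oplus> y) \<oplus> (\<ominus> y \<oplus> \<ominus> x')"
    using assms(1-4) by (simp add: minus_eq a_assoc r_neg2)
  also have "\<dots> = (y' \<oplus> x') \<oplus> (\<ominus> x' \<oplus> \<ominus> y)"
    using assms by (simp add: a_comm)
  also have "\<dots> = y' \<ominus> y"
    using assms(1-4) by (simp add: minus_eq a_assoc r_neg2)
  finally show ?thesis .
qed

abbreviation purely_even :: "('k, 'a) graded \<Rightarrow> bool" where
  "purely_even A \<equiv> hcomp A 1 = {\<zero>\<^bsub>A\<^esub>}"

text \<open>The element \<open>\<epsilon>\<close>.  It is set to zero in the absence of odd elements, so that the algebra is
  \<open>K 1 + K \<epsilon>\<close> in both cases.\<close>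

definition odd_unit :: "('k, 'a) graded \<Rightarrow> 'a" where
  "odd_unit A = (if purely_even A then \<zero>\<^bsub>A\<^esub> else SOME e. e \<in> hcomp A 1 \<and> e \<otimes>\<^bsub>A\<^esub> e = \<one>\<^bsub>A\<^esub>)"

locale closed_superdivision = gr_division_superalgebra K A + ground?: algebraically_closed K
  for K :: "('k, 'r) ring_scheme" and A :: "('k, 'a) graded" (structure) +
  assumes fin_dim_A: "vectorspace.fin_dim K A"
begin

text \<open>Horner evaluation of the polynomial with coefficient list \<open>p\<close>, leading coefficient first, at an
  element of an algebra that is not known to be commutative.\<close>

definition ev :: "'k list \<Rightarrow> 'a \<Rightarrow> 'a" where
  "ev p a = foldl (\<lambda>w c. w \<otimes> a \<oplus> c \<odot> \<one>) \<zero> p"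

lemma ev_Nil [simp]: "ev [] a = \<zero>"
  and ev_snoc [simp]: "ev (p @ [c]) a = ev p a \<otimes> a \<oplus> c \<odot> \<one>"
  by (simp_all add: ev_def)

lemma ev_closed [simp]: "set p \<subseteq> carrier K \<Longrightarrow> a \<in> carrier A \<Longrightarrow> ev p a \<in> carrier A"
  by (induction p rule: rev_induct) auto

lemma ev_Cons:
  assumes "set p \<subseteq> carrier K" "c \<in> carrier K" "a \<in> carrier A"
  shows "ev (c # p) a = c \<odot> a [^] length p \<oplus> ev p a"
  using assms
proof (induction p rule: rev_induct)
  case Nil
  then show ?case using ev_snoc[of "[]" c a] by simp
next
  case (snoc d p)
  then show ?case using ev_snoc[of "c # p" d a]
    by (simp add: A.l_distr M.a_assoc smult_mult_left)
qed

text \<open>Synthetic division by the linear polynomial with root \<open>r\<close>.  The quotient has the same leading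
  coefficient, which keeps it from vanishing.\<close>

lemma ev_divide_linear:
  assumes "set p \<subseteq> carrier K" "r \<in> carrier K" "a \<in> carrier A" "p \<noteq> []"
  shows "\<exists>q. length q = length p - 1 \<and> set q \<subseteq> carrier K \<and> (length p \<ge> 2 \<longrightarrow> hd q = hd p) \<and>
    ev p a = (a \<ominus> r \<odot> \<one>) \<otimes> ev q a \<oplus> R.eval p r \<odot> \<one>"
  using assms(1,4)
proof (induction p rule: rev_induct)
  case (snoc c p)
  show ?case
  proof (cases "p = []")
    case True
    then show ?thesis using snoc.prems assms(2,3) ev_snoc[of "[]" c a]
      by (intro exI[of _ "[]"]) simp
  next
    case False
    let ?b = "a \<ominus> r \<odot> \<one>" and ?e = "R.eval p r"
    obtain q where q: "length q = length p - 1" "set q \<subseteq> carrier K" "length p \<ge> 2 \<longrightarrow> hd q = hd p"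
      "ev p a = ?b \<otimes> ev q a \<oplus> ?e \<odot> \<one>" using snoc False by auto
    have e: "?e \<in> carrier K" using snoc.prems assms(2) by (auto intro: R.eval_in_carrier)
    have hd: "hd (q @ [?e]) = hd (p @ [c])"
    proof (cases "length p \<ge> 2")
      case True
      then show ?thesis using q(1,3) False by (cases q) auto
    next
      case f: False
      then obtain d where d: "p = [d]" using False by (cases p rule: list.exhaust) (auto simp: Suc_le_eq)
      then show ?thesis using q(1) snoc.prems assms(2) by simp
    qed
    have b: "?b \<in> carrier A" using assms by simp
    have qa: "ev q a \<in> carrier A" using q(2) assms(3) by simp
    have "ev (p @ [c]) a = (?b \<otimes> ev q a \<oplus> ?e \<odot> \<one>) \<otimes> a \<oplus> c \<odot> \<one>"
      using q(4) by simp
    also have "\<dots> = (?b \<otimes> (ev q a \<otimes> a) \<oplus> ?e \<odot> a) \<oplus> c \<odot> \<one>"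
      using b qa e assms(3) by (simp add: A.l_distr A.m_assoc smult_mult_left)
    also have "?e \<odot> a = ?b \<otimes> (?e \<odot> \<one>) \<oplus> (?e \<otimes>\<^bsub>K\<^esub> r) \<odot> \<one>"
    proof -
      have "?b \<otimes> (?e \<odot> \<one>) = ?e \<odot> ?b" using b e by (simp add: smult_mult_right)
      also have "?e \<odot> ?b = ?e \<odot> a \<ominus> (?e \<otimes>\<^bsub>K\<^esub> r) \<odot> \<one>"
        using e assms(2,3) by (simp add: M.minus_eq smult_r_distr smult_r_minus smult_assoc1)
      finally show ?thesis using e assms(2,3)
        by (simp add: M.minus_eq M.a_assoc M.l_neg)
    qed
    also have "(?b \<otimes> (ev q a \<otimes> a) \<oplus> (?b \<otimes> (?e \<odot> \<one>) \<oplus> (?e \<otimes>\<^bsub>K\<^esub> r) \<odot> \<one>)) \<oplus> c \<odot> \<one>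
        = ?b \<otimes> ev (q @ [?e]) a \<oplus> R.eval (p @ [c]) r \<odot> \<one>"
      using snoc.prems b qa e assms(2,3)
      by (simp add: R.eval_append_single smult_l_distr A.r_distr M.a_assoc)
    finally show ?thesis using q hd e False
      by (intro exI[of _ "q @ [?e]"]) (auto simp: Suc_leI)
  qed
qed simp

text \<open>Let \<open>r\<close> be a root of \<open>p\<close> in \<open>K\<close>.  The even element \<open>a - r\<close> is zero or invertible, and in the
  second case \<open>a\<close> is annihilated by the quotient of \<open>p\<close> by the linear factor, which has smaller degree.\<close>

lemma even_root_is_scalar:
  assumes "a \<in> hcomp A 0" "p \<noteq> []" "set p \<subseteq> carrier K" "hd p \<noteq> \<zero>\<^bsub>K\<^esub>" "ev p a = \<zero>"
  shows "\<exists>r\<in>carrier K. a = r \<odot> \<one>"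
  using assms(2-)
proof (induction "length p" arbitrary: p rule: less_induct)
  case less
  interpret A0: additive_subgroup "hcomp A 0" A using grading by (simp add: z2_grading_def)
  have a: "a \<in> carrier A" using assms(1) A0.a_subset by blast
  show ?case
  proof (cases "length p \<ge> 2")
    case True
    obtain r where r: "r \<in> carrier K" "R.eval p r = \<zero>\<^bsub>K\<^esub>"
      using field.algebraically_closed_root[OF ground.algebraically_closed_axioms] less.prems True by metis
    obtain q where q: "length q = length p - 1" "set q \<subseteq> carrier K" "hd q = hd p"
      "ev p a = (a \<ominus> r \<odot> \<one>) \<otimes> ev q a \<oplus> R.eval p r \<odot> \<one>"
      using ev_divide_linear[OF less.prems(2) r(1) a] less.prems True by metis
    let ?b = "a \<ominus> r \<odot> \<one>"
    have b0: "?b \<in> hcomp A 0"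
      using assms(1) r(1) by (simp add: M.minus_eq A0.a_closed A0.a_inv_closed smult_graded one_graded)
    have b: "?b \<in> carrier A" and qa: "ev q a \<in> carrier A" using a r q by simp_all
    have z: "?b \<otimes> ev q a = \<zero>" using q(4) r less.prems b qa by simp
    show ?thesis
    proof (cases "?b = \<zero>")
      case True
      then show ?thesis using a r(1) by (intro bexI[of _ r]) simp_all
    next
      case False
      then have u: "?b \<in> Units A" using homogeneous_invertible b0 by blast
      have "ev q a = inv ?b \<otimes> (?b \<otimes> ev q a)"
        using u qa b by (simp add: A.Units_l_inv flip: A.m_assoc)
      then have "ev q a = \<zero>" using z u by simp
      moreover have "length q < length p" "q \<noteq> []" using q(1) True by auto
      ultimately show ?thesis using less.hyps[of q] q less.prems by auto
    qed
  next
    case False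
    then obtain c where c: "p = [c]" using less.prems by (cases p rule: list.exhaust) (auto simp: Suc_le_eq)
    then have cK: "c \<in> carrier K" "c \<noteq> \<zero>\<^bsub>K\<^esub>" and z: "c \<odot> \<one> = \<zero>"
      using less.prems ev_snoc[of "[]" c a] a by auto
    have "\<one> = (inv\<^bsub>K\<^esub> c \<otimes>\<^bsub>K\<^esub> c) \<odot> \<one>" using cK by (simp add: field_Units)
    also have "\<dots> = inv\<^bsub>K\<^esub> c \<odot> (c \<odot> \<one>)" using cK by (intro smult_assoc1) (auto simp: field_Units)
    also have "\<dots> = \<zero>" using z cK by (simp add: field_Units)
    finally show ?thesis using nontrivial by simp
  qed
qed

text \<open>The values of all polynomials of degree less than \<open>n\<close>, leading zeros being allowed, form a
  subspace; it therefore contains the span of the powers of \<open>a\<close> below \<open>n\<close>.\<close>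

lemma ev_list_submodule:
  assumes "a \<in> carrier A"
  shows "submodule K {ev q a | q. length q = n \<and> set q \<subseteq> carrier K} A" (is "submodule K (?W n) A")
proof -
  have add: "x \<in> ?W n \<Longrightarrow> y \<in> ?W n \<Longrightarrow> x \<oplus> y \<in> ?W n" for x y
  proof (induction n arbitrary: x y)
    case (Suc n)
    obtain p c q d where *: "length p = n" "set p \<subseteq> carrier K" "c \<in> carrier K" "x = ev (p @ [c]) a"
      "length q = n" "set q \<subseteq> carrier K" "d \<in> carrier K" "y = ev (q @ [d]) a"
      using Suc.prems by (auto simp: length_Suc_conv_rev)
    obtain s where s: "length s = n" "set s \<subseteq> carrier K" "ev p a \<oplus> ev q a = ev s a"
      using Suc.IH[of "ev p a" "ev q a"] * by blast
    have "x \<oplus> y = ev (s @ [c \<oplus>\<^bsub>K\<^esub> d]) a"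
      using * s assms by (simp flip: s(3) add: A.l_distr smult_l_distr M.a_ac)
    then show ?case using s * by (intro CollectI exI[of _ "s @ [c \<oplus>\<^bsub>K\<^esub> d]"]) auto
  qed simp
  have sm: "x \<in> ?W n \<Longrightarrow> r \<in> carrier K \<Longrightarrow> r \<odot> x \<in> ?W n" for x r
  proof (induction n arbitrary: x)
    case (Suc n)
    obtain p c where *: "length p = n" "set p \<subseteq> carrier K" "c \<in> carrier K" "x = ev (p @ [c]) a"
      using Suc.prems by (auto simp: length_Suc_conv_rev)
    obtain s where s: "length s = n" "set s \<subseteq> carrier K" "r \<odot> ev p a = ev s a"
      using Suc.IH[of "ev p a"] * Suc.prems(2) by blast
    have "r \<odot> x = ev (s @ [r \<otimes>\<^bsub>K\<^esub> c]) a"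
      using * s assms Suc.prems(2) by (simp flip: s(3) add: smult_r_distr smult_assoc1 smult_mult_left)
    then show ?case using s * Suc.prems(2) by (intro CollectI exI[of _ "s @ [r \<otimes>\<^bsub>K\<^esub> c]"]) auto
  qed simp
  have z: "\<zero> \<in> ?W n"
  proof -
    have "ev (replicate n \<zero>\<^bsub>K\<^esub>) a = \<zero>"
      using assms by (induction n) (simp_all add: replicate_append_same[symmetric] del: replicate_append_same)
    then show ?thesis by (intro CollectI exI[of _ "replicate n \<zero>\<^bsub>K\<^esub>"]) auto
  qed
  show ?thesis
    using add sm z assms by (intro LinearCombinations.submodule.intro module_axioms) auto
qed

lemma pow_in_ev_lists:
  assumes "a \<in> carrier A" "k < n"
  shows "a [^] k \<in> {ev q a | q. length q = n \<and> set q \<subseteq> carrier K}"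
  using assms(2)
proof (induction n arbitrary: k)
  case (Suc n)
  interpret W: submodule K "{ev q a | q. length q = n \<and> set q \<subseteq> carrier K}" A
    by (rule ev_list_submodule[OF assms(1)])
  show ?case
  proof (cases k)
    case 0
    obtain q where q: "length q = n" "set q \<subseteq> carrier K" "ev q a = \<zero>"
      using W.zero_closed by auto
    then show ?thesis using 0 assms(1) by (intro CollectI exI[of _ "q @ [\<one>\<^bsub>K\<^esub>]"]) simp
  next
    case (Suc j)
    then obtain q where q: "length q = n" "set q \<subseteq> carrier K" "a [^] j = ev q a"
      using Suc.IH[of j] Suc.prems by auto
    then show ?thesis using Suc assms(1) by (intro CollectI exI[of _ "q @ [\<zero>\<^bsub>K\<^esub>]"]) simp
  qed
qed simp

text \<open>Finite dimension makes some power of \<open>a\<close> a linear combination of the preceding ones, which gives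
  a nonzero polynomial that annihilates \<open>a\<close>.\<close>

lemma even_is_scalar:
  assumes "a \<in> hcomp A 0"
  shows "\<exists>r\<in>carrier K. a = r \<odot> \<one>"
proof -
  interpret A0: additive_subgroup "hcomp A 0" A using grading by (simp add: z2_grading_def)
  have a: "a \<in> carrier A" using assms A0.a_subset by blast
  let ?S = "\<lambda>n::nat. (\<lambda>k::nat. a [^] k) ` {..<n}"
  have S: "?S n \<subseteq> carrier A" for n using a by auto
  \<comment> \<open>Otherwise the first \<open>n\<close> powers would be independent for every \<open>n\<close>, exceeding the dimension.\<close>
  have "\<exists>n. a [^] n \<in> span (?S n)"
  proof (rule ccontr)
    assume no: "\<nexists>n. a [^] n \<in> span (?S n)"
    have notin: "a [^] n \<notin> ?S n" for n using no in_own_span[OF S] by blast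
    have "lin_indpt (?S n) \<and> card (?S n) = n" for n
    proof (induction n)
      case 0
      show ?case by (simp add: lin_dep_def)
    next
      case (Suc n)
      have "lin_indpt (?S n \<union> {a [^] n})"
        using lin_dep_iff_in_span[OF S, of n "a [^] n"] Suc no notin a by auto
      moreover have "?S (Suc n) = ?S n \<union> {a [^] n}" by (auto simp: lessThan_Suc)
      ultimately show ?case using Suc notin[of n] by simp
    qed
    then have "n \<le> vectorspace.dim K A" for n
      using li_le_dim(2)[OF fin_dim_A S, of n] by simp
    then show False by (metis Suc_n_not_le_n)
  qed
  then obtain n where n: "a [^] n \<in> span (?S n)" by blast
  have "span (?S n) \<subseteq> {ev q a | q. length q = n \<and> set q \<subseteq> carrier K}"
    using pow_in_ev_lists[OF a] by (intro span_is_subset ev_list_submodule a) auto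
  with n obtain q where q: "length q = n" "set q \<subseteq> carrier K" "a [^] n = ev q a" by auto
  have "ev ((\<ominus>\<^bsub>K\<^esub> \<one>\<^bsub>K\<^esub>) # q) a = \<zero>"
    using q a by (simp add: ev_Cons smult_l_minus M.l_neg)
  moreover have "\<ominus>\<^bsub>K\<^esub> \<one>\<^bsub>K\<^esub> \<noteq> \<zero>\<^bsub>K\<^esub>" by simp
  ultimately show ?thesis using q(2) by (intro even_root_is_scalar[OF assms, of "(\<ominus>\<^bsub>K\<^esub> \<one>\<^bsub>K\<^esub>) # q"]) auto
qed

lemma hcomp_A_subset: "hcomp A z \<subseteq> carrier A"
  using grading additive_subgroup.a_subset unfolding z2_grading_def by blast

lemma zero_in_hcomp_A: "\<zero> \<in> hcomp A z"
  using grading additive_subgroup.zero_closed unfolding z2_grading_def by blast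

lemma hcomp_A_0: "hcomp A 0 = (\<lambda>c. c \<odot> \<one>) ` carrier K"
  using even_is_scalar one_graded smult_graded by blast

lemma hcomp_A_disjoint: "x \<in> hcomp A 0 \<Longrightarrow> x \<in> hcomp A 1 \<Longrightarrow> x = \<zero>"
  using grading unfolding z2_grading_def by blast

lemma scalar_eq_zeroD:
  assumes "c \<in> carrier K" "x \<in> carrier A" "c \<odot> x = \<zero>" "x \<noteq> \<zero>"
  shows "c = \<zero>\<^bsub>K\<^esub>"
proof (rule ccontr)
  assume "c \<noteq> \<zero>\<^bsub>K\<^esub>"
  then have c: "c \<in> Units K" using assms(1) by (simp add: field_Units)
  then have "x = inv\<^bsub>K\<^esub> c \<odot> (c \<odot> x)"
    using assms(1,2) by (simp flip: smult_assoc1)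
  then show False using assms(3,4) c by simp
qed

lemma scalar_inj:
  assumes "c \<in> carrier K" "d \<in> carrier K" "x \<in> carrier A" "c \<odot> x = d \<odot> x" "x \<noteq> \<zero>"
  shows "c = d"
proof -
  have "(c \<ominus>\<^bsub>K\<^esub> d) \<odot> x = \<zero>"
    using assms by (simp add: R.minus_eq smult_l_distr smult_l_minus M.r_neg)
  then have "c \<ominus>\<^bsub>K\<^esub> d = \<zero>\<^bsub>K\<^esub>" using assms by (intro scalar_eq_zeroD[of _ x]) auto
  then show ?thesis using assms by simp
qed

text \<open>The square of a nonzero odd element is invertible and even, hence a nonzero scalar \<open>c\<close>; divide
  the element by a square root of \<open>c\<close>.\<close>

lemma odd_unit_exists:
  assumes "\<not> purely_even A"
  shows "\<exists>e. e \<in> hcomp A 1 \<and> e \<otimes> e = \<one>"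
proof -
  obtain x where x: "x \<in> hcomp A 1" "x \<noteq> \<zero>" using assms zero_in_hcomp_A[of 1] by blast
  then have xA: "x \<in> carrier A" and xU: "x \<in> Units A"
    using hcomp_A_subset homogeneous_invertible by blast+
  have "x \<otimes> x \<in> hcomp A 0" using mult_graded[OF x(1) x(1)] by simp
  then obtain c where c: "c \<in> carrier K" "x \<otimes> x = c \<odot> \<one>"
    using even_is_scalar by blast
  have "c \<noteq> \<zero>\<^bsub>K\<^esub>"
  proof
    assume "c = \<zero>\<^bsub>K\<^esub>"
    then have "x \<otimes> x = \<zero>" using c by simp
    then have "inv x \<otimes> (x \<otimes> x) = \<zero>" using xU by simp
    then show False using x(2) xU xA by (simp flip: A.m_assoc)
  qed
  \<comment> \<open>A square root of \<open>c\<close>, as a root of the polynomial with coefficients \<open>1, 0, -c\<close>.\<close>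
  obtain r where r: "r \<in> carrier K" "R.eval [\<one>\<^bsub>K\<^esub>, \<zero>\<^bsub>K\<^esub>, \<ominus>\<^bsub>K\<^esub> c] r = \<zero>\<^bsub>K\<^esub>"
    by (rule field.algebraically_closed_root[OF ground.algebraically_closed_axioms,
      of "[\<one>\<^bsub>K\<^esub>, \<zero>\<^bsub>K\<^esub>, \<ominus>\<^bsub>K\<^esub> c]"]) (use c in auto)
  then have "r \<otimes>\<^bsub>K\<^esub> r \<ominus>\<^bsub>K\<^esub> c = \<zero>\<^bsub>K\<^esub>" using c by (simp add: numeral_2_eq_2 R.minus_eq)
  then have rr: "r \<otimes>\<^bsub>K\<^esub> r = c" using r c by simp
  with \<open>c \<noteq> \<zero>\<^bsub>K\<^esub>\<close> have "r \<noteq> \<zero>\<^bsub>K\<^esub>" using r by auto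
  then have rU: "r \<in> Units K" using r by (simp add: field_Units)
  let ?s = "inv\<^bsub>K\<^esub> r"
  have "(?s \<odot> x) \<otimes> (?s \<odot> x) = (?s \<otimes>\<^bsub>K\<^esub> (?s \<otimes>\<^bsub>K\<^esub> (r \<otimes>\<^bsub>K\<^esub> r))) \<odot> \<one>"
    using rU xA r c by (simp add: smult_mult_left smult_mult_right smult_assoc1 rr)
  also have "?s \<otimes>\<^bsub>K\<^esub> (?s \<otimes>\<^bsub>K\<^esub> (r \<otimes>\<^bsub>K\<^esub> r)) = ?s \<otimes>\<^bsub>K\<^esub> ((?s \<otimes>\<^bsub>K\<^esub> r) \<otimes>\<^bsub>K\<^esub> r)"
    using rU r by (simp only: R.m_assoc R.Units_inv_closed)
  also have "\<dots> = \<one>\<^bsub>K\<^esub>" using rU r by simp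
  finally show ?thesis using smult_graded[OF _ x(1), of ?s] rU
    by (intro exI[of _ "?s \<odot> x"]) simp
qed

context
  assumes odd: "\<not> purely_even A"
begin

lemma odd_unit_props: "odd_unit A \<in> hcomp A 1" "odd_unit A \<otimes> odd_unit A = \<one>"
  using someI_ex[OF odd_unit_exists[OF odd]] odd by (auto simp: odd_unit_def)

lemma odd_unit_carrier [simp]: "odd_unit A \<in> carrier A"
  using odd_unit_props(1) hcomp_A_subset by blast

lemma odd_unit_nonzero [simp]: "odd_unit A \<noteq> \<zero>"
proof
  assume "odd_unit A = \<zero>"
  then have "\<one> = \<zero>" using odd_unit_props(2) by simp
  then show False using nontrivial by simp
qed

lemma hcomp_A_1: "hcomp A 1 = (\<lambda>c. c \<odot> odd_unit A) ` carrier K"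
proof
  show "(\<lambda>c. c \<odot> odd_unit A) ` carrier K \<subseteq> hcomp A 1"
    using odd_unit_props smult_graded by blast
  show "hcomp A 1 \<subseteq> (\<lambda>c. c \<odot> odd_unit A) ` carrier K"
  proof
    fix y assume y: "y \<in> hcomp A 1"
    then have yA: "y \<in> carrier A" using hcomp_A_subset by blast
    obtain c where c: "c \<in> carrier K" "y \<otimes> odd_unit A = c \<odot> \<one>"
      using even_is_scalar mult_graded[OF y odd_unit_props(1)] by auto
    have "y = y \<otimes> (odd_unit A \<otimes> odd_unit A)" using yA by (simp add: odd_unit_props)
    also have "\<dots> = (c \<odot> \<one>) \<otimes> odd_unit A" using yA c(2) by (simp flip: A.m_assoc)
    also have "\<dots> = c \<odot> odd_unit A" using c(1) by (simp add: smult_mult_left)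
    finally show "y \<in> (\<lambda>c. c \<odot> odd_unit A) ` carrier K" using c(1) by blast
  qed
qed

text \<open>Comparing degrees: the difference of the two sides has an even and an odd part, and both vanish.\<close>

lemma one_odd_unit_independent:
  assumes K: "c \<in> carrier K" "d \<in> carrier K" "c' \<in> carrier K" "d' \<in> carrier K"
    and eq: "c \<odot> \<one> \<oplus> d \<odot> odd_unit A = c' \<odot> \<one> \<oplus> d' \<odot> odd_unit A"
  shows "c = c' \<and> d = d'"
proof -
  have z: "(c \<ominus>\<^bsub>K\<^esub> c') \<odot> \<one> = (d' \<ominus>\<^bsub>K\<^esub> d) \<odot> odd_unit A"
    using M.add_eq_imp_minus_eq[OF _ _ _ _ eq] K
    by (simp add: R.minus_eq M.minus_eq smult_l_distr smult_l_minus)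
  have "(c \<ominus>\<^bsub>K\<^esub> c') \<odot> \<one> \<in> hcomp A 0" "(d' \<ominus>\<^bsub>K\<^esub> d) \<odot> odd_unit A \<in> hcomp A 1"
    using K by (auto intro: smult_graded one_graded odd_unit_props)
  then have "(c \<ominus>\<^bsub>K\<^esub> c') \<odot> \<one> = \<zero>" "(d' \<ominus>\<^bsub>K\<^esub> d) \<odot> odd_unit A = \<zero>"
    using z hcomp_A_disjoint by force+
  then have "c \<ominus>\<^bsub>K\<^esub> c' = \<zero>\<^bsub>K\<^esub>" "d' \<ominus>\<^bsub>K\<^esub> d = \<zero>\<^bsub>K\<^esub>"
    using K odd_unit_nonzero scalar_eq_zeroD[of _ "\<one>"] scalar_eq_zeroD[of _ "odd_unit A"] nontrivial by auto
  then show ?thesis using K by auto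
qed

lemma is_odd_if: "is_odd K A"
proof -
  let ?B = "odd_superalgebra K" and ?e = "odd_unit A"
  let ?g = "\<lambda>(c, d). c \<odot> \<one> \<oplus> d \<odot> ?e"
  have im: "?g ` carrier ?B = carrier A"
  proof -
    have "?g ` carrier ?B = hcomp A 0 <+> hcomp A 1"
      unfolding hcomp_A_0 hcomp_A_1 set_add_def set_mult_def by (force simp: odd_superalgebra_def)
    then show ?thesis using grading by (simp add: z2_grading_def)
  qed
  show ?thesis
  proof (rule superalgebra_iso_via_inverse[of ?g])
    show "bij_betw ?g (carrier ?B) (carrier A)"
      unfolding bij_betw_def using im one_odd_unit_independent by (auto simp: inj_on_def odd_superalgebra_def)
    show "?g \<in> ring_hom ?B A"
      by (rule ring_hom_memI)
        (auto simp: odd_superalgebra_def A.l_distr A.r_distr smult_mult_left smult_mult_right smult_l_distr smult_r_distr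
          odd_unit_props R.m_comm M.a_ac simp flip: smult_assoc1)
    show "?g \<in> module_hom K ?B A"
      unfolding module_hom_def
      by (auto simp: odd_superalgebra_def smult_l_distr smult_r_distr smult_assoc1 M.a_ac)
    show "?g ` hcomp ?B z = hcomp A z" for z
      by (cases z) (force simp: odd_superalgebra_def hcomp_A_0 hcomp_A_1)+
  qed (auto simp: odd_superalgebra_def)
qed

end

lemma is_ground_if:
  assumes "purely_even A"
  shows "is_ground K A"
proof -
  let ?B = "ground_superalgebra K"
  let ?g = "\<lambda>c. c \<odot> \<one>"
  have im: "?g ` carrier ?B = carrier A"
  proof -
    have "?g ` carrier ?B = hcomp A 0 <+> hcomp A 1"
      unfolding hcomp_A_0 assms set_add_def set_mult_def by (force simp: ground_superalgebra_def)
    then show ?thesis using grading by (simp add: z2_grading_def)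
  qed
  show ?thesis
  proof (rule superalgebra_iso_via_inverse[of ?g])
    show "bij_betw ?g (carrier ?B) (carrier A)"
      unfolding bij_betw_def using im scalar_inj[of _ _ "\<one>"] nontrivial
      by (auto simp: inj_on_def ground_superalgebra_def)
    show "?g \<in> ring_hom ?B A"
      by (rule ring_hom_memI)
        (auto simp: ground_superalgebra_def smult_mult_left smult_l_distr smult_assoc1)
    show "?g \<in> module_hom K ?B A"
      unfolding module_hom_def by (auto simp: ground_superalgebra_def smult_l_distr smult_assoc1)
    show "?g ` hcomp ?B z = hcomp A z" for z
      by (cases z) (auto simp: ground_superalgebra_def hcomp_A_0 assms)
  qed (auto simp: ground_superalgebra_def)
qed

lemma is_ground_iff: "is_ground K A \<longleftrightarrow> purely_even A"
proof
  assume "is_ground K A"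
  then obtain h where h: "inj_on h (carrier A)" "h ` hcomp A 1 = {\<zero>\<^bsub>K\<^esub>}"
    unfolding superalgebra_iso_def bij_betw_def by (auto simp: ground_superalgebra_def dest: spec[of _ 1])
  have "x = \<zero>" if "x \<in> hcomp A 1" for x
  proof (rule inj_onD[OF h(1)])
    show "h x = h \<zero>" using h(2) that zero_in_hcomp_A[of 1] by (metis image_eqI singletonD)
  qed (use that hcomp_A_subset in auto)
  then show "purely_even A" using zero_in_hcomp_A[of 1] by blast
qed (rule is_ground_if)

lemma is_odd_iff: "is_odd K A \<longleftrightarrow> \<not> purely_even A"
proof
  assume "is_odd K A"
  then obtain h where h: "h ` hcomp A 1 = {\<zero>\<^bsub>K\<^esub>} \<times> carrier K"
    unfolding superalgebra_iso_def by (auto simp: odd_superalgebra_def dest: spec[of _ 1])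
  show "\<not> purely_even A"
  proof
    assume "purely_even A"
    then have eq: "{h \<zero>} = {\<zero>\<^bsub>K\<^esub>} \<times> carrier K" using h by simp
    have "(\<zero>\<^bsub>K\<^esub>, \<zero>\<^bsub>K\<^esub>) \<in> {h \<zero>}" "(\<zero>\<^bsub>K\<^esub>, \<one>\<^bsub>K\<^esub>) \<in> {h \<zero>}" unfolding eq by auto
    then show False by (metis one_not_zero prod.inject singletonD)
  qed
qed (rule is_odd_if)

lemma odd_unit_in_hcomp: "odd_unit A \<in> hcomp A 1"
  using odd_unit_props(1) zero_in_hcomp_A[of 1] by (cases "purely_even A") (auto simp: odd_unit_def)

lemma odd_unit_in_carrier [simp]: "odd_unit A \<in> carrier A"
  using odd_unit_in_hcomp hcomp_A_subset by blast

lemma carrier_A_cases: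
  assumes "a \<in> carrier A"
  obtains c d where "c \<in> carrier K" "d \<in> carrier K" "a = c \<odot> \<one> \<oplus> d \<odot> odd_unit A"
proof -
  have "a \<in> hcomp A 0 <+> hcomp A 1" using assms grading by (simp add: z2_grading_def)
  then obtain x y where xy: "x \<in> hcomp A 0" "y \<in> hcomp A 1" "a = x \<oplus> y"
    unfolding set_add_def set_mult_def by auto
  obtain c where c: "c \<in> carrier K" "x = c \<odot> \<one>" using even_is_scalar xy(1) by blast
  have "\<exists>d\<in>carrier K. y = d \<odot> odd_unit A"
  proof (cases "purely_even A")
    case True
    then show ?thesis using xy(2) by (intro bexI[of _ "\<zero>\<^bsub>K\<^esub>"]) auto
  next
    case False
    then show ?thesis using hcomp_A_1 xy(2) by auto
  qed
  then show thesis using that c xy(3) by blast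
qed

end

section \<open>Graded modules and their homogeneous components\<close>

text \<open>Degrees are compared as sums, so sums of bits must not be rewritten to exclusive disjunctions.\<close>

declare add_bit_eq_xor [simp del]

definition parts :: "('a, 'v, 'c) graded_scheme \<Rightarrow> 'v \<Rightarrow> 'v \<times> 'v" where
  "parts V x = (THE p. fst p \<in> hcomp V 0 \<and> snd p \<in> hcomp V 1 \<and> x = fst p \<oplus>\<^bsub>V\<^esub> snd p)"

definition part :: "('a, 'v, 'c) graded_scheme \<Rightarrow> bit \<Rightarrow> 'v \<Rightarrow> 'v" where
  "part V z x = (if z = 0 then fst (parts V x) else snd (parts V x))"

locale z2_graded_group = abelian_group V for V :: "('a, 'v, 'c) graded_scheme" (structure) +
  assumes z2: "z2_grading V"
begin

lemma hcomp_subgroup: "additive_subgroup (hcomp V z) V"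
  using z2 by (simp add: z2_grading_def)

lemma hcomp_subset: "hcomp V z \<subseteq> carrier V"
  using hcomp_subgroup by (rule additive_subgroup.a_subset)

lemma hcompD [simp, dest]: "x \<in> hcomp V z \<Longrightarrow> x \<in> carrier V"
  using hcomp_subset by blast

lemma hcomp_add [simp]: "x \<in> hcomp V z \<Longrightarrow> y \<in> hcomp V z \<Longrightarrow> x \<oplus> y \<in> hcomp V z"
  and hcomp_zero [simp]: "\<zero> \<in> hcomp V z"
  and hcomp_neg [simp]: "x \<in> hcomp V z \<Longrightarrow> \<ominus> x \<in> hcomp V z"
  using hcomp_subgroup additive_subgroup.a_closed additive_subgroup.zero_closed
    additive_subgroup.a_inv_closed by metis+

lemma hcomp_minus [simp]: "x \<in> hcomp V z \<Longrightarrow> y \<in> hcomp V z \<Longrightarrow> x \<ominus> y \<in> hcomp V z"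
  by (simp add: minus_eq)

lemma hcomp_finsum: "(\<And>i. i \<in> I \<Longrightarrow> f i \<in> hcomp V z) \<Longrightarrow> finsum V f I \<in> hcomp V z"
proof (induction I rule: infinite_finite_induct)
  case (insert i I)
  then show ?case by (subst finsum_insert) auto
qed simp_all

lemma hcomp_disjoint: "x \<in> hcomp V 0 \<Longrightarrow> x \<in> hcomp V 1 \<Longrightarrow> x = \<zero>"
  using z2 by (auto simp: z2_grading_def)

lemma hcomp_disjoint': "x \<in> hcomp V s \<Longrightarrow> x \<in> hcomp V t \<Longrightarrow> s \<noteq> t \<Longrightarrow> x = \<zero>"
  using hcomp_disjoint[of x] by (cases s; cases t) auto

lemma decomposition_unique:
  assumes "x \<in> hcomp V 0" "y \<in> hcomp V 1" "x' \<in> hcomp V 0" "y' \<in> hcomp V 1" "x \<oplus> y = x' \<oplus> y'"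
  shows "x = x'" "y = y'"
proof -
  have "x \<ominus> x' = y' \<ominus> y" by (rule add_eq_imp_minus_eq) (use assms in auto)
  moreover have "x \<ominus> x' \<in> hcomp V 0" "y' \<ominus> y \<in> hcomp V 1" using assms by simp_all
  ultimately have "x \<ominus> x' = \<zero>" "y' \<ominus> y = \<zero>"
    using hcomp_disjoint[of "x \<ominus> x'"] hcomp_disjoint[of "y' \<ominus> y"] by auto
  then show "x = x'" "y = y'" using assms(1-4) by simp_all
qed

lemma parts_eq: "x \<in> hcomp V 0 \<Longrightarrow> y \<in> hcomp V 1 \<Longrightarrow> parts V (x \<oplus> y) = (x, y)"
  unfolding parts_def
  by (rule the_equality) (use decomposition_unique in \<open>metis fst_conv snd_conv prod.collapse\<close>)+

lemma part_eq [simp]: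
  assumes "x \<in> hcomp V 0" "y \<in> hcomp V 1"
  shows "part V 0 (x \<oplus> y) = x" "part V 1 (x \<oplus> y) = y"
  by (simp_all add: part_def parts_eq assms)

lemma decomposition:
  assumes "v \<in> carrier V"
  obtains x y where "x \<in> hcomp V 0" "y \<in> hcomp V 1" "v = x \<oplus> y"
proof -
  have "v \<in> hcomp V 0 <+> hcomp V 1" using assms z2 by (simp add: z2_grading_def)
  then show thesis using that unfolding set_add_def set_mult_def by auto
qed

lemma part_closed [simp]: "v \<in> carrier V \<Longrightarrow> part V z v \<in> hcomp V z"
  by (erule decomposition) (cases z; auto)

lemma part_carrier [simp]: "v \<in> carrier V \<Longrightarrow> part V z v \<in> carrier V"
  using part_closed hcompD by blast

lemma part_sum: "v \<in> carrier V \<Longrightarrow> part V 0 v \<oplus> part V 1 v = v"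
  by (erule decomposition) auto

lemma part_homogeneous: "x \<in> hcomp V s \<Longrightarrow> part V t x = (if s = t then x else \<zero>)"
  using part_eq[of x \<zero>] part_eq[of \<zero> x] by (cases s; cases t) auto

lemma part_add [simp]:
  assumes "v \<in> carrier V" "w \<in> carrier V"
  shows "part V z (v \<oplus> w) = part V z v \<oplus> part V z w"
proof -
  obtain x y where v: "x \<in> hcomp V 0" "y \<in> hcomp V 1" "v = x \<oplus> y" using decomposition assms by blast
  obtain x' y' where w: "x' \<in> hcomp V 0" "y' \<in> hcomp V 1" "w = x' \<oplus> y'" using decomposition assms by blast
  have "v \<oplus> w = (x \<oplus> x') \<oplus> (y \<oplus> y')" using v w by (simp add: a_ac)
  then show ?thesis using v w by (cases z) simp_all
qed

text \<open>An additive map of degree \<open>d\<close> applied to the decomposition of \<open>v\<close> gives a decomposition of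
  \<open>f v\<close>, and decompositions are unique.\<close>

lemma part_commutes:
  assumes f: "\<And>v. v \<in> carrier V \<Longrightarrow> f v \<in> carrier V"
    and add: "\<And>v w. v \<in> carrier V \<Longrightarrow> w \<in> carrier V \<Longrightarrow> f (v \<oplus> w) = f v \<oplus> f w"
    and deg: "\<And>v z. v \<in> hcomp V z \<Longrightarrow> f v \<in> hcomp V (z + d)"
    and v: "v \<in> carrier V"
  shows "part V z (f v) = f (part V (z + d) v)"
proof -
  obtain x y where v: "x \<in> hcomp V 0" "y \<in> hcomp V 1" "v = x \<oplus> y" using decomposition v by blast
  have "f x \<in> hcomp V d" "f y \<in> hcomp V (1 + d)" using deg[OF v(1)] deg[OF v(2)] by simp_all
  then show ?thesis using v add[of x y] f hcompD[OF v(1)] hcompD[OF v(2)]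
    by (cases z; cases d) (simp_all add: part_homogeneous)
qed

end

text \<open>The component of degree \<open>z\<close> as a vector space over \<open>K\<close>; this is the space at the vertex
  \<open>(i, z)\<close>.\<close>

definition piece :: "('k, 'a) graded \<Rightarrow> ('a, 'v, 'c) graded_scheme \<Rightarrow> bit \<Rightarrow> ('k, 'v) module" where
  "piece A V z = (restrict_scalars A V)\<lparr>carrier := hcomp V z\<rparr>"

lemma piece_simps [simp]:
  "carrier (piece A V z) = hcomp V z" "ring.zero (piece A V z) = \<zero>\<^bsub>V\<^esub>"
  "ring.add (piece A V z) = ring.add V" "smult (piece A V z) c x = (c \<odot>\<^bsub>A\<^esub> \<one>\<^bsub>A\<^esub>) \<odot>\<^bsub>V\<^esub> x"
  by (simp_all add: piece_def restrict_scalars_def)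

lemma restrict_scalars_simps [simp]:
  "carrier (restrict_scalars A V) = carrier V" "ring.zero (restrict_scalars A V) = \<zero>\<^bsub>V\<^esub>"
  "ring.add (restrict_scalars A V) = ring.add V"
  "smult (restrict_scalars A V) c x = (c \<odot>\<^bsub>A\<^esub> \<one>\<^bsub>A\<^esub>) \<odot>\<^bsub>V\<^esub> x"
  by (simp_all add: restrict_scalars_def)

text \<open>A form of finite generation without linear combinations, which passes easily between a graded
  module and its components.\<close>

lemma (in vectorspace) fin_dim_iff_submodules:
  "fin_dim \<longleftrightarrow> (\<exists>B. finite B \<and> B \<subseteq> carrier V \<and>
    (\<forall>N. LinearCombinations.submodule K N V \<longrightarrow> B \<subseteq> N \<longrightarrow> carrier V \<subseteq> N))"
proof
  assume fin_dim
  then obtain B where B: "finite B" "B \<subseteq> carrier V" "span B = carrier V"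
    unfolding fin_dim_def by auto
  then show "\<exists>B. finite B \<and> B \<subseteq> carrier V \<and>
    (\<forall>N. LinearCombinations.submodule K N V \<longrightarrow> B \<subseteq> N \<longrightarrow> carrier V \<subseteq> N)"
    using span_is_subset by metis
next
  assume "\<exists>B. finite B \<and> B \<subseteq> carrier V \<and>
    (\<forall>N. LinearCombinations.submodule K N V \<longrightarrow> B \<subseteq> N \<longrightarrow> carrier V \<subseteq> N)"
  then obtain B where B: "finite B" "B \<subseteq> carrier V"
    "\<And>N. LinearCombinations.submodule K N V \<Longrightarrow> B \<subseteq> N \<Longrightarrow> carrier V \<subseteq> N" by blast
  have "carrier V \<subseteq> span B" using B by (intro B(3) span_is_submodule in_own_span)
  then have "span B = carrier V" using span_is_subset2[OF B(2)] by blast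
  then show fin_dim unfolding fin_dim_def using B by blast
qed

lemma (in linear_map) fin_dim_surj:
  assumes "V.fin_dim" "T ` carrier V = carrier W"
  shows "W.fin_dim"
  using rank_nullity_main(2)[OF assms] .

locale superdivision_module = closed_superdivision K A + V: graded_left_module A V
  for K :: "('k, 'r) ring_scheme" and A :: "('k, 'a) graded" and V :: "('a, 'v, 'c) graded_scheme" (structure)
begin

sublocale VG: z2_graded_group V
  using V.group V.grading by (simp add: z2_graded_group_def z2_graded_group_axioms_def)

abbreviation kmult :: "'k \<Rightarrow> 'v \<Rightarrow> 'v" (infixl "\<bullet>" 70) where
  "c \<bullet> x \<equiv> (c \<odot>\<^bsub>A\<^esub> \<one>\<^bsub>A\<^esub>) \<odot> x"

lemma kmult_closed [simp]: "c \<in> carrier K \<Longrightarrow> x \<in> carrier V \<Longrightarrow> c \<bullet> x \<in> carrier V"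
  by (simp add: V.smult_closed)

lemma kmult_graded [simp]: "c \<in> carrier K \<Longrightarrow> x \<in> hcomp V z \<Longrightarrow> c \<bullet> x \<in> hcomp V z"
  using V.smult_graded[of "c \<odot>\<^bsub>A\<^esub> \<one>\<^bsub>A\<^esub>" 0 x z] by (simp add: smult_graded one_graded)

lemma unit_graded: "x \<in> hcomp V z \<Longrightarrow> odd_unit A \<odot> x \<in> hcomp V (z + 1)"
  using V.smult_graded[OF odd_unit_in_hcomp, of x z] by (simp add: add.commute)

lemma unit_closed [simp]: "x \<in> carrier V \<Longrightarrow> odd_unit A \<odot> x \<in> carrier V"
  by (simp add: V.smult_closed)

lemma unit_unit:
  assumes "\<not> purely_even A" "x \<in> carrier V"
  shows "odd_unit A \<odot> (odd_unit A \<odot> x) = x"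
  using assms by (simp add: odd_unit_props V.smult_one flip: V.smult_assoc)

lemma kmult_unit:
  assumes "c \<in> carrier K" "x \<in> carrier V"
  shows "odd_unit A \<odot> (c \<bullet> x) = c \<bullet> (odd_unit A \<odot> x)"
  using assms by (simp add: smult_mult_left smult_mult_right flip: V.smult_assoc)

lemma smult_zero_left [simp]: "x \<in> carrier V \<Longrightarrow> \<zero>\<^bsub>A\<^esub> \<odot> x = \<zero>"
  using V.smult_l_distr[of "\<zero>\<^bsub>A\<^esub>" "\<zero>\<^bsub>A\<^esub>" x] V.smult_closed[of "\<zero>\<^bsub>A\<^esub>" x]
  by (metis M.l_zero M.zero_closed VG.add.l_cancel_one')

lemma vectorspace_restrict: "vectorspace K (restrict_scalars A V)"
  using field_axioms
  by (intro vs_criteria)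
    (auto simp: V.smult_closed V.smult_one V.smult_r_distr V.smult_assoc[symmetric] VG.a_ac
      smult_mult_left smult_assoc1 smult_l_distr V.smult_l_distr[symmetric] intro: VG.r_neg bexI[of _ "\<ominus> _"])

lemma vectorspace_piece: "vectorspace K (piece A V z)"
  using field_axioms
  by (intro vs_criteria)
    (auto simp: V.smult_closed V.smult_one V.smult_r_distr V.smult_assoc[symmetric] VG.a_ac
      smult_mult_left smult_assoc1 smult_l_distr V.smult_l_distr[symmetric]
      intro!: VG.r_neg bexI[of _ "\<ominus> _"])

text \<open>The projection of a graded module onto a component is linear and surjective.\<close>

lemma fin_dim_piece:
  assumes "fin_dim_module K A V"
  shows "vectorspace.fin_dim K (piece A V z)"
proof -
  interpret R: vectorspace K "restrict_scalars A V" by (rule vectorspace_restrict)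
  interpret P: vectorspace K "piece A V z" by (rule vectorspace_piece)
  interpret T: linear_map K "restrict_scalars A V" "piece A V z" "part V z"
  proof unfold_locales
    show "part V z \<in> module_hom K (restrict_scalars A V) (piece A V z)"
    proof -
      have "part V z (c \<bullet> x) = c \<bullet> part V z x" if "c \<in> carrier K" "x \<in> carrier V" for c x
        using VG.part_commutes[of "\<lambda>x. c \<bullet> x" 0 x z] that by (auto simp: V.smult_r_distr)
      then show ?thesis unfolding module_hom_def by auto
    qed
  qed
  have "part V z ` carrier (restrict_scalars A V) = carrier (piece A V z)"
  proof
    show "carrier (piece A V z) \<subseteq> part V z ` carrier (restrict_scalars A V)"
    proof
      fix x assume "x \<in> carrier (piece A V z)"
      then have "x = part V z x" "x \<in> carrier V" by (auto simp: VG.part_homogeneous)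
      then show "x \<in> part V z ` carrier (restrict_scalars A V)" by auto
    qed
  qed auto
  then show ?thesis using T.fin_dim_surj assms unfolding fin_dim_module_def by blast
qed

lemma fin_dim_from_pieces:
  assumes "\<And>z. vectorspace.fin_dim K (piece A V z)"
  shows "fin_dim_module K A V"
proof -
  interpret R: vectorspace K "restrict_scalars A V" by (rule vectorspace_restrict)
  have "\<exists>B. finite B \<and> B \<subseteq> hcomp V z \<and>
      (\<forall>N. LinearCombinations.submodule K N (restrict_scalars A V) \<longrightarrow> B \<subseteq> N \<longrightarrow> hcomp V z \<subseteq> N)" for z
  proof -
    interpret P: vectorspace K "piece A V z" by (rule vectorspace_piece)
    obtain B where B: "finite B" "B \<subseteq> hcomp V z"
      "\<And>N. LinearCombinations.submodule K N (piece A V z) \<Longrightarrow> B \<subseteq> N \<Longrightarrow> hcomp V z \<subseteq> N"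
      using assms[of z] unfolding P.fin_dim_iff_submodules by auto
    have "hcomp V z \<subseteq> N" if N: "LinearCombinations.submodule K N (restrict_scalars A V)" "B \<subseteq> N" for N
    proof -
      interpret N: LinearCombinations.submodule K N "restrict_scalars A V" by (rule N)
      have "LinearCombinations.submodule K (N \<inter> hcomp V z) (piece A V z)"
        using N.m_closed N.zero_closed N.smult_closed
        by (intro LinearCombinations.submodule.intro P.module_axioms) auto
      from B(3)[OF this] show ?thesis using B(2) N(2) by blast
    qed
    then show ?thesis using B(1,2) by blast
  qed
  then obtain B where B: "\<And>z. finite (B z)" "\<And>z. B z \<subseteq> hcomp V z"
    "\<And>z N. LinearCombinations.submodule K N (restrict_scalars A V) \<Longrightarrow> B z \<subseteq> N \<Longrightarrow> hcomp V z \<subseteq> N"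
    by metis
  have "carrier V \<subseteq> N" if N: "LinearCombinations.submodule K N (restrict_scalars A V)"
    "B 0 \<union> B 1 \<subseteq> N" for N
  proof
    interpret N: LinearCombinations.submodule K N "restrict_scalars A V" by (rule N)
    fix x assume "x \<in> carrier V"
    then show "x \<in> N" using B(3)[OF N(1), of 0] B(3)[OF N(1), of 1] N(2) N.m_closed
      by (elim VG.decomposition) auto
  qed
  moreover have "finite (B 0 \<union> B 1)" "B 0 \<union> B 1 \<subseteq> carrier V" using B(1,2) by auto
  ultimately show ?thesis unfolding fin_dim_module_def R.fin_dim_iff_submodules
    by (intro exI[of _ "B 0 \<union> B 1"]) auto
qed

end

locale superdivision_module_pair =
  V: superdivision_module K A V + W: superdivision_module K A W
  for K :: "('k, 'r) ring_scheme" and A :: "('k, 'a) graded" and V :: "('a, 'v, 'c) graded_scheme"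
    and W :: "('a, 'w, 'd) graded_scheme"
begin

text \<open>Since \<open>A = K 1 + K \<epsilon>\<close>, linearity over \<open>A\<close> is linearity over \<open>K\<close> together with compatibility
  with \<open>\<epsilon>\<close>.\<close>

lemma graded_homI:
  assumes "\<And>x. x \<in> carrier V \<Longrightarrow> f x \<in> carrier W"
    and "\<And>x y. x \<in> carrier V \<Longrightarrow> y \<in> carrier V \<Longrightarrow> f (x \<oplus>\<^bsub>V\<^esub> y) = f x \<oplus>\<^bsub>W\<^esub> f y"
    and "\<And>c x. c \<in> carrier K \<Longrightarrow> x \<in> carrier V \<Longrightarrow> f ((c \<odot>\<^bsub>A\<^esub> \<one>\<^bsub>A\<^esub>) \<odot>\<^bsub>V\<^esub> x) = (c \<odot>\<^bsub>A\<^esub> \<one>\<^bsub>A\<^esub>) \<odot>\<^bsub>W\<^esub> f x"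
    and "\<And>x. x \<in> carrier V \<Longrightarrow> f (odd_unit A \<odot>\<^bsub>V\<^esub> x) = odd_unit A \<odot>\<^bsub>W\<^esub> f x"
    and "\<And>z x. x \<in> hcomp V z \<Longrightarrow> f x \<in> hcomp W z"
  shows "f \<in> graded_hom A V W"
proof -
  have "f (a \<odot>\<^bsub>V\<^esub> x) = a \<odot>\<^bsub>W\<^esub> f x" if a: "a \<in> carrier A" and x: "x \<in> carrier V" for a x
  proof -
    obtain c d where cd: "c \<in> carrier K" "d \<in> carrier K"
      and a: "a = c \<odot>\<^bsub>A\<^esub> \<one>\<^bsub>A\<^esub> \<oplus>\<^bsub>A\<^esub> d \<odot>\<^bsub>A\<^esub> odd_unit A" using V.carrier_A_cases a by blast
    have d: "d \<odot>\<^bsub>A\<^esub> odd_unit A = (d \<odot>\<^bsub>A\<^esub> \<one>\<^bsub>A\<^esub>) \<otimes>\<^bsub>A\<^esub> odd_unit A"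
      using cd by (simp add: V.smult_mult_left)
    show ?thesis using cd x assms unfolding a d
      by (simp add: V.V.smult_l_distr W.V.smult_l_distr V.V.smult_assoc W.V.smult_assoc)
  qed
  then show ?thesis using assms unfolding graded_hom_def module_hom_def by auto
qed

text \<open>A graded module map is the same as a pair of linear maps on the components that is compatible
  with \<open>\<epsilon>\<close>, which exchanges the components.\<close>

lemma extend_pieces:
  assumes g: "\<And>z. g z \<in> module_hom K (piece A V z) (piece A W z)"
    and e: "\<And>z x. x \<in> hcomp V z \<Longrightarrow> g (z + 1) (odd_unit A \<odot>\<^bsub>V\<^esub> x) = odd_unit A \<odot>\<^bsub>W\<^esub> g z x"
  defines "f \<equiv> \<lambda>x. g 0 (part V 0 x) \<oplus>\<^bsub>W\<^esub> g 1 (part V 1 x)"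
  shows "f \<in> graded_hom A V W" "\<And>z x. x \<in> hcomp V z \<Longrightarrow> f x = g z x"
proof -
  have gc: "g z x \<in> hcomp W z" if "x \<in> hcomp V z" for z x
    using module_hom_closed[OF g[of z]] that by auto
  have ga: "g z (x \<oplus>\<^bsub>V\<^esub> y) = g z x \<oplus>\<^bsub>W\<^esub> g z y" if "x \<in> hcomp V z" "y \<in> hcomp V z" for z x y
    using module_hom_add[OF g[of z]] that by auto
  have gs: "g z ((c \<odot>\<^bsub>A\<^esub> \<one>\<^bsub>A\<^esub>) \<odot>\<^bsub>V\<^esub> x) = (c \<odot>\<^bsub>A\<^esub> \<one>\<^bsub>A\<^esub>) \<odot>\<^bsub>W\<^esub> g z x" if "c \<in> carrier K" "x \<in> hcomp V z" for z x c
    using module_hom_smult[OF g[of z]] that by auto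
  have g0: "g z \<zero>\<^bsub>V\<^esub> = \<zero>\<^bsub>W\<^esub>" for z
    using ga[of "\<zero>\<^bsub>V\<^esub>" z "\<zero>\<^bsub>V\<^esub>"] gc[of "\<zero>\<^bsub>V\<^esub>" z] W.VG.hcompD
    by (metis V.VG.hcomp_zero V.VG.l_zero V.VG.zero_closed W.VG.add.l_cancel_one')
  note gc' = gc[THEN W.VG.hcompD]
  show fz: "f x = g z x" if "x \<in> hcomp V z" for z x
    using that gc'[OF that] unfolding f_def by (cases z) (auto simp: V.VG.part_homogeneous g0)
  show "f \<in> graded_hom A V W"
  proof (rule graded_homI)
    fix x assume x: "x \<in> carrier V"
    then show "f x \<in> carrier W" unfolding f_def by (auto intro!: gc')
    have p: "part V z (odd_unit A \<odot>\<^bsub>V\<^esub> x) = odd_unit A \<odot>\<^bsub>V\<^esub> part V (z + 1) x" for z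
      using x by (intro V.VG.part_commutes) (auto simp: V.V.smult_r_distr V.unit_graded)
    show "f (odd_unit A \<odot>\<^bsub>V\<^esub> x) = odd_unit A \<odot>\<^bsub>W\<^esub> f x"
      using x e[of "part V 1 x" 1] e[of "part V 0 x" 0] unfolding f_def p
      by (simp add: W.V.smult_r_distr gc' W.VG.a_comm)
  next
    fix x y assume "x \<in> carrier V" "y \<in> carrier V"
    then show "f (x \<oplus>\<^bsub>V\<^esub> y) = f x \<oplus>\<^bsub>W\<^esub> f y" unfolding f_def by (simp add: ga gc' W.VG.a_ac)
  next
    fix c x assume *: "c \<in> carrier K" "x \<in> carrier V"
    have p: "part V z ((c \<odot>\<^bsub>A\<^esub> \<one>\<^bsub>A\<^esub>) \<odot>\<^bsub>V\<^esub> x) = (c \<odot>\<^bsub>A\<^esub> \<one>\<^bsub>A\<^esub>) \<odot>\<^bsub>V\<^esub> part V z x" for z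
      using V.VG.part_commutes[of "\<lambda>x. (c \<odot>\<^bsub>A\<^esub> \<one>\<^bsub>A\<^esub>) \<odot>\<^bsub>V\<^esub> x" 0 x z] * by (auto simp: V.V.smult_r_distr)
    show "f ((c \<odot>\<^bsub>A\<^esub> \<one>\<^bsub>A\<^esub>) \<odot>\<^bsub>V\<^esub> x) = (c \<odot>\<^bsub>A\<^esub> \<one>\<^bsub>A\<^esub>) \<odot>\<^bsub>W\<^esub> f x"
      using * unfolding f_def p by (simp add: gs W.V.smult_r_distr gc')
  qed (auto simp: fz gc)
qed

end

section \<open>The universal property of the tensor product\<close>

text \<open>The maps that correspond to graded morphisms of left \<open>B\<close>-modules from the tensor product of \<open>M\<close>
  and \<open>V\<close> over \<open>A\<close> to \<open>W\<close>.\<close>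

definition tensor_bihom :: "('k, 'a) graded \<Rightarrow> ('k, 'a) graded \<Rightarrow> ('a, 'm) graded_bimod \<Rightarrow>
    ('a, 'v) graded \<Rightarrow> ('a, 'w, 'e) graded_scheme \<Rightarrow> ('m \<Rightarrow> 'v \<Rightarrow> 'w) \<Rightarrow> bool" where
  "tensor_bihom B A M V W b \<longleftrightarrow>
    (\<forall>m\<in>carrier M. \<forall>v\<in>carrier V. b m v \<in> carrier W) \<and>
    (\<forall>m\<in>carrier M. \<forall>m'\<in>carrier M. \<forall>v\<in>carrier V. b (m \<oplus>\<^bsub>M\<^esub> m') v = b m v \<oplus>\<^bsub>W\<^esub> b m' v) \<and>
    (\<forall>m\<in>carrier M. \<forall>v\<in>carrier V. \<forall>v'\<in>carrier V. b m (v \<oplus>\<^bsub>V\<^esub> v') = b m v \<oplus>\<^bsub>W\<^esub> b m v') \<and>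
    (\<forall>m\<in>carrier M. \<forall>a\<in>carrier A. \<forall>v\<in>carrier V. b (rsmult M m a) v = b m (a \<odot>\<^bsub>V\<^esub> v)) \<and>
    (\<forall>c\<in>carrier B. \<forall>m\<in>carrier M. \<forall>v\<in>carrier V. b (c \<odot>\<^bsub>M\<^esub> m) v = c \<odot>\<^bsub>W\<^esub> b m v) \<and>
    (\<forall>s t. \<forall>m\<in>hcomp M s. \<forall>v\<in>hcomp V t. b m v \<in> hcomp W (s + t))"

lemma tensor_simps [simp]:
  "carrier (tensor A M V) = carrier (tensor_group A M V)"
  "ring.zero (tensor A M V) = monoid.one (tensor_group A M V)"
  "ring.add (tensor A M V) = monoid.mult (tensor_group A M V)"
  "smult (tensor A M V) = (\<lambda>b. tensor_map A M V (\<lambda>m. b \<odot>\<^bsub>M\<^esub> m) (\<lambda>v. v))"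
  "hcomp (tensor A M V) = (\<lambda>z. generate (tensor_group A M V)
       {pure_tensor A M V m v | m v s t. m \<in> hcomp M s \<and> v \<in> hcomp V t \<and> s + t = z})"
  by (simp_all add: tensor_def)

locale tensor_data = graded_bimodule K B A M + V: graded_left_module A V
  for K :: "('k, 'r) ring_scheme" and B :: "('k, 'a) graded" and A :: "('k, 'a) graded"
    and M :: "('a, 'm) graded_bimod" and V :: "('a, 'v) graded"
begin

abbreviation "Free \<equiv> tensor_free M V"

abbreviation "Tens \<equiv> tensor_group A M V"

abbreviation "Null \<equiv> tensor_null A M V"

abbreviation "Rel \<equiv> tensor_relators A M V"

abbreviation "cls \<equiv> tensor_class A M V"

abbreviation "pure \<equiv> pure_tensor A M V"

sublocale MG: abelian_group M by (rule left.group)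
sublocale VG: abelian_group V by (rule V.group)

sublocale free: comm_group "Free"
  unfolding tensor_free_def by (rule abelian_free_Abelian_group)

lemma carrier_free: "c \<in> carrier (Free) \<longleftrightarrow> Poly_Mapping.keys c \<subseteq> carrier M \<times> carrier V"
  by (simp add: tensor_free_def)

lemma free_mult [simp]: "c \<otimes>\<^bsub>Free\<^esub> d = c + d"
  by (simp add: tensor_free_def)

lemma frag_of_free [simp]: "frag_of x \<in> carrier (Free) \<longleftrightarrow> x \<in> carrier M \<times> carrier V"
  by (simp add: tensor_free_def)

lemma free_diff: "c \<in> carrier (Free) \<Longrightarrow> d \<in> carrier (Free) \<Longrightarrow>
    c - d \<in> carrier (Free)"
  unfolding carrier_free using keys_diff[of c d] by blast

lemma hom_free_diff:
  assumes "h \<in> hom (Free) G" "group G" "c \<in> carrier (Free)" "d \<in> carrier (Free)"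
  shows "h (c - d) = h c \<otimes>\<^bsub>G\<^esub> inv\<^bsub>G\<^esub> h d"
proof -
  interpret h: group_hom "Free" G h
    using assms(1,2) by (simp add: group_hom_def group_hom_axioms_def free.group_axioms)
  have "inv\<^bsub>Free\<^esub> d = - d" using assms(4) by (simp add: tensor_free_def)
  then show ?thesis using h.hom_mult[OF assms(3) free.inv_closed[OF assms(4)]] h.hom_inv[OF assms(4)] by simp
qed

lemma relators_subset: "Rel \<subseteq> carrier (Free)"
  unfolding tensor_relators_def
  by (auto intro!: free_diff simp: rsmult_closed V.smult_closed)

lemma null_subgroup: "subgroup (Null) (Free)"
  unfolding tensor_null_def by (rule free.generate_is_subgroup[OF relators_subset])

sublocale null: normal "Null" "Free"
  by (rule free.subgroup_imp_normal[OF null_subgroup])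

sublocale tens: comm_group "Tens"
  unfolding tensor_group_def by (rule free.abelian_FactGroup[OF null_subgroup])

lemma tensor_group_cases:
  assumes "T \<in> carrier (Tens)"
  obtains c where "c \<in> carrier (Free)" "T = cls c"
  using assms unfolding tensor_group_def FactGroup_def RCOSETS_def tensor_class_def by auto

lemma class_closed [simp]:
  "c \<in> carrier (Free) \<Longrightarrow> cls c \<in> carrier (Tens)"
  unfolding tensor_group_def FactGroup_def RCOSETS_def tensor_class_def by auto

lemma class_add:
  "c \<in> carrier (Free) \<Longrightarrow> d \<in> carrier (Free) \<Longrightarrow>
    cls (c + d) = cls c \<otimes>\<^bsub>Tens\<^esub> cls d"
  unfolding tensor_group_def FactGroup_def tensor_class_def by (simp add: null.rcos_sum)

lemma class_hom: "cls \<in> hom (Free) (Tens)"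
  by (auto simp: hom_def class_add)

lemma class_null: "c \<in> Null \<Longrightarrow> cls c = \<one>\<^bsub>Tens\<^esub>"
  unfolding tensor_class_def tensor_group_def FactGroup_def
  using free.coset_join2[OF _ null_subgroup] null.mem_carrier by auto

lemma class_eqI:
  assumes "c \<in> carrier (Free)" "d \<in> carrier (Free)" "c - d \<in> Rel"
  shows "cls c = cls d"
proof -
  have "cls (c - d) = \<one>\<^bsub>Tens\<^esub>"
    using assms(3) by (intro class_null) (simp add: tensor_null_def generate.incl)
  then show ?thesis using class_add[of "c - d" d] free_diff assms by simp
qed

lemma pure_closed [simp]:
  "m \<in> carrier M \<Longrightarrow> v \<in> carrier V \<Longrightarrow> pure m v \<in> carrier (Tens)"
  by (simp add: pure_tensor_def)

lemma pure_add_left: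
  assumes "m \<in> carrier M" "m' \<in> carrier M" "v \<in> carrier V"
  shows "pure (m \<oplus>\<^bsub>M\<^esub> m') v =
    pure m v \<otimes>\<^bsub>Tens\<^esub> pure m' v"
proof -
  have "cls (frag_of (m \<oplus>\<^bsub>M\<^esub> m', v)) = cls (frag_of (m, v) + frag_of (m', v))"
    using assms by (intro class_eqI free.m_closed[simplified])
      (auto simp: tensor_relators_def algebra_simps)
  then show ?thesis using assms by (simp add: pure_tensor_def class_add)
qed

lemma pure_add_right:
  assumes "m \<in> carrier M" "v \<in> carrier V" "v' \<in> carrier V"
  shows "pure m (v \<oplus>\<^bsub>V\<^esub> v') =
    pure m v \<otimes>\<^bsub>Tens\<^esub> pure m v'"
proof -
  have "cls (frag_of (m, v \<oplus>\<^bsub>V\<^esub> v')) = cls (frag_of (m, v) + frag_of (m, v'))"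
    using assms by (intro class_eqI free.m_closed[simplified])
      (auto simp: tensor_relators_def algebra_simps)
  then show ?thesis using assms by (simp add: pure_tensor_def class_add)
qed

lemma pure_balanced:
  assumes "m \<in> carrier M" "a \<in> carrier A" "v \<in> carrier V"
  shows "pure (rsmult M m a) v = pure m (a \<odot>\<^bsub>V\<^esub> v)"
  unfolding pure_tensor_def using assms
  by (intro class_eqI) (auto simp: tensor_relators_def rsmult_closed V.smult_closed)

lemma kills_null:
  assumes "h \<in> hom (Free) G" "group G" "\<And>c. c \<in> Rel \<Longrightarrow> h c = \<one>\<^bsub>G\<^esub>"
    and "c \<in> Null"
  shows "h c = \<one>\<^bsub>G\<^esub>"
proof -
  interpret h: group_hom "Free" G h
    using assms(1,2) by (simp add: group_hom_def group_hom_axioms_def free.group_axioms)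
  have "Null \<subseteq> kernel (Free) G h"
    unfolding tensor_null_def using assms(3) relators_subset
    by (intro free.generate_subgroup_incl h.subgroup_kernel) (auto simp: kernel_def)
  then show ?thesis using assms(4) by (auto simp: kernel_def)
qed

lemma constant_on_class:
  assumes "h \<in> hom (Free) G" "group G" "\<And>c. c \<in> Rel \<Longrightarrow> h c = \<one>\<^bsub>G\<^esub>"
    and "c \<in> carrier (Free)" "d \<in> cls c"
  shows "h d = h c"
proof -
  obtain n where n: "n \<in> Null" "d = n + c"
    using assms(5) unfolding tensor_class_def r_coset_def by auto
  have "h d = h n \<otimes>\<^bsub>G\<^esub> h c"
    using n assms(1,4) null.mem_carrier[OF n(1)] hom_mult[OF assms(1)] by fastforce
  moreover have "h c \<in> carrier G" using assms(1,4) by (auto simp: hom_def)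
  ultimately show ?thesis using kills_null[OF assms(1-3) n(1)] assms(2) by (simp add: group.is_monoid)
qed

lemma class_self: "c \<in> carrier (Free) \<Longrightarrow> c \<in> cls c"
  unfolding tensor_class_def using free.rcos_self[OF _ null_subgroup] by blast

text \<open>\<open>F\<close> need only be known on classes; that makes the lemma apply to maps on cosets however they
  are defined, by choosing a representative or by a union over all of them.\<close>

lemma factor_through_tensor:
  assumes "h \<in> hom (Free) G" "group G" "\<And>c. c \<in> Rel \<Longrightarrow> h c = \<one>\<^bsub>G\<^esub>"
    and F: "\<And>c. c \<in> carrier (Free) \<Longrightarrow> F (cls c) = h c"
  shows "F \<in> hom (Tens) G"
proof (rule homI)
  fix T assume "T \<in> carrier (Tens)"
  then show "F T \<in> carrier G" by (rule tensor_group_cases) (use F assms(1) in \<open>auto simp: hom_def\<close>)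
next
  fix T U assume "T \<in> carrier (Tens)" "U \<in> carrier (Tens)"
  then obtain c d where *: "c \<in> carrier (Free)" "T = cls c"
    "d \<in> carrier (Free)" "U = cls d" by (metis tensor_group_cases)
  then have "F (T \<otimes>\<^bsub>Tens\<^esub> U) = h (c + d)"
    using F[of "c + d"] free.m_closed[of c d] by (simp add: class_add)
  then show "F (T \<otimes>\<^bsub>Tens\<^esub> U) = F T \<otimes>\<^bsub>G\<^esub> F U"
    using * F hom_mult[OF assms(1), of c d] by simp
qed

lemma tensor_universal:
  assumes "comm_group G"
    and "\<And>m v. m \<in> carrier M \<Longrightarrow> v \<in> carrier V \<Longrightarrow> b m v \<in> carrier G"
    and "\<And>m m' v. m \<in> carrier M \<Longrightarrow> m' \<in> carrier M \<Longrightarrow> v \<in> carrier V \<Longrightarrow>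
      b (m \<oplus>\<^bsub>M\<^esub> m') v = b m v \<otimes>\<^bsub>G\<^esub> b m' v"
    and "\<And>m v v'. m \<in> carrier M \<Longrightarrow> v \<in> carrier V \<Longrightarrow> v' \<in> carrier V \<Longrightarrow>
      b m (v \<oplus>\<^bsub>V\<^esub> v') = b m v \<otimes>\<^bsub>G\<^esub> b m v'"
    and "\<And>m a v. m \<in> carrier M \<Longrightarrow> a \<in> carrier A \<Longrightarrow> v \<in> carrier V \<Longrightarrow>
      b (rsmult M m a) v = b m (a \<odot>\<^bsub>V\<^esub> v)"
  obtains h where "h \<in> hom (Free) G"
    "\<And>m v. m \<in> carrier M \<Longrightarrow> v \<in> carrier V \<Longrightarrow> h (frag_of (m, v)) = b m v"
    "\<And>c. c \<in> Rel \<Longrightarrow> h c = \<one>\<^bsub>G\<^esub>"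
proof -
  interpret G: comm_group G by (rule assms(1))
  obtain h where h: "h \<in> hom (Free) G"
    and "\<And>x. x \<in> carrier M \<times> carrier V \<Longrightarrow> h (frag_of x) = (\<lambda>(m, v). b m v) x"
    using G.free_Abelian_group_universal[of "\<lambda>(m, v). b m v" "carrier M \<times> carrier V"] assms(2)
    unfolding tensor_free_def by (metis (no_types, lifting) case_prod_conv image_subsetI mem_Sigma_iff old.prod.exhaust)
  then have hb: "\<And>m v. m \<in> carrier M \<Longrightarrow> v \<in> carrier V \<Longrightarrow> h (frag_of (m, v)) = b m v" by auto
  have comm: "x \<otimes>\<^bsub>G\<^esub> y \<otimes>\<^bsub>G\<^esub> inv\<^bsub>G\<^esub> x \<otimes>\<^bsub>G\<^esub> inv\<^bsub>G\<^esub> y = \<one>\<^bsub>G\<^esub>"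
    if "x \<in> carrier G" "y \<in> carrier G" for x y
    using that by (simp add: G.m_comm[of x y] G.m_assoc)
  have "h c = \<one>\<^bsub>G\<^esub>" if "c \<in> Rel" for c
    using that unfolding tensor_relators_def
    by (auto simp: hom_free_diff[OF h G.group_axioms] free_diff hb assms(2-) rsmult_closed V.smult_closed
        comm)
  then show thesis using that h hb by blast
qed

text \<open>The pure tensors generate the tensor product.\<close>

lemma hom_eq_on_pure:
  assumes "f \<in> hom (Tens) G" "g \<in> hom (Tens) G" "group G"
    and "\<And>m v. m \<in> carrier M \<Longrightarrow> v \<in> carrier V \<Longrightarrow> f (pure m v) = g (pure m v)"
    and "T \<in> carrier (Tens)"
  shows "f T = g T"
proof -
  obtain c where c: "c \<in> carrier (Free)" "T = cls c"
    using assms(5) tensor_group_cases by blast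
  have fh: "f \<circ> cls \<in> hom (Free) G"
    and gh: "g \<circ> cls \<in> hom (Free) G"
    using hom_compose[OF class_hom] assms(1,2) by (auto simp: comp_def)
  have "Poly_Mapping.keys c \<subseteq> carrier M \<times> carrier V" using c(1) carrier_free by simp
  then have "(f \<circ> cls) c = (g \<circ> cls) c"
  proof (induction c rule: free_Abelian_group_induct[consumes 1])
    case 1
    have "0 = \<one>\<^bsub>Free\<^esub>" by (simp add: tensor_free_def)
    then show ?case using hom_one[OF fh free.group_axioms assms(3)] hom_one[OF gh free.group_axioms assms(3)] by simp
  next
    case (2 x y)
    then show ?case using hom_free_diff[OF fh assms(3)] hom_free_diff[OF gh assms(3)] carrier_free by metis
  next
    case (3 x)
    then show ?case using assms(4) by (cases x) (auto simp: pure_tensor_def)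
  qed
  then show ?thesis using c(2) by simp
qed

text \<open>On the free group, the map induced by \<open>f\<close> and \<open>g\<close> followed by the passage to classes kills the
  relators.  All members of a coset thus yield the same class, and the union that defines
  \<^const>\<open>tensor_map\<close> is this class.\<close>

lemma tensor_map_hom:
  assumes W: "graded_left_module A W"
    and f: "\<And>m. m \<in> carrier M \<Longrightarrow> f m \<in> carrier M"
      "\<And>m m'. m \<in> carrier M \<Longrightarrow> m' \<in> carrier M \<Longrightarrow> f (m \<oplus>\<^bsub>M\<^esub> m') = f m \<oplus>\<^bsub>M\<^esub> f m'"
      "\<And>m a. m \<in> carrier M \<Longrightarrow> a \<in> carrier A \<Longrightarrow> f (rsmult M m a) = rsmult M (f m) a"
    and g: "g \<in> module_hom A V W"
  shows "tensor_map A M W f g \<in> hom (Tens) (tensor_group A M W)"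
    and "\<And>m v. m \<in> carrier M \<Longrightarrow> v \<in> carrier V \<Longrightarrow>
      tensor_map A M W f g (pure m v) = pure_tensor A M W (f m) (g v)"
proof -
  interpret W: tensor_data K B A M W
    using W graded_bimodule_axioms by (simp add: tensor_data_def)
  note g' = module_hom_closed[OF g, THEN funcset_mem] module_hom_add[OF g] module_hom_smult[OF g]
  obtain h where h: "h \<in> hom (Free) (tensor_group A M W)"
    "\<And>m v. m \<in> carrier M \<Longrightarrow> v \<in> carrier V \<Longrightarrow> h (frag_of (m, v)) = pure_tensor A M W (f m) (g v)"
    "\<And>c. c \<in> Rel \<Longrightarrow> h c = \<one>\<^bsub>tensor_group A M W\<^esub>"
    by (rule tensor_universal[OF W.tens.comm_group_axioms, of "\<lambda>m v. pure_tensor A M W (f m) (g v)"])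
      (auto simp: f g' W.pure_add_left W.pure_add_right W.pure_balanced)
  define e where "e = frag_extend (\<lambda>(m, v). frag_of (f m, g v))"
  have e: "e c \<in> carrier (tensor_free M W) \<and> tensor_class A M W (e c) = h c"
    if "c \<in> carrier (Free)" for c
  proof -
    have "Poly_Mapping.keys c \<subseteq> carrier M \<times> carrier V" using that carrier_free by simp
    then show ?thesis
    proof (induction c rule: free_Abelian_group_induct[consumes 1])
      case 1
      have "0 = \<one>\<^bsub>tensor_free M W\<^esub>" "0 = \<one>\<^bsub>Free\<^esub>" by (simp_all add: tensor_free_def)
      then show ?case
        using hom_one[OF h(1) free.group_axioms W.tens.group_axioms] hom_one[OF W.class_hom W.free.group_axioms W.tens.group_axioms]
        by (simp add: e_def W.carrier_free)
    next
      case (2 x y)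
      then show ?case using hom_free_diff[OF h(1) W.tens.group_axioms] W.hom_free_diff[OF W.class_hom W.tens.group_axioms] carrier_free
        by (simp add: e_def frag_extend_diff W.free_diff)
    next
      case (3 x)
      then show ?case using f g' by (cases x) (auto simp: pure_tensor_def e_def h(2))
    qed
  qed
  have F: "tensor_map A M W f g (cls c) = h c" if c: "c \<in> carrier (Free)" for c
  proof -
    have "tensor_class A M W (e d) = h c" if d: "d \<in> cls c" for d
    proof -
      have "d \<in> carrier (Free)" using d c null.mem_carrier
        unfolding tensor_class_def r_coset_def by (auto intro: free.m_closed[simplified])
      then show ?thesis using e constant_on_class[OF h(1) W.tens.group_axioms h(3) c d] by simp
    qed
    then have "(\<Union>d\<in>cls c. tensor_class A M W (e d)) = h c"
      using class_self[OF c] by auto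
    then show ?thesis by (simp add: tensor_map_def e_def)
  qed
  show "tensor_map A M W f g \<in> hom (Tens) (tensor_group A M W)"
    by (rule factor_through_tensor[OF h(1) W.tens.group_axioms h(3) F])
  show "tensor_map A M W f g (pure m v) = pure_tensor A M W (f m) (g v)"
    if "m \<in> carrier M" "v \<in> carrier V" for m v
    using F[of "frag_of (m, v)"] h(2) that by (simp add: pure_tensor_def)
qed

lemma tensor_smult_hom:
  assumes "c \<in> carrier B"
  shows "smult (tensor A M V) c \<in> hom (Tens) (Tens)"
    and "\<And>m v. m \<in> carrier M \<Longrightarrow> v \<in> carrier V \<Longrightarrow>
      smult (tensor A M V) c (pure m v) = pure (c \<odot>\<^bsub>M\<^esub> m) v"
  using tensor_map_hom[OF V.graded_left_module_axioms, of "\<lambda>m. c \<odot>\<^bsub>M\<^esub> m" "\<lambda>v. v"] assms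
  by (auto simp: left.smult_closed left.smult_r_distr bimodule_assoc module_hom_def)

context
  fixes W :: "('a, 'w, 'e) graded_scheme"
  assumes W: "graded_left_module B W"
begin

interpretation W: graded_left_module B W by (rule W)
interpretation WG: abelian_group W by (rule W.group)

lemma module_hom_tensor_iff:
  "f \<in> module_hom B (tensor A M V) W \<longleftrightarrow> f \<in> hom (Tens) (add_monoid W) \<and>
    (\<forall>c\<in>carrier B. \<forall>T\<in>carrier (Tens). f (smult (tensor A M V) c T) = c \<odot>\<^bsub>W\<^esub> f T)"
  by (auto simp: module_hom_def hom_def)

lemma bihom_of_hom:
  assumes "f \<in> graded_hom B (tensor A M V) W"
  shows "tensor_bihom B A M V W (\<lambda>m v. f (pure m v))"
proof -
  have f: "f \<in> hom (Tens) (add_monoid W)"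
    and sm: "\<And>c T. c \<in> carrier B \<Longrightarrow> T \<in> carrier (Tens) \<Longrightarrow> f (smult (tensor A M V) c T) = c \<odot>\<^bsub>W\<^esub> f T"
    and gr: "\<And>z. f ` hcomp (tensor A M V) z \<subseteq> hcomp W z"
    using assms unfolding graded_hom_def module_hom_tensor_iff by auto
  have "f (pure m v) \<in> hcomp W (s + t)" if "m \<in> hcomp M s" "v \<in> hcomp V t" for m v s t
  proof -
    have "pure m v \<in> hcomp (tensor A M V) (s + t)"
      using that by (auto intro!: generate.incl)
    then show ?thesis using gr by blast
  qed
  moreover have "f (pure (c \<odot>\<^bsub>M\<^esub> m) v) = c \<odot>\<^bsub>W\<^esub> f (pure m v)"
    if "c \<in> carrier B" "m \<in> carrier M" "v \<in> carrier V" for c m v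
    using sm[of c "pure m v"] tensor_smult_hom(2)[of c m v] that by simp
  ultimately show ?thesis unfolding tensor_bihom_def
    using f hom_mult[OF f] by (auto simp: pure_add_left pure_add_right pure_balanced hom_def)
qed

text \<open>The balanced map extends to the free group and factors through the classes.  Linearity over \<open>B\<close>
  holds on pure tensors, hence everywhere.\<close>

lemma hom_of_bihom:
  assumes "tensor_bihom B A M V W b"
  shows "\<exists>f\<in>graded_hom B (tensor A M V) W.
    \<forall>m\<in>carrier M. \<forall>v\<in>carrier V. f (pure m v) = b m v"
proof -
  have WC: "comm_group (add_monoid W)" by (rule WG.a_comm_group)
  then have WGr: "group (add_monoid W)" by (simp add: comm_group_def)
  obtain h where h: "h \<in> hom (Free) (add_monoid W)"
    "\<And>m v. m \<in> carrier M \<Longrightarrow> v \<in> carrier V \<Longrightarrow> h (frag_of (m, v)) = b m v"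
    "\<And>c. c \<in> Rel \<Longrightarrow> h c = \<one>\<^bsub>add_monoid W\<^esub>"
    by (rule tensor_universal[OF WC, of b]) (use assms in \<open>auto simp: tensor_bihom_def\<close>)
  define f where "f T = h (SOME c. c \<in> T)" for T
  have f: "f (cls c) = h c" if "c \<in> carrier (Free)" for c
    unfolding f_def
    by (rule constant_on_class[OF h(1) WGr h(3) that]) (use class_self[OF that] in \<open>auto intro: someI\<close>)
  have fh: "f \<in> hom (Tens) (add_monoid W)"
    by (rule factor_through_tensor[OF h(1) WGr h(3) f])
  have fp: "f (pure m v) = b m v" if "m \<in> carrier M" "v \<in> carrier V" for m v
    using f[of "frag_of (m, v)"] h(2) that by (simp add: pure_tensor_def)
  have sm: "f (smult (tensor A M V) c T) = c \<odot>\<^bsub>W\<^esub> f T"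
    if c: "c \<in> carrier B" and T: "T \<in> carrier (Tens)" for c T
  proof -
    have 1: "(\<lambda>x. c \<odot>\<^bsub>W\<^esub> x) \<in> hom (add_monoid W) (add_monoid W)"
      using c by (auto simp: hom_def W.smult_closed W.smult_r_distr)
    have "(f \<circ> smult (tensor A M V) c) T = ((\<lambda>x. c \<odot>\<^bsub>W\<^esub> x) \<circ> f) T"
    proof (rule hom_eq_on_pure[OF _ _ WGr _ T])
      show "f \<circ> smult (tensor A M V) c \<in> hom (Tens) (add_monoid W)"
        using hom_compose[OF tensor_smult_hom(1)[OF c] fh] .
      show "(\<lambda>x. c \<odot>\<^bsub>W\<^esub> x) \<circ> f \<in> hom (Tens) (add_monoid W)"
        using hom_compose[OF fh 1] .
      show "(f \<circ> smult (tensor A M V) c) (pure m v) = ((\<lambda>x. c \<odot>\<^bsub>W\<^esub> x) \<circ> f) (pure m v)"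
        if "m \<in> carrier M" "v \<in> carrier V" for m v
        using that c assms by (simp add: tensor_smult_hom(2)[OF c] fp left.smult_closed tensor_bihom_def del: tensor_simps)
    qed
    then show ?thesis by simp
  qed
  have "f ` hcomp (tensor A M V) z \<subseteq> hcomp W z" for z
  proof -
    interpret f: group_hom "Tens" "add_monoid W" f
      using fh WGr by (simp add: group_hom_def group_hom_axioms_def tens.group_axioms)
    have Wz: "subgroup (hcomp W z) (add_monoid W)"
      using W.grading by (simp add: z2_grading_def additive_subgroup_def)
    let ?P = "{pure m v | m v s t. m \<in> hcomp M s \<and> v \<in> hcomp V t \<and> s + t = z}"
    have hM: "m \<in> carrier M" if "m \<in> hcomp M s" for m s
      using left.grading that additive_subgroup.a_subset unfolding z2_grading_def by blast
    have hV: "v \<in> carrier V" if "v \<in> hcomp V s" for v s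
      using V.grading that additive_subgroup.a_subset unfolding z2_grading_def by blast
    have "f ` generate (Tens) ?P = generate (add_monoid W) (f ` ?P)"
      by (rule f.generate_img[symmetric]) (auto simp: hM hV)
    also have "\<dots> \<subseteq> hcomp W z"
      using assms by (intro group.generate_subgroup_incl[OF WGr _ Wz]) (auto simp: fp hM hV tensor_bihom_def)
    finally show ?thesis by simp
  qed
  then have "f \<in> graded_hom B (tensor A M V) W"
    unfolding graded_hom_def module_hom_tensor_iff using fh sm by auto
  then show ?thesis using fp by blast
qed

lemma module_hom_is_group_hom: "f \<in> graded_hom B (tensor A M V) W \<Longrightarrow> f \<in> hom (Tens) (add_monoid W)"
  by (auto simp: graded_hom_def module_hom_def hom_def)

end

end

section \<open>Homogeneous bases and maps out of a bimodule\<close>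

lemma additive_finsum:
  assumes G: "abelian_group G" and H: "abelian_group H"
    and f: "\<And>x. x \<in> carrier G \<Longrightarrow> f x \<in> carrier H"
      "\<And>x y. x \<in> carrier G \<Longrightarrow> y \<in> carrier G \<Longrightarrow> f (x \<oplus>\<^bsub>G\<^esub> y) = f x \<oplus>\<^bsub>H\<^esub> f y"
    and I: "finite I" "\<And>i. i \<in> I \<Longrightarrow> g i \<in> carrier G"
  shows "f (finsum G g I) = finsum H (\<lambda>i. f (g i)) I"
proof -
  interpret G: abelian_group G by (rule G)
  interpret H: abelian_group H by (rule H)
  have zero: "f \<zero>\<^bsub>G\<^esub> = \<zero>\<^bsub>H\<^esub>"
    using f(1)[of "\<zero>\<^bsub>G\<^esub>"] f(2)[of "\<zero>\<^bsub>G\<^esub>" "\<zero>\<^bsub>G\<^esub>"] by simp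
  show ?thesis using I
  proof (induction I rule: finite_induct)
    case (insert i I)
    have "f (finsum G g (insert i I)) = f (g i \<oplus>\<^bsub>G\<^esub> finsum G g I)"
      using insert by (subst G.finsum_insert) auto
    also have "\<dots> = f (g i) \<oplus>\<^bsub>H\<^esub> finsum H (\<lambda>i. f (g i)) I"
      using insert by (subst f(2)) (auto intro!: G.finsum_closed)
    also have "\<dots> = finsum H (\<lambda>i. f (g i)) (insert i I)"
      using insert f(1) by (subst H.finsum_insert) auto
    finally show ?case .
  qed (simp add: zero)
qed

lemma (in z2_graded_group) deg_eq: "x \<in> hcomp V z \<Longrightarrow> x \<noteq> \<zero> \<Longrightarrow> deg V x = z"
  unfolding deg_def by (rule the_equality) (use hcomp_disjoint'[of x] in blast)+

locale based_module = superdivision_module K B M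
  for K :: "('k, 'r) ring_scheme" and B :: "('k, 'a) graded" and M :: "('a, 'm, 'c) graded_scheme" (structure) +
  fixes L :: "'l set" and m :: "'l \<Rightarrow> 'm"
  assumes basis: "homogeneous_basis B M L m"
begin

sublocale BG: z2_graded_group B
  using grading M.abelian_group_axioms by (simp add: z2_graded_group_def z2_graded_group_axioms_def)

lemma finite_basis: "finite L" using basis by (simp add: homogeneous_basis_def)

lemma basis_homogeneous: "l \<in> L \<Longrightarrow> \<exists>z. m l \<in> hcomp M z"
  using basis by (simp add: homogeneous_basis_def)

lemma basis_closed [simp]: "l \<in> L \<Longrightarrow> m l \<in> carrier M"
  using basis_homogeneous VG.hcompD by blast

definition coords :: "'m \<Rightarrow> 'l \<Rightarrow> 'a" where
  "coords x = (THE c. c \<in> (\<Pi>\<^sub>E l\<in>L. carrier B) \<and> x = (\<Oplus>l\<in>L. c l \<odot> m l))"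

lemma coords_props:
  assumes "x \<in> carrier M"
  shows "coords x \<in> (\<Pi>\<^sub>E l\<in>L. carrier B)" "x = (\<Oplus>l\<in>L. coords x l \<odot> m l)"
proof -
  have "\<exists>!c. c \<in> (\<Pi>\<^sub>E l\<in>L. carrier B) \<and> x = (\<Oplus>l\<in>L. c l \<odot> m l)"
    using basis assms by (simp add: homogeneous_basis_def)
  from theI'[OF this] show "coords x \<in> (\<Pi>\<^sub>E l\<in>L. carrier B)" "x = (\<Oplus>l\<in>L. coords x l \<odot> m l)"
    unfolding coords_def by blast+
qed

lemma coords_closed [simp]: "x \<in> carrier M \<Longrightarrow> l \<in> L \<Longrightarrow> coords x l \<in> carrier B"
  using coords_props(1) by (auto simp: PiE_iff)

lemma coords_eqI:
  assumes c: "\<And>l. l \<in> L \<Longrightarrow> c l \<in> carrier B" and x: "x = (\<Oplus>l\<in>L. c l \<odot> m l)" and l: "l \<in> L"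
  shows "coords x l = c l"
proof -
  have xM: "x \<in> carrier M" unfolding x using c by (auto intro!: VG.finsum_closed V.smult_closed)
  have "x = (\<Oplus>l\<in>L. restrict c L l \<odot> m l)" unfolding x
    by (rule VG.finsum_cong') (use c in \<open>auto intro!: V.smult_closed\<close>)
  moreover have "restrict c L \<in> (\<Pi>\<^sub>E l\<in>L. carrier B)" using c by auto
  ultimately have "coords x = restrict c L"
    using basis xM coords_props[OF xM] unfolding homogeneous_basis_def by blast
  then show ?thesis using l by simp
qed

lemma coords_add [simp]:
  assumes "x \<in> carrier M" "y \<in> carrier M" "l \<in> L"
  shows "coords (x \<oplus> y) l = coords x l \<oplus>\<^bsub>B\<^esub> coords y l"
proof (rule coords_eqI)
  have "(\<Oplus>l\<in>L. (coords x l \<oplus>\<^bsub>B\<^esub> coords y l) \<odot> m l) =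
      (\<Oplus>l\<in>L. coords x l \<odot> m l \<oplus> coords y l \<odot> m l)"
    by (rule VG.finsum_cong') (use assms in \<open>auto simp: V.smult_l_distr V.smult_closed\<close>)
  also have "\<dots> = x \<oplus> y"
    using assms by (subst VG.finsum_addf) (auto simp: V.smult_closed coords_props(2)[symmetric])
  finally show "x \<oplus> y = (\<Oplus>l\<in>L. (coords x l \<oplus>\<^bsub>B\<^esub> coords y l) \<odot> m l)" ..
qed (use assms in auto)

lemma smult_finsum:
  assumes "b \<in> carrier B" "finite I" "\<And>i. i \<in> I \<Longrightarrow> g i \<in> carrier M"
  shows "b \<odot> (\<Oplus>i\<in>I. g i) = (\<Oplus>i\<in>I. b \<odot> g i)"
  by (rule additive_finsum[OF V.group V.group]) (use assms in \<open>auto simp: V.smult_closed V.smult_r_distr\<close>)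

lemma coords_smult [simp]:
  assumes "b \<in> carrier B" "x \<in> carrier M" "l \<in> L"
  shows "coords (b \<odot> x) l = b \<otimes>\<^bsub>B\<^esub> coords x l"
proof (rule coords_eqI)
  have "b \<odot> x = b \<odot> (\<Oplus>l\<in>L. coords x l \<odot> m l)"
    using coords_props(2)[OF assms(2)] by simp
  also have "\<dots> = (\<Oplus>l\<in>L. b \<odot> (coords x l \<odot> m l))"
    using assms finite_basis by (intro smult_finsum) (auto simp: V.smult_closed)
  also have "\<dots> = (\<Oplus>l\<in>L. (b \<otimes>\<^bsub>B\<^esub> coords x l) \<odot> m l)"
    by (rule VG.finsum_cong') (use assms in \<open>auto simp: V.smult_closed V.smult_assoc\<close>)
  finally show "b \<odot> x = (\<Oplus>l\<in>L. (b \<otimes>\<^bsub>B\<^esub> coords x l) \<odot> m l)" .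
qed (use assms in auto)

lemma finsum_single:
  assumes "abelian_group W" "l \<in> L" "f l \<in> carrier W" "\<And>k. k \<in> L \<Longrightarrow> k \<noteq> l \<Longrightarrow> f k = \<zero>\<^bsub>W\<^esub>"
  shows "finsum W f L = f l"
proof -
  interpret W: abelian_group W by (rule assms(1))
  have fL: "f k \<in> carrier W" if "k \<in> L" for k
    using assms(3) assms(4)[OF that] by (cases "k = l") auto
  have "finsum W f L = finsum W (\<lambda>k. if l = k then f k else \<zero>\<^bsub>W\<^esub>) L"
  proof (rule W.finsum_cong')
    show "f k = (if l = k then f k else \<zero>\<^bsub>W\<^esub>)" if "k \<in> L" for k
      using assms(4)[OF that] by (cases "l = k") auto
  qed (use assms(3) in auto)
  also have "\<dots> = f l" using assms(2) finite_basis fL by (intro W.finsum_singleton) auto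
  finally show ?thesis .
qed

lemma coords_basis:
  assumes "k \<in> L" "l \<in> L"
  shows "coords (m k) l = (if l = k then \<one>\<^bsub>B\<^esub> else \<zero>\<^bsub>B\<^esub>)"
proof (rule coords_eqI)
  show "m k = (\<Oplus>l\<in>L. (if l = k then \<one>\<^bsub>B\<^esub> else \<zero>\<^bsub>B\<^esub>) \<odot> m l)"
    using assms by (subst finsum_single[OF V.group assms(1)]) (auto simp: V.smult_one)
qed (use assms in auto)

lemma basis_nonzero: "l \<in> L \<Longrightarrow> m l \<noteq> \<zero>"
proof
  assume l: "l \<in> L" "m l = \<zero>"
  then have "coords (m l) l = \<zero>\<^bsub>B\<^esub>"
    using coords_smult[of "\<zero>\<^bsub>B\<^esub>" "\<zero>" l] by simp
  then show False using coords_basis[OF l(1) l(1)] nontrivial by simp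
qed

lemma basis_deg: "l \<in> L \<Longrightarrow> m l \<in> hcomp M (deg M (m l))"
  using basis_homogeneous[of l] VG.deg_eq basis_nonzero by metis

lemma bit_cancel: "(s::bit) + t + t = s" "(s::bit) + (s + t) = t"
  by (cases s; cases t; simp)+

text \<open>The component of degree \<open>s\<close> of \<open>x\<close> is obtained by replacing every coordinate \<open>c\<close> by its
  component of degree \<open>s + deg (m l)\<close>.  As \<open>x\<close> is its own component, uniqueness of coordinates shows
  that they were homogeneous of that degree.\<close>

lemma coords_graded:
  assumes x: "x \<in> hcomp M s" and l: "l \<in> L"
  shows "coords x l \<in> hcomp B (s + deg M (m l))"
proof -
  let ?z = "\<lambda>l. deg M (m l)"
  have xM: "x \<in> carrier M" using x by simp
  have p: "part M s (c \<odot> m l) = part B (s + ?z l) c \<odot> m l" if "l \<in> L" "c \<in> carrier B" for l c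
  proof -
    let ?t = "s + ?z l"
    have c: "c = part B ?t c \<oplus>\<^bsub>B\<^esub> part B (?t + 1) c"
      using BG.part_sum[OF that(2)] that(2) BG.part_carrier M.a_comm by (cases ?t) (auto simp: add.commute)
    have 1: "part B ?t c \<odot> m l \<in> hcomp M s"
      using V.smult_graded[OF BG.part_closed[OF that(2), of ?t] basis_deg[OF that(1)]] by (simp add: bit_cancel)
    have 2: "part B (?t + 1) c \<odot> m l \<in> hcomp M (s + 1)"
      using V.smult_graded[OF BG.part_closed[OF that(2), of "?t + 1"] basis_deg[OF that(1)]]
      by (simp add: bit_cancel add.assoc add.left_commute add.commute)
    have "part M s (c \<odot> m l) = part M s (part B ?t c \<odot> m l) \<oplus> part M s (part B (?t + 1) c \<odot> m l)"
      using that 1 2 by (subst (1) c, subst V.smult_l_distr) auto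
    also have "\<dots> = part B ?t c \<odot> m l"
      using 1 2 by (cases s) (auto simp: VG.part_homogeneous)
    finally show ?thesis .
  qed
  have "x = part M s x" using x by (simp add: VG.part_homogeneous)
  also have "\<dots> = part M s (\<Oplus>l\<in>L. coords x l \<odot> m l)" using coords_props(2)[OF xM] by simp
  also have "\<dots> = (\<Oplus>l\<in>L. part M s (coords x l \<odot> m l))"
    using xM finite_basis by (intro additive_finsum[OF V.group V.group]) (auto simp: V.smult_closed)
  also have "\<dots> = (\<Oplus>l\<in>L. part B (s + ?z l) (coords x l) \<odot> m l)"
    by (rule VG.finsum_cong') (use xM p in \<open>auto simp: V.smult_closed\<close>)
  finally have "coords x l = part B (s + ?z l) (coords x l)"
    using xM l by (intro coords_eqI) auto
  then show ?thesis using BG.part_closed[of "coords x l" "s + ?z l"] xM l by simp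
qed

text \<open>The \<open>B\<close>-linear map \<open>M \<rightarrow> W\<close> with \<open>m l \<mapsto> f l\<close>.\<close>

definition expand :: "('a, 'w, 'e) graded_scheme \<Rightarrow> ('l \<Rightarrow> 'w) \<Rightarrow> 'm \<Rightarrow> 'w" where
  "expand W f x = (\<Oplus>\<^bsub>W\<^esub>l\<in>L. coords x l \<odot>\<^bsub>W\<^esub> f l)"

context
  fixes W :: "('a, 'w, 'e) graded_scheme"
  assumes W: "graded_left_module B W"
begin

interpretation W: superdivision_module K B W
  using W closed_superdivision_axioms by (simp add: superdivision_module_def)

lemma expand_closed:
  "(\<And>l. l \<in> L \<Longrightarrow> f l \<in> carrier W) \<Longrightarrow> x \<in> carrier M \<Longrightarrow> expand W f x \<in> carrier W"
  unfolding expand_def by (auto intro!: W.VG.finsum_closed W.V.smult_closed)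

lemma expand_cong:
  assumes "\<And>l. l \<in> L \<Longrightarrow> f l = g l" "\<And>l. l \<in> L \<Longrightarrow> g l \<in> carrier W" "x \<in> carrier M"
  shows "expand W f x = expand W g x"
  unfolding expand_def by (rule W.VG.finsum_cong') (use assms in \<open>auto simp: W.V.smult_closed\<close>)

lemma expand_add_left:
  assumes "\<And>l. l \<in> L \<Longrightarrow> f l \<in> carrier W" "x \<in> carrier M" "y \<in> carrier M"
  shows "expand W f (x \<oplus> y) = expand W f x \<oplus>\<^bsub>W\<^esub> expand W f y"
proof -
  have "expand W f (x \<oplus> y) = (\<Oplus>\<^bsub>W\<^esub>l\<in>L. coords x l \<odot>\<^bsub>W\<^esub> f l \<oplus>\<^bsub>W\<^esub> coords y l \<odot>\<^bsub>W\<^esub> f l)"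
    unfolding expand_def
    by (rule W.VG.finsum_cong') (use assms in \<open>auto simp: W.V.smult_closed W.V.smult_l_distr\<close>)
  also have "\<dots> = expand W f x \<oplus>\<^bsub>W\<^esub> expand W f y" unfolding expand_def
    using assms by (intro W.VG.finsum_addf) (auto simp: W.V.smult_closed)
  finally show ?thesis .
qed

lemma expand_add_right:
  assumes "\<And>l. l \<in> L \<Longrightarrow> f l \<in> carrier W" "\<And>l. l \<in> L \<Longrightarrow> g l \<in> carrier W" "x \<in> carrier M"
  shows "expand W (\<lambda>l. f l \<oplus>\<^bsub>W\<^esub> g l) x = expand W f x \<oplus>\<^bsub>W\<^esub> expand W g x"
proof -
  have "expand W (\<lambda>l. f l \<oplus>\<^bsub>W\<^esub> g l) x = (\<Oplus>\<^bsub>W\<^esub>l\<in>L. coords x l \<odot>\<^bsub>W\<^esub> f l \<oplus>\<^bsub>W\<^esub> coords x l \<odot>\<^bsub>W\<^esub> g l)"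
    unfolding expand_def
    by (rule W.VG.finsum_cong') (use assms in \<open>auto simp: W.V.smult_closed W.V.smult_r_distr\<close>)
  also have "\<dots> = expand W f x \<oplus>\<^bsub>W\<^esub> expand W g x" unfolding expand_def
    using assms by (intro W.VG.finsum_addf) (auto simp: W.V.smult_closed)
  finally show ?thesis .
qed

lemma W_smult_finsum:
  assumes "b \<in> carrier B" "\<And>i. i \<in> L \<Longrightarrow> g i \<in> carrier W"
  shows "b \<odot>\<^bsub>W\<^esub> (\<Oplus>\<^bsub>W\<^esub>i\<in>L. g i) = (\<Oplus>\<^bsub>W\<^esub>i\<in>L. b \<odot>\<^bsub>W\<^esub> g i)"
  by (rule additive_finsum[OF W.V.group W.V.group])
    (use assms finite_basis in \<open>auto simp: W.V.smult_closed W.V.smult_r_distr\<close>)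

lemma expand_smult:
  assumes "\<And>l. l \<in> L \<Longrightarrow> f l \<in> carrier W" "x \<in> carrier M" "b \<in> carrier B"
  shows "expand W f (b \<odot> x) = b \<odot>\<^bsub>W\<^esub> expand W f x"
proof -
  have "expand W f (b \<odot> x) = (\<Oplus>\<^bsub>W\<^esub>l\<in>L. b \<odot>\<^bsub>W\<^esub> (coords x l \<odot>\<^bsub>W\<^esub> f l))"
    unfolding expand_def
    by (rule W.VG.finsum_cong') (use assms in \<open>auto simp: W.V.smult_closed W.V.smult_assoc\<close>)
  also have "\<dots> = b \<odot>\<^bsub>W\<^esub> expand W f x" unfolding expand_def
    using assms by (intro W_smult_finsum[symmetric]) (auto simp: W.V.smult_closed)
  finally show ?thesis .
qed

text \<open>Scalars from \<open>K\<close> are central in \<open>B\<close> and so commute with the coordinates.\<close>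

lemma expand_kmult:
  assumes "\<And>l. l \<in> L \<Longrightarrow> f l \<in> carrier W" "x \<in> carrier M" "c \<in> carrier K"
  shows "expand W (\<lambda>l. (c \<odot>\<^bsub>B\<^esub> \<one>\<^bsub>B\<^esub>) \<odot>\<^bsub>W\<^esub> f l) x = (c \<odot>\<^bsub>B\<^esub> \<one>\<^bsub>B\<^esub>) \<odot>\<^bsub>W\<^esub> expand W f x"
proof -
  have "expand W (\<lambda>l. (c \<odot>\<^bsub>B\<^esub> \<one>\<^bsub>B\<^esub>) \<odot>\<^bsub>W\<^esub> f l) x =
      (\<Oplus>\<^bsub>W\<^esub>l\<in>L. (c \<odot>\<^bsub>B\<^esub> \<one>\<^bsub>B\<^esub>) \<odot>\<^bsub>W\<^esub> (coords x l \<odot>\<^bsub>W\<^esub> f l))"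
    unfolding expand_def
    by (rule W.VG.finsum_cong')
      (use assms in \<open>auto simp: W.V.smult_closed smult_mult_left smult_mult_right simp flip: W.V.smult_assoc\<close>)
  also have "\<dots> = (c \<odot>\<^bsub>B\<^esub> \<one>\<^bsub>B\<^esub>) \<odot>\<^bsub>W\<^esub> expand W f x" unfolding expand_def
    using assms by (intro W_smult_finsum[symmetric]) (auto simp: W.V.smult_closed)
  finally show ?thesis .
qed

lemma expand_basis:
  assumes "\<And>l. l \<in> L \<Longrightarrow> f l \<in> carrier W" "l \<in> L"
  shows "expand W f (m l) = f l"
  unfolding expand_def using assms
  by (subst finsum_single[OF W.V.group assms(2)]) (auto simp: coords_basis W.V.smult_one)

lemma expand_graded:
  assumes "\<And>l. l \<in> L \<Longrightarrow> f l \<in> hcomp W (t + deg M (m l))" "x \<in> hcomp M s"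
  shows "expand W f x \<in> hcomp W (s + t)"
  unfolding expand_def
proof (rule W.VG.hcomp_finsum)
  fix l assume l: "l \<in> L"
  have "s + deg M (m l) + (t + deg M (m l)) = s + t"
    by (cases s; cases t; cases "deg M (m l)") auto
  then show "coords x l \<odot>\<^bsub>W\<^esub> f l \<in> hcomp W (s + t)"
    using W.V.smult_graded[OF coords_graded[OF assms(2) l] assms(1)[OF l]] by simp
qed

lemma linear_eq_expand:
  assumes "\<And>x. x \<in> carrier M \<Longrightarrow> g x \<in> carrier W"
    "\<And>x y. x \<in> carrier M \<Longrightarrow> y \<in> carrier M \<Longrightarrow> g (x \<oplus> y) = g x \<oplus>\<^bsub>W\<^esub> g y"
    "\<And>b x. b \<in> carrier B \<Longrightarrow> x \<in> carrier M \<Longrightarrow> g (b \<odot> x) = b \<odot>\<^bsub>W\<^esub> g x"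
    and x: "x \<in> carrier M"
  shows "g x = expand W (\<lambda>l. g (m l)) x"
proof -
  have "g x = g (\<Oplus>l\<in>L. coords x l \<odot> m l)" using coords_props(2)[OF x] by simp
  also have "\<dots> = (\<Oplus>\<^bsub>W\<^esub>l\<in>L. g (coords x l \<odot> m l))"
    using x assms finite_basis by (intro additive_finsum[OF V.group W.V.group]) (auto simp: V.smult_closed)
  also have "\<dots> = expand W (\<lambda>l. g (m l)) x" unfolding expand_def
    by (rule W.VG.finsum_cong') (use x assms in \<open>auto simp: W.V.smult_closed\<close>)
  finally show ?thesis .
qed

end
end

text \<open>The situation of one pair of indices: \<open>A\<close> and \<open>B\<close> are the algebras at the tail and at the head,
  and \<open>M\<close> is the bimodule with its basis.\<close>

locale arrow_data = tensor_data K B A M V + AA: closed_superdivision K A + based_module K B M L m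
  + W: graded_left_module B W
  for K :: "('k, 'r) ring_scheme" and B :: "('k, 'a) graded" and A :: "('k, 'a) graded"
    and M :: "('a, 'm) graded_bimod" and V :: "('a, 'v) graded" and L :: "'l set" and m :: "'l \<Rightarrow> 'm"
    and W :: "('a, 'w) graded"
begin

lemmas W_mod = W.graded_left_module_axioms

sublocale AV: superdivision_module K A V
  using AA.closed_superdivision_axioms V.graded_left_module_axioms by (simp add: superdivision_module_def)
sublocale BW: superdivision_module K B W
  using closed_superdivision_axioms W_mod by (simp add: superdivision_module_def)

text \<open>By linearity over \<open>B\<close> the values on the basis suffice.  The component of degree 1 can be ignored
  in the presence of \<open>\<epsilon>\<close>: an element \<open>v\<close> of it is \<open>\<epsilon> (\<epsilon> v)\<close>, and the outer \<open>\<epsilon>\<close> moves to the other side.\<close>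

lemma bihom_eqI:
  assumes b: "tensor_bihom B A M V W b" and b': "tensor_bihom B A M V W b'"
    and eq: "\<And>l z v. l \<in> L \<Longrightarrow> z = 0 \<or> purely_even A \<Longrightarrow> v \<in> hcomp V z \<Longrightarrow> b (m l) v = b' (m l) v"
    and x: "x \<in> carrier M" and v: "v \<in> carrier V"
  shows "b x v = b' x v"
proof -
  have vert: "b x v = b' x v" if x: "x \<in> carrier M" and z: "z = 0 \<or> purely_even A" and v: "v \<in> hcomp V z" for x z v
  proof -
    have vV: "v \<in> carrier V" using v by simp
    have "b x v = expand W (\<lambda>l. b (m l) v) x"
      using b vV x by (intro linear_eq_expand[OF W_mod, where g = "\<lambda>x. b x v"])
        (auto simp: tensor_bihom_def)
    also have "\<dots> = expand W (\<lambda>l. b' (m l) v) x"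
      using b' vV x eq[OF _ z v] by (intro expand_cong[OF W_mod]) (auto simp: tensor_bihom_def)
    also have "\<dots> = b' x v"
      using b' vV x by (intro linear_eq_expand[OF W_mod, where g = "\<lambda>x. b' x v", symmetric])
        (auto simp: tensor_bihom_def)
    finally show ?thesis .
  qed
  have hom: "b x v = b' x v" if v: "v \<in> hcomp V z" for z v
  proof (cases "z = 0 \<or> purely_even A")
    case True
    then show ?thesis using vert x v by blast
  next
    case False
    let ?e = "odd_unit A"
    have vV: "v \<in> carrier V" using v by simp
    have ev: "?e \<odot>\<^bsub>V\<^esub> v \<in> hcomp V 0" using AV.unit_graded[OF v] False by simp
    have eq: "?e \<odot>\<^bsub>V\<^esub> (?e \<odot>\<^bsub>V\<^esub> v) = v" using AV.unit_unit False vV by blast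
    have eV: "?e \<odot>\<^bsub>V\<^esub> v \<in> carrier V" using ev by simp
    have "b x v = b (rsmult M x ?e) (?e \<odot>\<^bsub>V\<^esub> v)"
      using b x eV eq unfolding tensor_bihom_def by (metis AA.odd_unit_in_carrier)
    also have "\<dots> = b' (rsmult M x ?e) (?e \<odot>\<^bsub>V\<^esub> v)"
      using vert[OF _ _ ev] x by (simp add: rsmult_closed)
    also have "\<dots> = b' x v"
      using b' x eV eq unfolding tensor_bihom_def by (metis AA.odd_unit_in_carrier)
    finally show ?thesis .
  qed
  obtain v0 v1 where v': "v0 \<in> hcomp V 0" "v1 \<in> hcomp V 1" "v = v0 \<oplus>\<^bsub>V\<^esub> v1"
    using AV.VG.decomposition v by blast
  have "v0 \<in> carrier V" "v1 \<in> carrier V" using v' by auto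
  then have "b x v = b x v0 \<oplus>\<^bsub>W\<^esub> b x v1" "b' x v = b' x v0 \<oplus>\<^bsub>W\<^esub> b' x v1"
    using b b' x by (simp_all add: v'(3) tensor_bihom_def)
  then show ?thesis using hom[OF v'(1)] hom[OF v'(2)] by simp
qed

lemma bihom_kmult:
  assumes b: "tensor_bihom B A M V W b" and "c \<in> carrier K" "x \<in> carrier M" "v \<in> carrier V"
  shows "b x ((c \<odot>\<^bsub>A\<^esub> \<one>\<^bsub>A\<^esub>) \<odot>\<^bsub>V\<^esub> v) = (c \<odot>\<^bsub>B\<^esub> \<one>\<^bsub>B\<^esub>) \<odot>\<^bsub>W\<^esub> b x v"
proof -
  have "b x ((c \<odot>\<^bsub>A\<^esub> \<one>\<^bsub>A\<^esub>) \<odot>\<^bsub>V\<^esub> v) = b (rsmult M x (c \<odot>\<^bsub>A\<^esub> \<one>\<^bsub>A\<^esub>)) v"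
    using assms by (simp add: tensor_bihom_def)
  also have "rsmult M x (c \<odot>\<^bsub>A\<^esub> \<one>\<^bsub>A\<^esub>) = (c \<odot>\<^bsub>B\<^esub> \<one>\<^bsub>B\<^esub>) \<odot>\<^bsub>M\<^esub> x"
    using central assms by simp
  finally show ?thesis using assms by (simp add: tensor_bihom_def)
qed

end

lemma tensor_bihom_post:
  assumes b: "tensor_bihom B A M V W b" and f: "f \<in> graded_hom B W W'"
  shows "tensor_bihom B A M V W' (\<lambda>x v. f (b x v))"
proof -
  have "f \<in> module_hom B W W'" and "\<And>z x. x \<in> hcomp W z \<Longrightarrow> f x \<in> hcomp W' z"
    using f by (auto simp: graded_hom_def)
  note f' = module_hom_closed[OF this(1), THEN funcset_mem] module_hom_add[OF this(1)]
    module_hom_smult[OF this(1)] this(2)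
  show ?thesis using b f' unfolding tensor_bihom_def by simp
qed

lemma tensor_bihom_pre:
  assumes b: "tensor_bihom B A M V' W b" and f: "f \<in> graded_hom A V V'"
  shows "tensor_bihom B A M V W (\<lambda>x v. b x (f v))"
proof -
  have "f \<in> module_hom A V V'" and "\<And>z x. x \<in> hcomp V z \<Longrightarrow> f x \<in> hcomp V' z"
    using f by (auto simp: graded_hom_def)
  note f' = module_hom_closed[OF this(1), THEN funcset_mem] module_hom_add[OF this(1)]
    module_hom_smult[OF this(1)] this(2)
  show ?thesis using b f' unfolding tensor_bihom_def by simp
qed

context superdivision_module_pair
begin

lemma graded_homD:
  assumes "f \<in> graded_hom A V W"
  shows "x \<in> carrier V \<Longrightarrow> f x \<in> carrier W"
    "x \<in> carrier V \<Longrightarrow> y \<in> carrier V \<Longrightarrow> f (x \<oplus>\<^bsub>V\<^esub> y) = f x \<oplus>\<^bsub>W\<^esub> f y"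
    "a \<in> carrier A \<Longrightarrow> x \<in> carrier V \<Longrightarrow> f (a \<odot>\<^bsub>V\<^esub> x) = a \<odot>\<^bsub>W\<^esub> f x"
    "x \<in> hcomp V z \<Longrightarrow> f x \<in> hcomp W z"
  using assms unfolding graded_hom_def module_hom_def by (auto simp: image_subset_iff)

lemma graded_hom_restrict:
  "restrict f (carrier V) \<in> graded_hom A V W" if "f \<in> graded_hom A V W"
  using graded_homD[OF that] unfolding graded_hom_def module_hom_def
  by (auto simp: V.V.smult_closed)

text \<open>In the presence of \<open>\<epsilon>\<close> the value at an odd \<open>x = \<epsilon> (\<epsilon> x)\<close> is determined by the value at the even
  element \<open>\<epsilon> x\<close>.\<close>

lemma graded_hom_eqI:
  assumes f: "f \<in> graded_hom A V W" and g: "g \<in> graded_hom A V W"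
    and eq: "\<And>z x. z = 0 \<or> purely_even A \<Longrightarrow> x \<in> hcomp V z \<Longrightarrow> f x = g x"
    and x: "x \<in> carrier V"
  shows "f x = g x"
proof -
  have hom: "f x = g x" if x: "x \<in> hcomp V z" for z x
  proof (cases "z = 0 \<or> purely_even A")
    case False
    let ?e = "odd_unit A"
    have xV: "x \<in> carrier V" using x by simp
    have ex: "?e \<odot>\<^bsub>V\<^esub> x \<in> hcomp V 0" using V.unit_graded[OF x] False by simp
    have "x = ?e \<odot>\<^bsub>V\<^esub> (?e \<odot>\<^bsub>V\<^esub> x)" using V.unit_unit False xV by metis
    then show ?thesis using graded_homD(3)[OF f, of ?e "?e \<odot>\<^bsub>V\<^esub> x"] graded_homD(3)[OF g, of ?e "?e \<odot>\<^bsub>V\<^esub> x"]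
      eq[OF _ ex] xV by simp
  qed (use eq x in blast)
  obtain y z where yz: "y \<in> hcomp V 0" "z \<in> hcomp V 1" "x = y \<oplus>\<^bsub>V\<^esub> z" using V.VG.decomposition x by blast
  then show ?thesis using hom[OF yz(1)] hom[OF yz(2)] graded_homD(2)[OF f] graded_homD(2)[OF g] by auto
qed

lemma extend_vertex_pieces:
  assumes g: "\<And>z. z = 0 \<or> purely_even A \<Longrightarrow> g z \<in> module_hom K (piece A V z) (piece A W z)"
  shows "\<exists>f\<in>graded_hom A V W. \<forall>z x. z = 0 \<or> purely_even A \<longrightarrow> x \<in> hcomp V z \<longrightarrow> f x = g z x"
proof (cases "purely_even A")
  case True
  then have e: "odd_unit A = \<zero>\<^bsub>A\<^esub>" by (simp add: odd_unit_def)
  have gz: "g z \<in> module_hom K (piece A V z) (piece A W z)" for z using g True by blast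
  have g0: "g z \<zero>\<^bsub>V\<^esub> = \<zero>\<^bsub>W\<^esub>" for z
    using module_hom_add[OF gz[of z], of "\<zero>\<^bsub>V\<^esub>" "\<zero>\<^bsub>V\<^esub>"] module_hom_closed[OF gz[of z]] W.VG.hcompD[of "g z \<zero>\<^bsub>V\<^esub>" z]
      W.VG.add.l_cancel_one'[of "g z \<zero>\<^bsub>V\<^esub>" "g z \<zero>\<^bsub>V\<^esub>"] by (auto simp: Pi_iff)
  have ge: "g (z + 1) (odd_unit A \<odot>\<^bsub>V\<^esub> x) = odd_unit A \<odot>\<^bsub>W\<^esub> g z x" if x: "x \<in> hcomp V z" for z x
  proof -
    have "g z x \<in> hcomp W z" using module_hom_closed[OF gz[of z]] x by auto
    then show ?thesis using x by (simp add: e g0)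
  qed
  show ?thesis
    by (rule bexI[OF _ extend_pieces(1)[OF gz ge]]) (use extend_pieces(2)[OF gz ge] in blast)+
next
  case False
  let ?e = "odd_unit A"
  \<comment> \<open>The only possible continuation to the odd component.\<close>
  define g' where "g' z = (if z = 0 then g 0 else (\<lambda>x. ?e \<odot>\<^bsub>W\<^esub> g 0 (?e \<odot>\<^bsub>V\<^esub> x)))" for z :: bit
  have g0: "g 0 \<in> module_hom K (piece A V 0) (piece A W 0)" using g by blast
  have gc: "g 0 x \<in> hcomp W 0" if "x \<in> hcomp V 0" for x using module_hom_closed[OF g0] that by auto
  have gc': "g 0 x \<in> carrier W" if "x \<in> hcomp V 0" for x using gc[OF that] by simp
  have ex: "?e \<odot>\<^bsub>V\<^esub> x \<in> hcomp V 0" if "x \<in> hcomp V 1" for x using V.unit_graded[OF that] by simp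
  have ex': "?e \<odot>\<^bsub>V\<^esub> x \<in> hcomp V 1" if "x \<in> hcomp V 0" for x using V.unit_graded[OF that] by simp
  have ga: "g 0 (x \<oplus>\<^bsub>V\<^esub> y) = g 0 x \<oplus>\<^bsub>W\<^esub> g 0 y" if "x \<in> hcomp V 0" "y \<in> hcomp V 0" for x y
    using module_hom_add[OF g0, of x y] that by simp
  have gs: "g 0 ((c \<odot>\<^bsub>A\<^esub> \<one>\<^bsub>A\<^esub>) \<odot>\<^bsub>V\<^esub> x) = (c \<odot>\<^bsub>A\<^esub> \<one>\<^bsub>A\<^esub>) \<odot>\<^bsub>W\<^esub> g 0 x" if "c \<in> carrier K" "x \<in> hcomp V 0" for x c
    using module_hom_smult[OF g0, of c x] that by simp
  have "(\<lambda>x. ?e \<odot>\<^bsub>W\<^esub> g 0 (?e \<odot>\<^bsub>V\<^esub> x)) \<in> module_hom K (piece A V 1) (piece A W 1)"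
    unfolding module_hom_def
    using ex gc gc' W.unit_graded[of _ 0]
    by (auto simp: V.V.smult_r_distr W.V.smult_r_distr ga gs V.kmult_unit W.kmult_unit)
  then have m: "g' z \<in> module_hom K (piece A V z) (piece A W z)" for z
    using g0 by (cases z) (simp_all add: g'_def)
  have "g' (z + 1) (?e \<odot>\<^bsub>V\<^esub> x) = ?e \<odot>\<^bsub>W\<^esub> g' z x" if "x \<in> hcomp V z" for z x
    using that ex gc' by (cases z) (auto simp: g'_def V.unit_unit[OF False] W.unit_unit[OF False])
  then obtain f where f: "f \<in> graded_hom A V W" "\<And>z x. x \<in> hcomp V z \<Longrightarrow> f x = g' z x"
    using extend_pieces[of g'] m by blast
  then show ?thesis using False by (intro bexI[of _ f]) (auto simp: g'_def)
qed

end

section \<open>Graded modules with prescribed components\<close>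

context closed_superdivision
begin

text \<open>The coordinates with respect to \<open>1\<close> and \<open>\<epsilon>\<close>.  If \<open>\<epsilon>\<close> is zero then the second coordinate is
  arbitrary; it is set to zero.\<close>

definition unit_coords :: "'a \<Rightarrow> 'k \<times> 'k" where
  "unit_coords a = (THE (c, d). c \<in> carrier K \<and> d \<in> carrier K \<and> (purely_even A \<longrightarrow> d = \<zero>\<^bsub>K\<^esub>) \<and>
    a = c \<odot> \<one> \<oplus> d \<odot> odd_unit A)"

lemma unit_coords_eq:
  assumes K: "c \<in> carrier K" "d \<in> carrier K" and d: "purely_even A \<longrightarrow> d = \<zero>\<^bsub>K\<^esub>"
  shows "unit_coords (c \<odot> \<one> \<oplus> d \<odot> odd_unit A) = (c, d)"
  unfolding unit_coords_def
proof (rule the_equality)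
  fix p assume "case p of (c', d') \<Rightarrow> c' \<in> carrier K \<and> d' \<in> carrier K \<and> (purely_even A \<longrightarrow> d' = \<zero>\<^bsub>K\<^esub>) \<and>
    c \<odot> \<one> \<oplus> d \<odot> odd_unit A = c' \<odot> \<one> \<oplus> d' \<odot> odd_unit A"
  then obtain c' d' where p: "p = (c', d')" "c' \<in> carrier K" "d' \<in> carrier K" "purely_even A \<longrightarrow> d' = \<zero>\<^bsub>K\<^esub>"
    "c \<odot> \<one> \<oplus> d \<odot> odd_unit A = c' \<odot> \<one> \<oplus> d' \<odot> odd_unit A" by (cases p) auto
  show "p = (c, d)"
  proof (cases "purely_even A")
    case True
    then have "c \<odot> \<one> = c' \<odot> \<one>" "d = \<zero>\<^bsub>K\<^esub>" "d' = \<zero>\<^bsub>K\<^esub>"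
      using p d K by simp_all
    then show ?thesis using scalar_inj[of c c' "\<one>"] p K nontrivial by simp
  next
    case False
    then show ?thesis using one_odd_unit_independent[OF False K p(2,3) p(5)] p(1) by simp
  qed
qed (use assms in auto)

lemma unit_coords_cases:
  assumes "a \<in> carrier A"
  obtains c d where "c \<in> carrier K" "d \<in> carrier K" "purely_even A \<longrightarrow> d = \<zero>\<^bsub>K\<^esub>"
    "a = c \<odot> \<one> \<oplus> d \<odot> odd_unit A" "unit_coords a = (c, d)"
proof -
  obtain c d where cd: "c \<in> carrier K" "d \<in> carrier K" "a = c \<odot> \<one> \<oplus> d \<odot> odd_unit A"
    using carrier_A_cases assms by blast
  let ?d = "if purely_even A then \<zero>\<^bsub>K\<^esub> else d"
  have "a = c \<odot> \<one> \<oplus> ?d \<odot> odd_unit A" using cd by (simp add: odd_unit_def)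
  then show thesis using that[of c ?d] unit_coords_eq[of c ?d] cd(1,2) by simp
qed

lemma odd_unit_zero: "purely_even A \<Longrightarrow> odd_unit A = \<zero>"
  by (simp add: odd_unit_def)

lemma unit_coords_add:
  assumes "a \<in> carrier A" "b \<in> carrier A"
  shows "unit_coords (a \<oplus> b) = (fst (unit_coords a) \<oplus>\<^bsub>K\<^esub> fst (unit_coords b), snd (unit_coords a) \<oplus>\<^bsub>K\<^esub> snd (unit_coords b))"
proof -
  obtain c d where a: "c \<in> carrier K" "d \<in> carrier K" "purely_even A \<longrightarrow> d = \<zero>\<^bsub>K\<^esub>"
    "a = c \<odot> \<one> \<oplus> d \<odot> odd_unit A" "unit_coords a = (c, d)" using unit_coords_cases assms(1) .
  obtain c' d' where b: "c' \<in> carrier K" "d' \<in> carrier K" "purely_even A \<longrightarrow> d' = \<zero>\<^bsub>K\<^esub>"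
    "b = c' \<odot> \<one> \<oplus> d' \<odot> odd_unit A" "unit_coords b = (c', d')" using unit_coords_cases assms(2) .
  have "a \<oplus> b = (c \<oplus>\<^bsub>K\<^esub> c') \<odot> \<one> \<oplus> (d \<oplus>\<^bsub>K\<^esub> d') \<odot> odd_unit A"
    unfolding a(4) b(4) using a(1,2) b(1,2) by (simp add: smult_l_distr M.a_ac)
  then show ?thesis using a b unit_coords_eq[of "c \<oplus>\<^bsub>K\<^esub> c'" "d \<oplus>\<^bsub>K\<^esub> d'"] by simp
qed

lemma unit_coords_mult:
  assumes "a \<in> carrier A" "b \<in> carrier A"
  shows "unit_coords (a \<otimes> b) =
    (fst (unit_coords a) \<otimes>\<^bsub>K\<^esub> fst (unit_coords b) \<oplus>\<^bsub>K\<^esub> snd (unit_coords a) \<otimes>\<^bsub>K\<^esub> snd (unit_coords b),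
     fst (unit_coords a) \<otimes>\<^bsub>K\<^esub> snd (unit_coords b) \<oplus>\<^bsub>K\<^esub> snd (unit_coords a) \<otimes>\<^bsub>K\<^esub> fst (unit_coords b))"
proof -
  obtain c d where a: "c \<in> carrier K" "d \<in> carrier K" "purely_even A \<longrightarrow> d = \<zero>\<^bsub>K\<^esub>"
    "a = c \<odot> \<one> \<oplus> d \<odot> odd_unit A" "unit_coords a = (c, d)" using unit_coords_cases assms(1) .
  obtain c' d' where b: "c' \<in> carrier K" "d' \<in> carrier K" "purely_even A \<longrightarrow> d' = \<zero>\<^bsub>K\<^esub>"
    "b = c' \<odot> \<one> \<oplus> d' \<odot> odd_unit A" "unit_coords b = (c', d')" using unit_coords_cases assms(2) .
  let ?c = "c \<otimes>\<^bsub>K\<^esub> c' \<oplus>\<^bsub>K\<^esub> d \<otimes>\<^bsub>K\<^esub> d'" and ?d = "c \<otimes>\<^bsub>K\<^esub> d' \<oplus>\<^bsub>K\<^esub> d \<otimes>\<^bsub>K\<^esub> c'"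
  have "a \<otimes> b = ?c \<odot> \<one> \<oplus> ?d \<odot> odd_unit A"
  proof (cases "purely_even A")
    case True
    then show ?thesis unfolding a(4) b(4) using a(1-3) b(1-3)
      by (simp add: odd_unit_zero smult_mult_left smult_assoc1)
  next
    case False
    then show ?thesis unfolding a(4) b(4) using a(1,2) b(1,2)
      by (simp add: A.l_distr A.r_distr smult_mult_left smult_mult_right smult_l_distr smult_r_distr
          odd_unit_props R.m_comm M.a_ac flip: smult_assoc1)
  qed
  then show ?thesis using a b unit_coords_eq[of ?c ?d] by auto
qed

lemma unit_coords_one: "unit_coords \<one> = (\<one>\<^bsub>K\<^esub>, \<zero>\<^bsub>K\<^esub>)"
  using unit_coords_eq[of "\<one>\<^bsub>K\<^esub>" "\<zero>\<^bsub>K\<^esub>"] by simp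

lemma unit_coords_scalar: "c \<in> carrier K \<Longrightarrow> unit_coords (c \<odot> \<one>) = (c, \<zero>\<^bsub>K\<^esub>)"
  using unit_coords_eq[of c "\<zero>\<^bsub>K\<^esub>"] by simp

lemma unit_coords_closed:
  assumes "a \<in> carrier A"
  shows "fst (unit_coords a) \<in> carrier K" "snd (unit_coords a) \<in> carrier K"
    "purely_even A \<Longrightarrow> snd (unit_coords a) = \<zero>\<^bsub>K\<^esub>"
  using unit_coords_cases[OF assms] by (metis fst_conv snd_conv)+

lemma unit_coords_even: "a \<in> hcomp A 0 \<Longrightarrow> snd (unit_coords a) = \<zero>\<^bsub>K\<^esub>"
  using even_is_scalar unit_coords_scalar by force

lemma unit_coords_odd: "a \<in> hcomp A 1 \<Longrightarrow> fst (unit_coords a) = \<zero>\<^bsub>K\<^esub>"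
proof (cases "purely_even A")
  case True
  then show "a \<in> hcomp A 1 \<Longrightarrow> fst (unit_coords a) = \<zero>\<^bsub>K\<^esub>" using unit_coords_scalar[of "\<zero>\<^bsub>K\<^esub>"] by simp
next
  case False
  assume "a \<in> hcomp A 1"
  then obtain d where "d \<in> carrier K" "a = d \<odot> odd_unit A" using hcomp_A_1[OF False] by blast
  then show "fst (unit_coords a) = \<zero>\<^bsub>K\<^esub>" using unit_coords_eq[of "\<zero>\<^bsub>K\<^esub>" d] False by simp
qed

end

text \<open>The graded module with components \<open>U0\<close> and \<open>U1\<close>; the pair of an element of \<open>U0\<close> and one of
  \<open>U1\<close> is encoded as an element of \<open>'v\<close> by \<open>p\<close>.  If \<open>A\<close> has odd elements, the formula for the action
  presupposes \<open>U1 = U0\<close>, and \<open>\<epsilon>\<close> exchanges the two components.\<close>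

definition pair_module :: "('v \<times> 'v \<Rightarrow> 'v) \<Rightarrow> ('k, 'r) ring_scheme \<Rightarrow> ('k, 'a) graded \<Rightarrow>
    ('k, 'v) module \<Rightarrow> ('k, 'v) module \<Rightarrow> ('a, 'v) graded" where
  "pair_module p K A U0 U1 =
    \<lparr>carrier = p ` (carrier U0 \<times> carrier U1), monoid.mult = undefined, monoid.one = undefined,
     ring.zero = p (\<zero>\<^bsub>U0\<^esub>, \<zero>\<^bsub>U1\<^esub>),
     ring.add = (\<lambda>x y. p (fst (inv_into UNIV p x) \<oplus>\<^bsub>U0\<^esub> fst (inv_into UNIV p y), snd (inv_into UNIV p x) \<oplus>\<^bsub>U1\<^esub> snd (inv_into UNIV p y))),
     smult = (\<lambda>a x. case closed_superdivision.unit_coords K A a of (c, d) \<Rightarrow> case inv_into UNIV p x of (u, w) \<Rightarrow>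
       if purely_even A then p (c \<odot>\<^bsub>U0\<^esub> u, c \<odot>\<^bsub>U1\<^esub> w)
       else p (c \<odot>\<^bsub>U0\<^esub> u \<oplus>\<^bsub>U0\<^esub> d \<odot>\<^bsub>U0\<^esub> w, d \<odot>\<^bsub>U0\<^esub> u \<oplus>\<^bsub>U0\<^esub> c \<odot>\<^bsub>U0\<^esub> w)),
     hcomp = (\<lambda>z. if z = 0 then p ` (carrier U0 \<times> {\<zero>\<^bsub>U1\<^esub>}) else p ` ({\<zero>\<^bsub>U0\<^esub>} \<times> carrier U1))\<rparr>"

locale pair_module_data = closed_superdivision K A + U0: vectorspace K U0 + U1: vectorspace K U1
  for K :: "('k, 'r) ring_scheme" and A :: "('k, 'a) graded"
    and U0 :: "('k, 'v) module" and U1 :: "('k, 'v) module" +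
  fixes p :: "'v \<times> 'v \<Rightarrow> 'v"
  assumes inj_p: "inj p" and odd_eq: "\<not> purely_even A \<Longrightarrow> U1 = U0"
begin

abbreviation "P \<equiv> pair_module p K A U0 U1"

lemma inv_p [simp]: "inv_into UNIV p (p q) = q" using inj_p by simp

lemma p_eq [simp]: "p q = p q' \<longleftrightarrow> q = q'" using inj_p by (simp add: inj_eq)

lemma carrier_P: "carrier P = p ` (carrier U0 \<times> carrier U1)"
  and zero_P: "\<zero>\<^bsub>P\<^esub> = p (\<zero>\<^bsub>U0\<^esub>, \<zero>\<^bsub>U1\<^esub>)"
  and add_P [simp]: "p (u, w) \<oplus>\<^bsub>P\<^esub> p (u', w') = p (u \<oplus>\<^bsub>U0\<^esub> u', w \<oplus>\<^bsub>U1\<^esub> w')"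
  and hcomp_P_0: "hcomp P 0 = p ` (carrier U0 \<times> {\<zero>\<^bsub>U1\<^esub>})"
  and hcomp_P_1: "hcomp P 1 = p ` ({\<zero>\<^bsub>U0\<^esub>} \<times> carrier U1)"
  by (simp_all add: pair_module_def)

lemma smult_P_ground: "purely_even A \<Longrightarrow>
    a \<odot>\<^bsub>P\<^esub> p (u, w) = p (fst (unit_coords a) \<odot>\<^bsub>U0\<^esub> u, fst (unit_coords a) \<odot>\<^bsub>U1\<^esub> w)"
  and smult_P_odd: "\<not> purely_even A \<Longrightarrow>
    a \<odot>\<^bsub>P\<^esub> p (u, w) = p (fst (unit_coords a) \<odot>\<^bsub>U0\<^esub> u \<oplus>\<^bsub>U0\<^esub> snd (unit_coords a) \<odot>\<^bsub>U0\<^esub> w,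
      snd (unit_coords a) \<odot>\<^bsub>U0\<^esub> u \<oplus>\<^bsub>U0\<^esub> fst (unit_coords a) \<odot>\<^bsub>U0\<^esub> w)"
  by (simp_all add: pair_module_def split: prod.split)

lemma odd_eqs:
  assumes "\<not> purely_even A"
  shows "carrier U1 = carrier U0" "ring.zero U1 = ring.zero U0" "ring.add U1 = ring.add U0" "smult U1 = smult U0"
  using odd_eq[OF assms] by simp_all

lemma P_cases:
  assumes "x \<in> carrier P"
  obtains u w where "u \<in> carrier U0" "w \<in> carrier U1" "x = p (u, w)"
  using assms by (auto simp: carrier_P)

lemma p_mem [simp]: "p (u, w) \<in> carrier P \<longleftrightarrow> u \<in> carrier U0 \<and> w \<in> carrier U1"
  by (auto simp: carrier_P)

lemma abelian_group_P: "abelian_group P"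
proof (rule abelian_groupI)
  show "\<exists>y\<in>carrier P. y \<oplus>\<^bsub>P\<^esub> x = \<zero>\<^bsub>P\<^esub>" if "x \<in> carrier P" for x
    using that
  proof (rule P_cases)
    fix u w assume "u \<in> carrier U0" "w \<in> carrier U1" "x = p (u, w)"
    then show ?thesis by (intro bexI[of _ "p (\<ominus>\<^bsub>U0\<^esub> u, \<ominus>\<^bsub>U1\<^esub> w)"]) (simp_all add: zero_P U0.M.l_neg U1.M.l_neg)
  qed
qed (auto elim!: P_cases simp: zero_P U0.M.a_ac U1.M.a_ac)

lemma hcomp_P_subgroup: "additive_subgroup (hcomp P z) P"
proof -
  interpret PG: abelian_group P by (rule abelian_group_P)
  have neg: "\<ominus>\<^bsub>P\<^esub> p (u, w) = p (\<ominus>\<^bsub>U0\<^esub> u, \<ominus>\<^bsub>U1\<^esub> w)" if "u \<in> carrier U0" "w \<in> carrier U1" for u w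
    using that by (intro PG.minus_equality) (simp_all add: zero_P U0.M.l_neg U1.M.l_neg)
  have 0: "additive_subgroup (hcomp P 0) P" and 1: "additive_subgroup (hcomp P 1) P"
    by (intro additive_subgroup.intro PG.add.subgroupI;
        auto simp: hcomp_P_0 hcomp_P_1 neg simp flip: a_inv_def)+
  show ?thesis using 0 1 by (cases z) simp_all
qed

lemma graded_left_module_P: "graded_left_module A P"
proof (rule graded_left_module.intro)
  interpret PG: abelian_group P by (rule abelian_group_P)
  show "abelian_group P" by (rule abelian_group_P)
  define G where "G \<longleftrightarrow> purely_even A"
  note s = unit_coords_closed[folded G_def]
  note g = smult_P_ground[folded G_def] and o = smult_P_odd[folded G_def] and eqs = odd_eqs[folded G_def]
  show "a \<odot>\<^bsub>P\<^esub> x \<in> carrier P" if "a \<in> carrier A" "x \<in> carrier P" for a x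
    using that s[OF that(1)]
    by (cases G) (auto elim!: P_cases simp: g o eqs)
  show "(a \<oplus>\<^bsub>A\<^esub> b) \<odot>\<^bsub>P\<^esub> x = a \<odot>\<^bsub>P\<^esub> x \<oplus>\<^bsub>P\<^esub> b \<odot>\<^bsub>P\<^esub> x"
    if "a \<in> carrier A" "b \<in> carrier A" "x \<in> carrier P" for a b x
    using that s[OF that(1)] s[OF that(2)]
    by (cases G)
      (auto elim!: P_cases simp: g o eqs unit_coords_add U0.smult_l_distr U1.smult_l_distr U0.M.a_ac)
  show "a \<odot>\<^bsub>P\<^esub> (x \<oplus>\<^bsub>P\<^esub> y) = a \<odot>\<^bsub>P\<^esub> x \<oplus>\<^bsub>P\<^esub> a \<odot>\<^bsub>P\<^esub> y"
    if "a \<in> carrier A" "x \<in> carrier P" "y \<in> carrier P" for a x y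
    using that s[OF that(1)]
    by (cases G)
      (auto elim!: P_cases simp: g o eqs U0.smult_r_distr U1.smult_r_distr U0.M.a_ac)
  show "(a \<otimes>\<^bsub>A\<^esub> b) \<odot>\<^bsub>P\<^esub> x = a \<odot>\<^bsub>P\<^esub> (b \<odot>\<^bsub>P\<^esub> x)"
    if "a \<in> carrier A" "b \<in> carrier A" "x \<in> carrier P" for a b x
    using that s[OF that(1)] s[OF that(2)]
    by (cases G)
      (auto elim!: P_cases simp: g o eqs unit_coords_mult U0.smult_r_distr U0.smult_l_distr U0.M.a_ac
        U0.smult_assoc1 U1.smult_assoc1)
  show "\<one>\<^bsub>A\<^esub> \<odot>\<^bsub>P\<^esub> x = x" if "x \<in> carrier P" for x
    using that by (cases G) (auto elim!: P_cases simp: g o eqs unit_coords_one)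
  show "z2_grading P"
    unfolding z2_grading_def
  proof (intro conjI allI)
    show "hcomp P 0 <+>\<^bsub>P\<^esub> hcomp P 1 = carrier P"
    proof
      show "hcomp P 0 <+>\<^bsub>P\<^esub> hcomp P 1 \<subseteq> carrier P"
        by (auto simp: set_add_def set_mult_def hcomp_P_0 hcomp_P_1)
      show "carrier P \<subseteq> hcomp P 0 <+>\<^bsub>P\<^esub> hcomp P 1"
      proof
        fix x assume "x \<in> carrier P"
        then obtain u w where *: "u \<in> carrier U0" "w \<in> carrier U1" "x = p (u, w)" by (rule P_cases)
        then have "x = p (u, \<zero>\<^bsub>U1\<^esub>) \<oplus>\<^bsub>P\<^esub> p (\<zero>\<^bsub>U0\<^esub>, w)" by simp
        then show "x \<in> hcomp P 0 <+>\<^bsub>P\<^esub> hcomp P 1"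
          using * unfolding set_add_def set_mult_def hcomp_P_0 hcomp_P_1 by force
      qed
    qed
    show "hcomp P 0 \<inter> hcomp P 1 = {\<zero>\<^bsub>P\<^esub>}" by (auto simp: hcomp_P_0 hcomp_P_1 zero_P)
  qed (rule hcomp_P_subgroup)
  show "a \<odot>\<^bsub>P\<^esub> x \<in> hcomp P (s + t)" if a: "a \<in> hcomp A s" and x: "x \<in> hcomp P t" for a x s t
  proof -
    have aA: "a \<in> carrier A" using a hcomp_A_subset by blast
    show ?thesis using a x s[OF aA] unit_coords_even[of a] unit_coords_odd[of a]
      by (cases G; cases s; cases t) (auto simp: hcomp_P_0 hcomp_P_1 g o eqs)
  qed
qed

lemma scalar_P: "c \<in> carrier K \<Longrightarrow> u \<in> carrier U0 \<Longrightarrow> w \<in> carrier U1 \<Longrightarrow>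
    (c \<odot>\<^bsub>A\<^esub> \<one>\<^bsub>A\<^esub>) \<odot>\<^bsub>P\<^esub> p (u, w) = p (c \<odot>\<^bsub>U0\<^esub> u, c \<odot>\<^bsub>U1\<^esub> w)"
  using odd_eqs by (cases "purely_even A") (simp_all add: smult_P_ground smult_P_odd unit_coords_scalar)

definition U :: "bit \<Rightarrow> ('k, 'v) module" where "U z = (if z = 0 then U0 else U1)"

definition inc :: "bit \<Rightarrow> 'v \<Rightarrow> 'v" where "inc z u = (if z = 0 then p (u, \<zero>\<^bsub>U1\<^esub>) else p (\<zero>\<^bsub>U0\<^esub>, u))"

lemma inc_hom: "inc z \<in> module_hom K (U z) (piece A P z)"
  unfolding module_hom_def by (cases z) (auto simp: U_def inc_def hcomp_P_0 hcomp_P_1 scalar_P)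

lemma inc_bij: "bij_betw (inc z) (carrier (U z)) (hcomp P z)"
  by (cases z) (auto simp: bij_betw_def inj_on_def U_def inc_def hcomp_P_0 hcomp_P_1 image_iff)

lemma vectorspace_U: "vectorspace K (U z)"
  by (simp add: U_def U0.vectorspace_axioms U1.vectorspace_axioms)

lemma fin_dim_P:
  assumes "U0.fin_dim" "U1.fin_dim"
  shows "fin_dim_module K A P"
proof -
  interpret superdivision_module K A P
    using closed_superdivision_axioms graded_left_module_P by (simp add: superdivision_module_def)
  have "vectorspace.fin_dim K (piece A P z)" for z
  proof -
    interpret linear_map K "U z" "piece A P z" "inc z"
      using inc_hom[of z] vectorspace_U[of z] vectorspace_piece[of z]
      by (simp add: linear_map_def mod_hom_def mod_hom_axioms_def vectorspace_def)
    have "vectorspace.fin_dim K (U z)" using assms by (simp add: U_def)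
    then show ?thesis using fin_dim_surj inc_bij[of z] by (simp add: bij_betw_def)
  qed
  then show ?thesis by (rule fin_dim_from_pieces)
qed

end

text \<open>Prescribed values \<open>f z l u\<close> of a balanced map at the basis element \<open>m l\<close> and the element \<open>u\<close> of the
  component of degree \<open>z\<close>, for those \<open>z\<close> that belong to a vertex.\<close>

locale pair_arrow = PA: pair_module_data K A U0 U1 p + arrow_data K B A M "pair_module p K A U0 U1" L m W
  for K :: "('k, 'r) ring_scheme" and B :: "('k, 'a) graded" and A :: "('k, 'a) graded"
    and M :: "('a, 'm) graded_bimod" and U0 :: "('k, 'v) module" and U1 :: "('k, 'v) module"
    and p :: "'v \<times> 'v \<Rightarrow> 'v" and L :: "'l set" and m :: "'l \<Rightarrow> 'm" and W :: "('a, 'w) graded" +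
  fixes f :: "bit \<Rightarrow> 'l \<Rightarrow> 'v \<Rightarrow> 'w"
  assumes f_graded: "\<And>z l u. \<lbrakk>z = 0 \<or> purely_even A; l \<in> L; u \<in> carrier (PA.U z)\<rbrakk> \<Longrightarrow>
      f z l u \<in> hcomp W (z + deg M (m l))"
    and f_add: "\<And>z l u u'. \<lbrakk>z = 0 \<or> purely_even A; l \<in> L; u \<in> carrier (PA.U z); u' \<in> carrier (PA.U z)\<rbrakk> \<Longrightarrow>
      f z l (u \<oplus>\<^bsub>PA.U z\<^esub> u') = f z l u \<oplus>\<^bsub>W\<^esub> f z l u'"
    and f_smult: "\<And>z l c u. \<lbrakk>z = 0 \<or> purely_even A; l \<in> L; c \<in> carrier K; u \<in> carrier (PA.U z)\<rbrakk> \<Longrightarrow>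
      f z l (c \<odot>\<^bsub>PA.U z\<^esub> u) = (c \<odot>\<^bsub>B\<^esub> \<one>\<^bsub>B\<^esub>) \<odot>\<^bsub>W\<^esub> f z l u"
begin

text \<open>The map that the prescribed values define on one component.\<close>

definition glue_piece :: "bit \<Rightarrow> 'm \<Rightarrow> 'v \<Rightarrow> 'w" where
  "glue_piece z x u = expand W (\<lambda>l. f z l u) x"

text \<open>In the presence of \<open>\<epsilon>\<close> the second component consists of the elements \<open>\<epsilon> w\<close> with \<open>w\<close> in the
  first one, and balancedness forces the value at \<open>(x, \<epsilon> w)\<close> to be the value at \<open>(x \<epsilon>, w)\<close>.\<close>

definition glue :: "'m \<Rightarrow> 'v \<Rightarrow> 'w" where
  "glue x v = (case inv_into UNIV p v of (u, w) \<Rightarrow> glue_piece 0 x u \<oplus>\<^bsub>W\<^esub>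
    (if purely_even A then glue_piece 1 x w else glue_piece 0 (rsmult M x (odd_unit A)) w))"

context
  fixes z :: bit
  assumes z: "z = 0 \<or> purely_even A"
begin

lemma f_closed: "l \<in> L \<Longrightarrow> u \<in> carrier (PA.U z) \<Longrightarrow> f z l u \<in> carrier W"
  using BW.VG.hcompD[OF f_graded[OF z]] .

lemma glue_piece_closed: "x \<in> carrier M \<Longrightarrow> u \<in> carrier (PA.U z) \<Longrightarrow> glue_piece z x u \<in> carrier W"
  unfolding glue_piece_def by (intro expand_closed[OF W_mod] f_closed)

lemma glue_piece_add_left: "x \<in> carrier M \<Longrightarrow> y \<in> carrier M \<Longrightarrow> u \<in> carrier (PA.U z) \<Longrightarrow>
    glue_piece z (x \<oplus>\<^bsub>M\<^esub> y) u = glue_piece z x u \<oplus>\<^bsub>W\<^esub> glue_piece z y u"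
  unfolding glue_piece_def by (intro expand_add_left[OF W_mod] f_closed)

lemma glue_piece_add_right:
  assumes "x \<in> carrier M" "u \<in> carrier (PA.U z)" "u' \<in> carrier (PA.U z)"
  shows "glue_piece z x (u \<oplus>\<^bsub>PA.U z\<^esub> u') = glue_piece z x u \<oplus>\<^bsub>W\<^esub> glue_piece z x u'"
proof -
  have "glue_piece z x (u \<oplus>\<^bsub>PA.U z\<^esub> u') = expand W (\<lambda>l. f z l u \<oplus>\<^bsub>W\<^esub> f z l u') x"
    unfolding glue_piece_def
    by (rule expand_cong[OF W_mod]) (use assms z in \<open>auto simp: f_add f_closed\<close>)
  also have "\<dots> = glue_piece z x u \<oplus>\<^bsub>W\<^esub> glue_piece z x u'"
    unfolding glue_piece_def using assms by (intro expand_add_right[OF W_mod] f_closed)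
  finally show ?thesis .
qed

lemma glue_piece_smult: "b \<in> carrier B \<Longrightarrow> x \<in> carrier M \<Longrightarrow> u \<in> carrier (PA.U z) \<Longrightarrow>
    glue_piece z (b \<odot>\<^bsub>M\<^esub> x) u = b \<odot>\<^bsub>W\<^esub> glue_piece z x u"
  unfolding glue_piece_def by (intro expand_smult[OF W_mod] f_closed)

lemma glue_piece_kmult:
  assumes "c \<in> carrier K" "x \<in> carrier M" "u \<in> carrier (PA.U z)"
  shows "glue_piece z x (c \<odot>\<^bsub>PA.U z\<^esub> u) = (c \<odot>\<^bsub>B\<^esub> \<one>\<^bsub>B\<^esub>) \<odot>\<^bsub>W\<^esub> glue_piece z x u"
proof -
  have "glue_piece z x (c \<odot>\<^bsub>PA.U z\<^esub> u) = expand W (\<lambda>l. (c \<odot>\<^bsub>B\<^esub> \<one>\<^bsub>B\<^esub>) \<odot>\<^bsub>W\<^esub> f z l u) x"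
    unfolding glue_piece_def
    by (rule expand_cong[OF W_mod]) (use assms z in \<open>auto simp: f_smult f_closed\<close>)
  also have "\<dots> = (c \<odot>\<^bsub>B\<^esub> \<one>\<^bsub>B\<^esub>) \<odot>\<^bsub>W\<^esub> glue_piece z x u"
    unfolding glue_piece_def using assms by (intro expand_kmult[OF W_mod] f_closed)
  finally show ?thesis .
qed

lemma glue_piece_graded: "x \<in> hcomp M s \<Longrightarrow> u \<in> carrier (PA.U z) \<Longrightarrow> glue_piece z x u \<in> hcomp W (s + z)"
  unfolding glue_piece_def by (intro expand_graded[OF W_mod] f_graded[OF z])

lemma glue_piece_basis: "l \<in> L \<Longrightarrow> u \<in> carrier (PA.U z) \<Longrightarrow> glue_piece z (m l) u = f z l u"
  unfolding glue_piece_def by (rule expand_basis[OF W_mod]) (simp_all add: f_closed)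

lemma glue_piece_zero: "x \<in> carrier M \<Longrightarrow> glue_piece z x \<zero>\<^bsub>PA.U z\<^esub> = \<zero>\<^bsub>W\<^esub>"
proof -
  interpret Uz: vectorspace K "PA.U z" by (rule PA.vectorspace_U)
  assume x: "x \<in> carrier M"
  then show ?thesis using glue_piece_add_right[of x "\<zero>\<^bsub>PA.U z\<^esub>" "\<zero>\<^bsub>PA.U z\<^esub>"] glue_piece_closed[of x "\<zero>\<^bsub>PA.U z\<^esub>"]
    BW.VG.add.l_cancel_one'[of "glue_piece z x \<zero>\<^bsub>PA.U z\<^esub>" "glue_piece z x \<zero>\<^bsub>PA.U z\<^esub>"] by simp
qed

end

lemma U_simps [simp]: "PA.U 0 = U0" "PA.U 1 = U1" by (simp_all add: PA.U_def)

lemma glue_ground: "purely_even A \<Longrightarrow> glue x (p (u, w)) = glue_piece 0 x u \<oplus>\<^bsub>W\<^esub> glue_piece 1 x w"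
  and glue_odd: "\<not> purely_even A \<Longrightarrow>
    glue x (p (u, w)) = glue_piece 0 x u \<oplus>\<^bsub>W\<^esub> glue_piece 0 (rsmult M x (odd_unit A)) w"
  by (simp_all add: glue_def)

lemma rsmult_scalar: "c \<in> carrier K \<Longrightarrow> x \<in> carrier M \<Longrightarrow>
    rsmult M x (c \<odot>\<^bsub>A\<^esub> \<one>\<^bsub>A\<^esub>) = (c \<odot>\<^bsub>B\<^esub> \<one>\<^bsub>B\<^esub>) \<odot>\<^bsub>M\<^esub> x"
  using central by simp

lemma glue_bihom_ground:
  assumes G: "purely_even A"
  shows "tensor_bihom B A M (pair_module p K A U0 U1) W glue"
proof -
  note g = glue_ground[OF G]
  have z: "0 = (0::bit) \<or> purely_even A" "1 = (0::bit) \<or> purely_even A" using G by auto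
  note c = glue_piece_closed[OF z(1), simplified] glue_piece_closed[OF z(2), simplified]
  note al = glue_piece_add_left[OF z(1), simplified] glue_piece_add_left[OF z(2), simplified]
  note ar = glue_piece_add_right[OF z(1), simplified] glue_piece_add_right[OF z(2), simplified]
  note sm = glue_piece_smult[OF z(1), simplified] glue_piece_smult[OF z(2), simplified]
  note km = glue_piece_kmult[OF z(1), simplified] glue_piece_kmult[OF z(2), simplified]
  note zr = glue_piece_zero[OF z(1), simplified] glue_piece_zero[OF z(2), simplified]
  have bal: "glue (rsmult M x a) v = glue x (a \<odot>\<^bsub>PA.P\<^esub> v)"
    if x: "x \<in> carrier M" and a: "a \<in> carrier A" and v: "v \<in> carrier PA.P" for x a v
  proof -
    obtain b d where b: "b \<in> carrier K" "a = b \<odot>\<^bsub>A\<^esub> \<one>\<^bsub>A\<^esub>"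
      using PA.unit_coords_cases[OF a] G by (metis PA.M.r_zero PA.lmult_0 PA.odd_unit_in_carrier PA.smult_closed PA.A.one_closed)
    obtain u w where v: "u \<in> carrier U0" "w \<in> carrier U1" "v = p (u, w)" using PA.P_cases v .
    show ?thesis unfolding b(2) v(3) rsmult_scalar[OF b(1) x] PA.scalar_P[OF b(1) v(1,2)] g
      using x b(1) v(1,2) by (simp add: sm km c W.smult_r_distr)
  qed
  have gr: "glue x v \<in> hcomp W (s + t)" if x: "x \<in> hcomp M s" and v: "v \<in> hcomp PA.P t" for x v s t
  proof -
    have "x \<in> carrier M" using x by simp
    then show ?thesis using v x glue_piece_graded[OF z(1) x] glue_piece_graded[OF z(2) x]
      by (cases t) (auto simp: PA.hcomp_P_0 PA.hcomp_P_1 g zr)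
  qed
  show ?thesis unfolding tensor_bihom_def
    using bal gr by (auto elim!: PA.P_cases simp: g c al ar sm BW.VG.a_ac W.smult_closed W.smult_r_distr left.smult_closed)
qed

text \<open>Balancedness over \<open>a = b 1 + d \<epsilon>\<close>: multiplying \<open>x\<close> by \<open>a\<close> and then by \<open>\<epsilon>\<close> exchanges the roles of
  \<open>b\<close> and \<open>d\<close>, as does the action of \<open>a\<close> on the two components of \<open>v\<close>.\<close>

lemma glue_bihom_odd:
  assumes G: "\<not> purely_even A"
  shows "tensor_bihom B A M (pair_module p K A U0 U1) W glue"
proof -
  let ?e = "odd_unit A"
  note g = glue_odd[OF G]
  note eqs = PA.odd_eqs[OF G]
  have z: "0 = (0::bit) \<or> purely_even A" by auto
  note c = glue_piece_closed[OF z, simplified]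
  note al = glue_piece_add_left[OF z, simplified]
  note ar = glue_piece_add_right[OF z, simplified]
  note sm = glue_piece_smult[OF z, simplified]
  note km = glue_piece_kmult[OF z, simplified]
  note zr = glue_piece_zero[OF z, simplified]
  have e: "?e \<in> carrier A" by simp
  have ec: "rsmult M x ?e \<in> carrier M" if "x \<in> carrier M" for x using that e by (simp add: rsmult_closed)
  have ee: "rsmult M (rsmult M x ?e) ?e = x" if "x \<in> carrier M" for x
    using that PA.odd_unit_props(2)[OF G] rsmult_one by (simp flip: rsmult_assoc)
  have be: "rsmult M (b \<odot>\<^bsub>M\<^esub> x) ?e = b \<odot>\<^bsub>M\<^esub> rsmult M x ?e" if "b \<in> carrier B" "x \<in> carrier M" for b x
    using that bimodule_assoc e by blast
  have ae: "rsmult M (x \<oplus>\<^bsub>M\<^esub> y) ?e = rsmult M x ?e \<oplus>\<^bsub>M\<^esub> rsmult M y ?e" if "x \<in> carrier M" "y \<in> carrier M" for x y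
    using that rsmult_l_distr e by blast
  have bal: "glue (rsmult M x a) v = glue x (a \<odot>\<^bsub>PA.P\<^esub> v)"
    if x: "x \<in> carrier M" and a: "a \<in> carrier A" and v: "v \<in> carrier PA.P" for x a v
  proof -
    obtain b d where b: "b \<in> carrier K" "d \<in> carrier K" "a = b \<odot>\<^bsub>A\<^esub> \<one>\<^bsub>A\<^esub> \<oplus>\<^bsub>A\<^esub> d \<odot>\<^bsub>A\<^esub> ?e" "PA.unit_coords a = (b, d)"
      using PA.unit_coords_cases[OF a] by metis
    obtain u w where v: "u \<in> carrier U0" "w \<in> carrier U0" "v = p (u, w)" using PA.P_cases[OF v] eqs by metis
    let ?b = "b \<odot>\<^bsub>B\<^esub> \<one>\<^bsub>B\<^esub>" and ?d = "d \<odot>\<^bsub>B\<^esub> \<one>\<^bsub>B\<^esub>"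
    have de: "d \<odot>\<^bsub>A\<^esub> ?e = (d \<odot>\<^bsub>A\<^esub> \<one>\<^bsub>A\<^esub>) \<otimes>\<^bsub>A\<^esub> ?e" using b by (simp add: PA.smult_mult_left)
    have xa: "rsmult M x a = ?b \<odot>\<^bsub>M\<^esub> x \<oplus>\<^bsub>M\<^esub> ?d \<odot>\<^bsub>M\<^esub> rsmult M x ?e"
      unfolding b(3) de using b(1,2) x by (simp add: rsmult_r_distr rsmult_assoc rsmult_scalar be)
    have xae: "rsmult M (rsmult M x a) ?e = ?b \<odot>\<^bsub>M\<^esub> rsmult M x ?e \<oplus>\<^bsub>M\<^esub> ?d \<odot>\<^bsub>M\<^esub> x"
      unfolding xa using b(1,2) x by (simp add: ae be ee ec left.smult_closed)
    show ?thesis unfolding v(3) g xae PA.smult_P_odd[OF G] b(4)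
      unfolding xa
      using x b(1,2) v(1,2) ec[OF x] by (simp add: al ar sm km c left.smult_closed BW.VG.a_ac)
  qed
  have gr: "glue x v \<in> hcomp W (s + t)" if x: "x \<in> hcomp M s" and v: "v \<in> hcomp PA.P t" for x v s t
  proof -
    have "x \<in> carrier M" using x by simp
    moreover have "rsmult M x ?e \<in> hcomp M (s + 1)" using rsmult_graded[OF x PA.odd_unit_in_hcomp] .
    ultimately show ?thesis using v glue_piece_graded[OF z x] glue_piece_graded[OF z, of "rsmult M x ?e" "s + 1"]
      by (cases t) (auto simp: PA.hcomp_P_0 PA.hcomp_P_1 g zr eqs ec)
  qed
  show ?thesis unfolding tensor_bihom_def
    using bal gr
    by (auto elim!: PA.P_cases simp: g c al ar sm ae be ec eqs BW.VG.a_ac W.smult_closed W.smult_r_distr left.smult_closed)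
qed

lemma glue_bihom: "tensor_bihom B A M (pair_module p K A U0 U1) W glue"
  using glue_bihom_ground glue_bihom_odd by blast

lemma glue_basis:
  assumes "z = 0 \<or> purely_even A" "l \<in> L" "u \<in> carrier (PA.U z)"
  shows "glue (m l) (PA.inc z u) = f z l u"
proof (cases "purely_even A")
  case True
  then show ?thesis using assms f_closed[OF assms(1)] glue_piece_zero[of 0 "m l"] glue_piece_zero[of 1 "m l"]
    by (cases z) (auto simp: PA.inc_def glue_ground glue_piece_basis)
next
  case False
  then have "z = 0" using assms(1) by simp
  then show ?thesis using assms f_closed[OF assms(1)] glue_piece_zero[of 0 "rsmult M (m l) (odd_unit A)"] PA.odd_eqs[OF False] False
    by (auto simp: PA.inc_def glue_odd glue_piece_basis rsmult_closed)
qed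

end

section \<open>Representations of a superspecies and of its quiver\<close>

lemma category_rep_quiver:
  assumes "wf_digraph Q"
  shows "category (rep_quiver K Q)"
proof -
  interpret wf_digraph Q by (rule assms)
  show ?thesis
  proof (unfold_locales, goal_cases)
    case (1 V)
    then have "\<And>a v. a \<in> arcs Q \<Longrightarrow> v \<in> carrier (qspace V (tail Q a)) \<Longrightarrow> qmap V a v \<in> carrier (qspace V (head Q a))"
      by (auto simp: rep_quiver_def is_quiver_rep_def dest!: module_hom_closed)
    moreover have "(\<lambda>v\<in>carrier (qspace V x). v) \<in> module_hom K (qspace V x) (qspace V x)" if "x \<in> verts Q" for x
    proof -
      interpret vectorspace K "qspace V x" using 1 that by (simp add: rep_quiver_def is_quiver_rep_def)
      show ?thesis by (auto simp: module_hom_def)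
    qed
    ultimately show ?case by (auto simp: rep_quiver_def quiver_rep_hom_def)
  next
    case (2 V Y Z f g)
    have "compose (carrier (qspace V x)) (g x) (f x) \<in> module_hom K (qspace V x) (qspace Z x)" if x: "x \<in> verts Q" for x
    proof -
      interpret vectorspace K "qspace V x" using 2 x by (simp add: rep_quiver_def is_quiver_rep_def)
      have f: "f x \<in> module_hom K (qspace V x) (qspace Y x)" and g: "g x \<in> module_hom K (qspace Y x) (qspace Z x)"
        using 2 x by (auto simp: rep_quiver_def quiver_rep_hom_def PiE_iff)
      note f' = module_hom_closed[OF f, THEN funcset_mem] module_hom_add[OF f] module_hom_smult[OF f]
      note g' = module_hom_closed[OF g, THEN funcset_mem] module_hom_add[OF g] module_hom_smult[OF g]
      show ?thesis using f' g' by (auto simp: module_hom_def compose_def)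
    qed
    moreover have "qmap Z a (g (tail Q a) (f (tail Q a) v)) = compose (carrier (qspace V (head Q a))) (g (head Q a)) (f (head Q a)) (qmap V a v)"
      if a: "a \<in> arcs Q" and v: "v \<in> carrier (qspace V (tail Q a))" for a v
    proof -
      have "f (tail Q a) v \<in> carrier (qspace Y (tail Q a))"
        using 2 a v by (auto simp: rep_quiver_def quiver_rep_hom_def PiE_iff dest!: bspec module_hom_closed)
      moreover have "qmap V a v \<in> carrier (qspace V (head Q a))"
        using 2 a v by (auto simp: rep_quiver_def is_quiver_rep_def dest!: module_hom_closed)
      ultimately show ?thesis using 2 a v by (auto simp: rep_quiver_def quiver_rep_hom_def compose_def)
    qed
    ultimately show ?case by (auto simp: rep_quiver_def quiver_rep_hom_def compose_eq)
  next
    case (3 V Y f)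
    show ?case
    proof
      fix x
      show "Comp (rep_quiver K Q) V V Y f (Ident (rep_quiver K Q) V) x = f x"
        using 3 by (cases "x \<in> verts Q")
          (auto simp: rep_quiver_def quiver_rep_hom_def compose_def fun_eq_iff PiE_iff extensional_def)
    qed
  next
    case (4 V Y f)
    show ?case
    proof
      fix x
      show "Comp (rep_quiver K Q) V Y Y (Ident (rep_quiver K Q) Y) f x = f x"
        using 4 by (cases "x \<in> verts Q")
          (auto simp: rep_quiver_def quiver_rep_hom_def compose_def fun_eq_iff PiE_iff extensional_def module_hom_def)
    qed
  next
    case (5 W V Y Z f g h)
    have "f x \<in> carrier (qspace W x) \<rightarrow> carrier (qspace V x)" if "x \<in> verts Q" for x
      using 5 that by (auto simp: rep_quiver_def quiver_rep_hom_def PiE_iff module_hom_def)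
    then show ?case by (auto simp: rep_quiver_def fun_eq_iff compose_def Pi_iff)
  qed
qed

locale superspecies_setup =
  fixes K :: "('k, 'r) ring_scheme" and S :: "('k, 'a, 'm) superspecies"
    and L :: "nat \<Rightarrow> nat \<Rightarrow> 'l set" and m :: "nat \<Rightarrow> nat \<Rightarrow> 'l \<Rightarrow> 'm"
  assumes closed: "algebraically_closed K"
    and species: "is_superspecies K S"
    and bases: "admissible_bases K S L m"
begin

declare atLeastAtMost_iff [simp del]

abbreviation "I \<equiv> index_set S"

abbreviation "D \<equiv> dalg S"

abbreviation "Q \<equiv> superspecies_quiver K S L m"

definition ground :: "nat \<Rightarrow> bool" where
  "ground i \<longleftrightarrow> purely_even (D i)"

lemma dalg_closed: "i \<in> I \<Longrightarrow> closed_superdivision K (D i)"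
  using species closed
  by (simp add: is_superspecies_def closed_superdivision_def closed_superdivision_axioms_def)

lemma ground_iff: "i \<in> I \<Longrightarrow> is_ground K (D i) \<longleftrightarrow> ground i"
  and odd_iff: "i \<in> I \<Longrightarrow> is_odd K (D i) \<longleftrightarrow> \<not> ground i"
  unfolding ground_def using closed_superdivision.is_ground_iff closed_superdivision.is_odd_iff dalg_closed by blast+

lemma verts_iff: "(i, z) \<in> verts Q \<longleftrightarrow> i \<in> I \<and> (z = 0 \<or> ground i)"
  by (cases z) (auto simp: superspecies_quiver_def quiver_verts_def ground_iff)

definition target :: "nat \<Rightarrow> nat \<Rightarrow> 'l \<Rightarrow> bit \<Rightarrow> bit" where
  "target j i l z = (if ground i \<and> \<not> ground j then 0 else z + deg (bimod S j i) (m j i l))"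

lemma arcs_iff: "(j, i, l, z) \<in> arcs Q \<longleftrightarrow>
    i \<in> I \<and> j \<in> I \<and> l \<in> L j i \<and> (z = 0 \<or> ground i)"
  using verts_iff[of i z] by (auto simp: superspecies_quiver_def)

lemma tail_eq: "tail Q (j, i, l, z) = (i, z)"
  by (simp add: superspecies_quiver_def)

lemma head_eq: "i \<in> I \<Longrightarrow> j \<in> I \<Longrightarrow> head Q (j, i, l, z) = (j, target j i l z)"
  by (simp add: superspecies_quiver_def target_def ground_iff odd_iff)

lemma basis_deg_zero: "i \<in> I \<Longrightarrow> j \<in> I \<Longrightarrow> l \<in> L j i \<Longrightarrow> \<not> ground j \<Longrightarrow>
    deg (bimod S j i) (m j i l) = 0"
  using bases odd_iff by (simp add: admissible_bases_def)

lemma head_vert: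
  "i \<in> I \<Longrightarrow> j \<in> I \<Longrightarrow> l \<in> L j i \<Longrightarrow> z = 0 \<or> ground i \<Longrightarrow>
    target j i l z = 0 \<or> ground j"
  using basis_deg_zero by (auto simp: target_def)

lemma wf_quiver: "wf_digraph Q"
proof
  fix a assume a: "a \<in> arcs Q"
  obtain j i l z where a': "a = (j, i, l, z)" by (cases a) auto
  show "tail Q a \<in> verts Q" using a by (simp add: a' tail_eq verts_iff arcs_iff)
  show "head Q a \<in> verts Q" using a head_vert by (simp add: a' head_eq verts_iff arcs_iff)
qed

text \<open>The element by which \<open>b(m\<^sub>l, v)\<close> is multiplied.  Only from a module over \<open>K\<close> to one
  over \<open>K + K\<epsilon>\<close> can the value have odd degree without a vertex for it; then \<open>\<epsilon>\<close> makes it even.\<close>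

definition shift :: "nat \<Rightarrow> nat \<Rightarrow> bit \<Rightarrow> 'a" where
  "shift j i z = (if ground i \<and> \<not> ground j \<and> z = 1 then odd_unit (D j) else \<one>\<^bsub>D j\<^esub>)"

text \<open>The second part says that the shift is its own inverse, so it loses no information.\<close>

lemma shift_props:
  assumes i: "i \<in> I" and j: "j \<in> I" and W: "graded_left_module (D j) W"
  shows "shift j i z \<in> carrier (D j)"
    and "y \<in> carrier W \<Longrightarrow> shift j i z \<odot>\<^bsub>W\<^esub> (shift j i z \<odot>\<^bsub>W\<^esub> y) = y"
    and "l \<in> L j i \<Longrightarrow> z = 0 \<or> ground i \<Longrightarrow> y \<in> hcomp W (deg (bimod S j i) (m j i l) + z) \<Longrightarrow>
      shift j i z \<odot>\<^bsub>W\<^esub> y \<in> hcomp W (target j i l z)"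
    and "l \<in> L j i \<Longrightarrow> z = 0 \<or> ground i \<Longrightarrow> y \<in> hcomp W (target j i l z) \<Longrightarrow>
      shift j i z \<odot>\<^bsub>W\<^esub> y \<in> hcomp W (deg (bimod S j i) (m j i l) + z)"
    and "c \<in> carrier K \<Longrightarrow> y \<in> carrier W \<Longrightarrow>
      shift j i z \<odot>\<^bsub>W\<^esub> ((c \<odot>\<^bsub>D j\<^esub> \<one>\<^bsub>D j\<^esub>) \<odot>\<^bsub>W\<^esub> y) = (c \<odot>\<^bsub>D j\<^esub> \<one>\<^bsub>D j\<^esub>) \<odot>\<^bsub>W\<^esub> (shift j i z \<odot>\<^bsub>W\<^esub> y)"
proof -
  interpret W: superdivision_module K "D j" W
    using dalg_closed[OF j] W by (simp add: superdivision_module_def)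
  show "shift j i z \<in> carrier (D j)" by (simp add: shift_def)
  show "y \<in> carrier W \<Longrightarrow> shift j i z \<odot>\<^bsub>W\<^esub> (shift j i z \<odot>\<^bsub>W\<^esub> y) = y"
    by (simp add: shift_def W.V.smult_one W.unit_unit ground_def[of j])
  show "l \<in> L j i \<Longrightarrow> z = 0 \<or> ground i \<Longrightarrow> y \<in> hcomp W (deg (bimod S j i) (m j i l) + z) \<Longrightarrow>
      shift j i z \<odot>\<^bsub>W\<^esub> y \<in> hcomp W (target j i l z)"
    using W.unit_graded[of y 1] basis_deg_zero[OF i j, of l]
    by (cases z) (auto simp: shift_def target_def W.V.smult_one add.commute)
  show "l \<in> L j i \<Longrightarrow> z = 0 \<or> ground i \<Longrightarrow> y \<in> hcomp W (target j i l z) \<Longrightarrow>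
      shift j i z \<odot>\<^bsub>W\<^esub> y \<in> hcomp W (deg (bimod S j i) (m j i l) + z)"
    using W.unit_graded[of y 0] basis_deg_zero[OF i j, of l]
    by (cases z) (auto simp: shift_def target_def W.V.smult_one add.commute split: if_splits)
  show "c \<in> carrier K \<Longrightarrow> y \<in> carrier W \<Longrightarrow>
      shift j i z \<odot>\<^bsub>W\<^esub> ((c \<odot>\<^bsub>D j\<^esub> \<one>\<^bsub>D j\<^esub>) \<odot>\<^bsub>W\<^esub> y) = (c \<odot>\<^bsub>D j\<^esub> \<one>\<^bsub>D j\<^esub>) \<odot>\<^bsub>W\<^esub> (shift j i z \<odot>\<^bsub>W\<^esub> y)"
    by (simp add: shift_def W.V.smult_one W.kmult_unit)
qed

lemma arrow_data:
  assumes i: "i \<in> I" and j: "j \<in> I"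
    and V: "graded_left_module (D i) V" and W: "graded_left_module (D j) W"
  shows "arrow_data K (D j) (D i) (bimod S j i) V (L j i) (m j i) W"
proof -
  have M: "graded_bimodule K (D j) (D i) (bimod S j i)"
    using species i j by (simp add: is_superspecies_def)
  moreover have "graded_left_module (D j) (bimod S j i)"
    using M by (simp add: graded_bimodule_def)
  ultimately show ?thesis using V W dalg_closed i j bases
    by (simp add: arrow_data_def tensor_data_def based_module_def superdivision_module_def
      based_module_axioms_def admissible_bases_def)
qed

lemma module_pair:
  assumes "i \<in> I" "graded_left_module (D i) V" "graded_left_module (D i) W"
  shows "superdivision_module_pair K (D i) V W"
  using assms dalg_closed by (simp add: superdivision_module_pair_def superdivision_module_def)

text \<open>The structure map as a balanced map.\<close>

definition act :: "('a, 'm, 'v) species_rep \<Rightarrow> nat \<Rightarrow> nat \<Rightarrow> 'm \<Rightarrow> 'v \<Rightarrow> 'v" where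
  "act V j i x v = smap V j i (pure_tensor (D i) (bimod S j i) (sspace V i) x v)"

lemma rep_module: "is_species_rep S V \<Longrightarrow> i \<in> I \<Longrightarrow> graded_left_module (D i) (sspace V i)"
  by (simp add: is_species_rep_def)

lemma act_bihom:
  assumes V: "is_species_rep S V" and i: "i \<in> I" and j: "j \<in> I"
  shows "tensor_bihom (D j) (D i) (bimod S j i) (sspace V i) (sspace V j) (act V j i)"
proof -
  interpret arrow_data K "D j" "D i" "bimod S j i" "sspace V i" "L j i" "m j i" "sspace V j"
    by (rule arrow_data[OF i j rep_module[OF V i] rep_module[OF V j]])
  show ?thesis unfolding act_def
    using V i j by (intro bihom_of_hom W_mod) (simp add: is_species_rep_def)
qed

text \<open>Both sides of the compatibility condition are additive in the tensor, so pure tensors suffice.\<close>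

lemma species_rep_hom_iff:
  fixes V W :: "('a, 'm, 'v) species_rep"
  assumes V: "is_species_rep S V" and W: "is_species_rep S W"
  shows "\<alpha> \<in> species_rep_hom S V W \<longleftrightarrow>
    \<alpha> \<in> (\<Pi>\<^sub>E i\<in>I. graded_hom (D i) (sspace V i) (sspace W i) \<inter> extensional (carrier (sspace V i))) \<and>
    (\<forall>i\<in>I. \<forall>j\<in>I. \<forall>x\<in>carrier (bimod S j i). \<forall>v\<in>carrier (sspace V i).
      act W j i x (\<alpha> i v) = \<alpha> j (act V j i x v))"
proof -
  let ?P = "\<Pi>\<^sub>E i\<in>I. graded_hom (D i) (sspace V i) (sspace W i) \<inter> extensional (carrier (sspace V i))"
  have "(\<forall>T\<in>carrier (tensor (D i) (bimod S j i) (sspace V i)).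
          smap W j i (tensor_map (D i) (bimod S j i) (sspace W i) (\<lambda>m. m) (\<alpha> i) T) =
          \<alpha> j (smap V j i T)) \<longleftrightarrow>
      (\<forall>x\<in>carrier (bimod S j i). \<forall>v\<in>carrier (sspace V i). act W j i x (\<alpha> i v) = \<alpha> j (act V j i x v))"
    (is "?l \<longleftrightarrow> ?r")
    if \<alpha>: "\<alpha> \<in> ?P" and i: "i \<in> I" and j: "j \<in> I" for i j
  proof -
    interpret VV: arrow_data K "D j" "D i" "bimod S j i" "sspace V i" "L j i" "m j i" "sspace V j"
      by (rule arrow_data[OF i j rep_module[OF V i] rep_module[OF V j]])
    interpret WW: arrow_data K "D j" "D i" "bimod S j i" "sspace W i" "L j i" "m j i" "sspace W j"
      by (rule arrow_data[OF i j rep_module[OF W i] rep_module[OF W j]])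
    let ?t = "tensor_map (D i) (bimod S j i) (sspace W i) (\<lambda>m. m) (\<alpha> i)"
    have \<alpha>i: "\<alpha> i \<in> module_hom (D i) (sspace V i) (sspace W i)"
      and \<alpha>j: "\<alpha> j \<in> module_hom (D j) (sspace V j) (sspace W j)"
      using \<alpha> i j by (auto simp: PiE_iff graded_hom_def)
    have th: "?t \<in> hom (tensor_group (D i) (bimod S j i) (sspace V i)) (tensor_group (D i) (bimod S j i) (sspace W i))"
      and tp: "\<And>x v. x \<in> carrier (bimod S j i) \<Longrightarrow> v \<in> carrier (sspace V i) \<Longrightarrow>
        ?t (pure_tensor (D i) (bimod S j i) (sspace V i) x v) = pure_tensor (D i) (bimod S j i) (sspace W i) x (\<alpha> i v)"
      using VV.tensor_map_hom[OF rep_module[OF W i] _ _ _ \<alpha>i, of "\<lambda>x. x"] by auto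
    show ?thesis
    proof
      assume ?l
      then show ?r unfolding act_def using tp by (metis VV.pure_closed tensor_simps(1))
    next
      assume r: ?r
      have sW: "smap W j i \<in> hom (tensor_group (D i) (bimod S j i) (sspace W i)) (add_monoid (sspace W j))"
        using W i j by (intro WW.module_hom_is_group_hom WW.W_mod) (simp add: is_species_rep_def)
      have sV: "smap V j i \<in> hom (tensor_group (D i) (bimod S j i) (sspace V i)) (add_monoid (sspace V j))"
        using V i j by (intro VV.module_hom_is_group_hom VV.W_mod) (simp add: is_species_rep_def)
      have aj: "\<alpha> j \<in> hom (add_monoid (sspace V j)) (add_monoid (sspace W j))"
        using \<alpha>j by (auto simp: module_hom_def hom_def)
      show ?l
      proof
        fix T assume "T \<in> carrier (tensor (D i) (bimod S j i) (sspace V i))"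
        then have T: "T \<in> carrier (tensor_group (D i) (bimod S j i) (sspace V i))" by simp
        have "(smap W j i \<circ> ?t) T = (\<alpha> j \<circ> smap V j i) T"
          using r tp unfolding act_def
          by (intro VV.hom_eq_on_pure[OF hom_compose[OF th sW] hom_compose[OF sV aj] _ _ T])
            (auto simp: WW.BW.VG.add.group_axioms)
        then show "smap W j i (?t T) = \<alpha> j (smap V j i T)" by simp
      qed
    qed
  qed
  then show ?thesis unfolding species_rep_hom_def by blast
qed

lemma rep_ob_iff: "V \<in> Ob (rep_superspecies K S) \<longleftrightarrow>
    is_species_rep S V \<and> (\<forall>i\<in>I. fin_dim_module K (D i) (sspace V i))"
  by (simp add: rep_superspecies_def)

lemma Hom_rep: "Hom (rep_superspecies K S) = species_rep_hom S"
  by (simp add: rep_superspecies_def)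

lemma species_rep_hom_closed:
  "\<alpha> \<in> species_rep_hom S V W \<Longrightarrow> i \<in> I \<Longrightarrow> \<alpha> i \<in> carrier (sspace V i) \<rightarrow> carrier (sspace W i)"
  by (auto simp: species_rep_hom_def PiE_iff graded_hom_def module_hom_def)

lemma category_rep_superspecies:
  "category (rep_superspecies K S :: (('a, 'm, 'v) species_rep, nat \<Rightarrow> 'v \<Rightarrow> 'v) cat)"
proof (unfold_locales, goal_cases)
  case (1 V)
  then have V: "is_species_rep S V" by (simp add: rep_ob_iff)
  have "(\<lambda>x\<in>carrier (sspace V i). x) \<in> graded_hom (D i) (sspace V i) (sspace V i)" if i: "i \<in> I" for i
  proof -
    interpret superdivision_module_pair K "D i" "sspace V i" "sspace V i"
      using module_pair i rep_module[OF V] by blast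
    show ?thesis by (rule graded_hom_restrict) (auto simp: graded_hom_def module_hom_def)
  qed
  moreover have "act V j i x v \<in> carrier (sspace V j)" if "i \<in> I" "j \<in> I"
    "x \<in> carrier (bimod S j i)" "v \<in> carrier (sspace V i)" for i j x v
    using act_bihom[OF V that(1,2)] that by (simp add: tensor_bihom_def)
  ultimately show ?case unfolding Hom_rep species_rep_hom_iff[OF V V]
    by (auto simp: rep_superspecies_def)
next
  case (2 V Y Z f g)
  then have V: "is_species_rep S V" and Y: "is_species_rep S Y" and Z: "is_species_rep S Z"
    by (simp_all add: rep_ob_iff)
  have fg: "f \<in> species_rep_hom S V Y" "g \<in> species_rep_hom S Y Z" using 2 by (simp_all add: Hom_rep)
  note f = fg(1)[unfolded species_rep_hom_iff[OF V Y]] and g = fg(2)[unfolded species_rep_hom_iff[OF Y Z]]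
  have "compose (carrier (sspace V i)) (g i) (f i) \<in> graded_hom (D i) (sspace V i) (sspace Z i)" if i: "i \<in> I" for i
  proof -
    interpret VY: superdivision_module_pair K "D i" "sspace V i" "sspace Y i"
      using module_pair i rep_module[OF V] rep_module[OF Y] by blast
    interpret YZ: superdivision_module_pair K "D i" "sspace Y i" "sspace Z i"
      using module_pair i rep_module[OF Y] rep_module[OF Z] by blast
    interpret VZ: superdivision_module_pair K "D i" "sspace V i" "sspace Z i"
      using module_pair i rep_module[OF V] rep_module[OF Z] by blast
    have fi: "f i \<in> graded_hom (D i) (sspace V i) (sspace Y i)"
      and gi: "g i \<in> graded_hom (D i) (sspace Y i) (sspace Z i)" using f g i by (auto simp: PiE_iff)
    show ?thesis unfolding compose_def
      by (rule VZ.graded_hom_restrict, rule VZ.graded_homI)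
        (simp_all add: VY.graded_homD[OF fi] YZ.graded_homD[OF gi] VY.V.V.smult_closed)
  qed
  moreover have "act V j i x v \<in> carrier (sspace V j)" if "i \<in> I" "j \<in> I"
    "x \<in> carrier (bimod S j i)" "v \<in> carrier (sspace V i)" for i j x v
    using act_bihom[OF V that(1,2)] that by (simp add: tensor_bihom_def)
  moreover have "f i v \<in> carrier (sspace Y i)" if "i \<in> I" "v \<in> carrier (sspace V i)" for i v
    using species_rep_hom_closed[OF fg(1) that(1)] that(2) by auto
  ultimately show ?case using f g unfolding Hom_rep species_rep_hom_iff[OF V Z]
    by (auto simp: rep_superspecies_def compose_eq)
next
  case (3 V Y f)
  show ?case
  proof
    fix i
    show "Comp (rep_superspecies K S) V V Y f (Ident (rep_superspecies K S) V) i = f i"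
      using 3 by (cases "i \<in> I")
        (auto simp: rep_superspecies_def species_rep_hom_def compose_def fun_eq_iff PiE_iff extensional_def)
  qed
next
  case (4 V Y f)
  show ?case
  proof
    fix i
    show "Comp (rep_superspecies K S) V Y Y (Ident (rep_superspecies K S) Y) f i = f i"
      using 4 by (cases "i \<in> I")
        (auto simp: rep_superspecies_def species_rep_hom_def compose_def fun_eq_iff PiE_iff extensional_def
          module_hom_def graded_hom_def)
  qed
next
  case (5 W V Y Z f g h)
  then show ?case using species_rep_hom_closed[of f W V]
    by (auto simp: rep_superspecies_def fun_eq_iff compose_def Pi_iff)
qed

end

section \<open>The functor from superspecies representations to quiver representations\<close>

lemma iso_rep_quiverI:
  assumes Q: "wf_digraph Q" and V: "V \<in> Ob (rep_quiver K Q)" and W: "W \<in> Ob (rep_quiver K Q)"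
    and f: "f \<in> quiver_rep_hom K Q V W"
    and bij: "\<And>x. x \<in> verts Q \<Longrightarrow> bij_betw (f x) (carrier (qspace V x)) (carrier (qspace W x))"
  shows "iso_hom (rep_quiver K Q) V W f"
proof -
  interpret wf_digraph Q by (rule Q)
  define g where "g = (\<lambda>x\<in>verts Q. \<lambda>w\<in>carrier (qspace W x). inv_into (carrier (qspace V x)) (f x) w)"
  have fm: "f x \<in> module_hom K (qspace V x) (qspace W x)" if "x \<in> verts Q" for x
    using f that by (auto simp: quiver_rep_hom_def PiE_iff)
  have fg: "f x (g x w) = w" and gc: "g x w \<in> carrier (qspace V x)" if "x \<in> verts Q" "w \<in> carrier (qspace W x)" for x w
  proof -
    have w: "w \<in> f x ` carrier (qspace V x)" using bij[OF that(1)] that(2) by (simp add: bij_betw_def)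
    show "f x (g x w) = w" "g x w \<in> carrier (qspace V x)"
      using f_inv_into_f[OF w] inv_into_into[OF w] that by (simp_all add: g_def)
  qed
  have gf: "g x (f x v) = v" if "x \<in> verts Q" "v \<in> carrier (qspace V x)" for x v
    using bij[OF that(1)] that module_hom_closed[OF fm[OF that(1)]] by (auto simp: g_def bij_betw_def)
  have inj: "v = v'" if "x \<in> verts Q" "v \<in> carrier (qspace V x)" "v' \<in> carrier (qspace V x)" "f x v = f x v'" for x v v'
    using bij[OF that(1)] that(2-) by (auto simp: bij_betw_def inj_on_def)
  have gm: "g x \<in> module_hom K (qspace W x) (qspace V x)" if x: "x \<in> verts Q" for x
  proof -
    interpret V: vectorspace K "qspace V x" using V x by (simp add: rep_quiver_def is_quiver_rep_def)
    interpret W: vectorspace K "qspace W x" using W x by (simp add: rep_quiver_def is_quiver_rep_def)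
    show ?thesis unfolding module_hom_def
    proof (intro CollectI conjI allI impI; (elim conjE)?)
      show "g x \<in> carrier (qspace W x) \<rightarrow> carrier (qspace V x)" using gc[OF x] by blast
    next
      fix w w' assume "w \<in> carrier (qspace W x)" "w' \<in> carrier (qspace W x)"
      then show "g x (w \<oplus>\<^bsub>qspace W x\<^esub> w') = g x w \<oplus>\<^bsub>qspace V x\<^esub> g x w'"
        by - (rule inj[OF x], simp_all add: gc[OF x] fg[OF x] module_hom_add[OF fm[OF x]])
    next
      fix c w assume "c \<in> carrier K" "w \<in> carrier (qspace W x)"
      then show "g x (c \<odot>\<^bsub>qspace W x\<^esub> w) = c \<odot>\<^bsub>qspace V x\<^esub> g x w"
        by - (rule inj[OF x], simp_all add: gc[OF x] fg[OF x] module_hom_smult[OF fm[OF x]])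
    qed
  qed
  have Va: "qmap V a v \<in> carrier (qspace V (head Q a))" if "a \<in> arcs Q" "v \<in> carrier (qspace V (tail Q a))" for a v
    using V that by (auto simp: rep_quiver_def is_quiver_rep_def dest!: module_hom_closed)
  have Wa: "qmap W a v \<in> carrier (qspace W (head Q a))" if "a \<in> arcs Q" "v \<in> carrier (qspace W (tail Q a))" for a v
    using W that by (auto simp: rep_quiver_def is_quiver_rep_def dest!: module_hom_closed)
  have "qmap V a (g (tail Q a) w) = g (head Q a) (qmap W a w)" if a: "a \<in> arcs Q" and w: "w \<in> carrier (qspace W (tail Q a))" for a w
  proof (rule inj[of "head Q a"])
    have *: "g (tail Q a) w \<in> carrier (qspace V (tail Q a))" using a w by (simp add: gc)
    have "f (head Q a) (qmap V a (g (tail Q a) w)) = qmap W a (f (tail Q a) (g (tail Q a) w))"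
      using f a * by (simp add: quiver_rep_hom_def)
    then show "f (head Q a) (qmap V a (g (tail Q a) w)) = f (head Q a) (g (head Q a) (qmap W a w))"
      using a w by (simp add: fg Wa)
    show "qmap V a (g (tail Q a) w) \<in> carrier (qspace V (head Q a))" using a * by (simp add: Va)
  qed (use a w in \<open>simp_all add: gc Wa\<close>)
  then have "g \<in> quiver_rep_hom K Q W V"
    unfolding quiver_rep_hom_def using gm by (auto simp: g_def)
  moreover have "Comp (rep_quiver K Q) V W V g f = Ident (rep_quiver K Q) V"
    by (auto simp: rep_quiver_def fun_eq_iff compose_def gf)
  moreover have "Comp (rep_quiver K Q) W V W f g = Ident (rep_quiver K Q) W"
    by (auto simp: rep_quiver_def fun_eq_iff compose_def fg)
  ultimately show ?thesis using f unfolding iso_hom_def by (auto simp: rep_quiver_def)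
qed

context superspecies_setup
begin

definition quiver_rep_of :: "('a, 'm, 'v) species_rep \<Rightarrow> ('k, nat \<times> bit, nat \<times> nat \<times> 'l \<times> bit, 'v) quiver_rep" where
  "quiver_rep_of V = \<lparr>qspace = (\<lambda>(i, z). piece (D i) (sspace V i) z),
    qmap = (\<lambda>(j, i, l, z) v. shift j i z \<odot>\<^bsub>sspace V j\<^esub> act V j i (m j i l) v)\<rparr>"

definition quiver_hom_of :: "('a, 'm, 'v) species_rep \<Rightarrow> (nat \<Rightarrow> 'v \<Rightarrow> 'v) \<Rightarrow> nat \<times> bit \<Rightarrow> 'v \<Rightarrow> 'v" where
  "quiver_hom_of V \<alpha> = restrict (\<lambda>(i, z). restrict (\<alpha> i) (hcomp (sspace V i) z)) (verts Q)"

definition quiver_functor ::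
  "(('a, 'm, 'v) species_rep, nat \<Rightarrow> 'v \<Rightarrow> 'v,
    ('k, nat \<times> bit, nat \<times> nat \<times> 'l \<times> bit, 'v) quiver_rep, nat \<times> bit \<Rightarrow> 'v \<Rightarrow> 'v) cat_map" where
  "quiver_functor = \<lparr>on_ob = quiver_rep_of, on_hom = (\<lambda>V W. quiver_hom_of V)\<rparr>"

lemma quiver_rep_of_simps [simp]:
  "qspace (quiver_rep_of V) (i, z) = piece (D i) (sspace V i) z"
  "qmap (quiver_rep_of V) (j, i, l, z) v = shift j i z \<odot>\<^bsub>sspace V j\<^esub> act V j i (m j i l) v"
  by (simp_all add: quiver_rep_of_def)

lemma act_graded:
  assumes V: "is_species_rep S V" and i: "i \<in> I" and j: "j \<in> I" and l: "l \<in> L j i"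
    and v: "v \<in> hcomp (sspace V i) z"
  shows "act V j i (m j i l) v \<in> hcomp (sspace V j) (deg (bimod S j i) (m j i l) + z)"
proof -
  interpret arrow_data K "D j" "D i" "bimod S j i" "sspace V i" "L j i" "m j i" "sspace V j"
    by (rule arrow_data[OF i j rep_module[OF V i] rep_module[OF V j]])
  show ?thesis using act_bihom[OF V i j] basis_deg[OF l] v by (simp add: tensor_bihom_def)
qed

lemma quiver_rep_of_is_rep:
  assumes V: "is_species_rep S V"
  shows "is_quiver_rep K Q (quiver_rep_of V)"
  unfolding is_quiver_rep_def
proof (intro conjI ballI)
  fix x assume "x \<in> verts Q"
  then obtain i z where x: "x = (i, z)" "i \<in> I" by (cases x) (auto simp: verts_iff)
  interpret superdivision_module K "D i" "sspace V i"
    using dalg_closed[OF x(2)] rep_module[OF V x(2)] by (simp add: superdivision_module_def)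
  show "vectorspace K (qspace (quiver_rep_of V) x)" by (simp add: x vectorspace_piece)
next
  fix a assume "a \<in> arcs Q"
  then obtain j i l z where a: "a = (j, i, l, z)" and i: "i \<in> I" and j: "j \<in> I"
    and l: "l \<in> L j i" and z: "z = 0 \<or> ground i" by (cases a) (auto simp: arcs_iff)
  interpret arrow_data K "D j" "D i" "bimod S j i" "sspace V i" "L j i" "m j i" "sspace V j"
    by (rule arrow_data[OF i j rep_module[OF V i] rep_module[OF V j]])
  note b = act_bihom[OF V i j]
  note s = shift_props[OF i j W_mod]
  have ac: "act V j i (m j i l) v \<in> carrier (sspace V j)" if "v \<in> hcomp (sspace V i) z" for v
    using act_graded[OF V i j l that] by simp
  have aa: "act V j i (m j i l) (v \<oplus>\<^bsub>sspace V i\<^esub> w) = act V j i (m j i l) v \<oplus>\<^bsub>sspace V j\<^esub> act V j i (m j i l) w"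
    if "v \<in> hcomp (sspace V i) z" "w \<in> hcomp (sspace V i) z" for v w
    using b AV.VG.hcompD that l by (simp add: tensor_bihom_def)
  show "qmap (quiver_rep_of V) a \<in> module_hom K (qspace (quiver_rep_of V) (tail Q a)) (qspace (quiver_rep_of V) (head Q a))"
    unfolding module_hom_def a tail_eq head_eq[OF i j]
    using s(3)[OF l z act_graded[OF V i j l]] s(1) s(5) l
    by (auto simp: aa ac W.smult_r_distr bihom_kmult[OF b])
qed

lemma quiver_rep_of_ob:
  assumes V: "V \<in> Ob (rep_superspecies K S)"
  shows "quiver_rep_of V \<in> Ob (rep_quiver K Q)"
proof -
  have V': "is_species_rep S V" using V by (simp add: rep_ob_iff)
  have "vectorspace.fin_dim K (qspace (quiver_rep_of V) x)" if xQ: "x \<in> verts Q" for x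
  proof -
    obtain i z where x: "x = (i, z)" "i \<in> I" using xQ by (cases x) (auto simp: verts_iff)
    interpret superdivision_module K "D i" "sspace V i"
      using dalg_closed[OF x(2)] rep_module[OF V' x(2)] by (simp add: superdivision_module_def)
    show ?thesis using V x fin_dim_piece by (simp add: rep_ob_iff)
  qed
  then show ?thesis using quiver_rep_of_is_rep[OF V'] by (simp add: rep_quiver_def)
qed

lemma quiver_hom_of_apply:
  "(i, z) \<in> verts Q \<Longrightarrow> v \<in> hcomp (sspace V i) z \<Longrightarrow> quiver_hom_of V \<alpha> (i, z) v = \<alpha> i v"
  by (simp add: quiver_hom_of_def)

lemma hom_component:
  assumes \<alpha>: "\<alpha> \<in> species_rep_hom S V W" and i: "i \<in> I"
  shows "\<alpha> i \<in> graded_hom (D i) (sspace V i) (sspace W i)"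
  using \<alpha> i by (auto simp: species_rep_hom_def PiE_iff)

lemma quiver_hom_of_hom:
  assumes V: "is_species_rep S V" and W: "is_species_rep S W" and \<alpha>: "\<alpha> \<in> species_rep_hom S V W"
  shows "quiver_hom_of V \<alpha> \<in> quiver_rep_hom K Q (quiver_rep_of V) (quiver_rep_of W)"
proof -
  have 1: "quiver_hom_of V \<alpha> x \<in> module_hom K (qspace (quiver_rep_of V) x) (qspace (quiver_rep_of W) x) \<inter>
      extensional (carrier (qspace (quiver_rep_of V) x))" if xQ: "x \<in> verts Q" for x
  proof -
    obtain i z where x: "x = (i, z)" "i \<in> I" using xQ by (cases x) (auto simp: verts_iff)
    interpret superdivision_module_pair K "D i" "sspace V i" "sspace W i"
      using module_pair[OF x(2) rep_module[OF V x(2)] rep_module[OF W x(2)]] .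
    note a = graded_homD[OF hom_component[OF \<alpha> x(2)]]
    show ?thesis using xQ a unfolding x by (auto simp: quiver_hom_of_def module_hom_def)
  qed
  have 2: "qmap (quiver_rep_of W) a (quiver_hom_of V \<alpha> (tail Q a) v) = quiver_hom_of V \<alpha> (head Q a) (qmap (quiver_rep_of V) a v)"
    if a: "a \<in> arcs Q" and v: "v \<in> carrier (qspace (quiver_rep_of V) (tail Q a))" for a v
  proof -
    obtain j i l z where a': "a = (j, i, l, z)" and i: "i \<in> I" and j: "j \<in> I"
      and l: "l \<in> L j i" and z: "z = 0 \<or> ground i" using a by (cases a) (auto simp: arcs_iff)
    interpret arrow_data K "D j" "D i" "bimod S j i" "sspace V i" "L j i" "m j i" "sspace V j"
      by (rule arrow_data[OF i j rep_module[OF V i] rep_module[OF V j]])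
    interpret VW: superdivision_module_pair K "D j" "sspace V j" "sspace W j"
      using module_pair[OF j rep_module[OF V j] rep_module[OF W j]] .
    note s = shift_props[OF i j rep_module[OF V j]]
    have v: "v \<in> hcomp (sspace V i) z" using v by (simp add: a' tail_eq)
    note ag = act_graded[OF V i j l v]
    have "act W j i (m j i l) (\<alpha> i v) = \<alpha> j (act V j i (m j i l) v)"
      using \<alpha> species_rep_hom_iff[OF V W] i j l v by simp
    moreover have "\<alpha> j (shift j i z \<odot>\<^bsub>sspace V j\<^esub> act V j i (m j i l) v) = shift j i z \<odot>\<^bsub>sspace W j\<^esub> \<alpha> j (act V j i (m j i l) v)"
      using s(1) ag by (simp add: VW.graded_homD(3)[OF hom_component[OF \<alpha> j]])
    ultimately show ?thesis
      using v s(3)[OF l z ag] i j z head_vert[OF i j l z]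
      by (simp add: a' tail_eq head_eq quiver_hom_of_apply verts_iff)
  qed
  show ?thesis unfolding quiver_rep_hom_def using 1 2 by (auto simp: quiver_hom_of_def)
qed

lemma quiver_functor_is_functor:
  "covariant_functor (rep_superspecies K S :: (('a, 'm, 'v) species_rep, nat \<Rightarrow> 'v \<Rightarrow> 'v) cat)
    (rep_quiver K Q) quiver_functor"
proof -
  interpret category "rep_superspecies K S :: (('a, 'm, 'v) species_rep, nat \<Rightarrow> 'v \<Rightarrow> 'v) cat"
    by (rule category_rep_superspecies)
  interpret target: category "rep_quiver K Q :: (('k, nat \<times> bit, nat \<times> nat \<times> 'l \<times> bit, 'v) quiver_rep, nat \<times> bit \<Rightarrow> 'v \<Rightarrow> 'v) cat"
    by (rule category_rep_quiver[OF wf_quiver])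
  have sub: "hcomp (sspace V i) z \<subseteq> carrier (sspace V i)" if "is_species_rep S V" "i \<in> I"
    for V :: "('a, 'm, 'v) species_rep" and i z
  proof -
    interpret superdivision_module_pair K "D i" "sspace V i" "sspace V i"
      using module_pair that rep_module by blast
    show ?thesis by (rule V.VG.hcomp_subset)
  qed
  show ?thesis
  proof (unfold_locales, goal_cases)
    case (1 V)
    then show ?case by (simp add: quiver_functor_def quiver_rep_of_ob)
  next
    case (2 V Y f)
    then show ?case using quiver_hom_of_hom[of V Y f]
      by (simp add: quiver_functor_def rep_ob_iff Hom_rep) (simp add: rep_quiver_def)
  next
    case (3 V)
    then have "is_species_rep S V" by (simp add: rep_ob_iff)
    from sub[OF this] show ?case
      by (auto simp: quiver_functor_def quiver_hom_of_def rep_quiver_def rep_superspecies_def fun_eq_iff verts_iff)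
  next
    case (4 V Y Z f g)
    then have V: "is_species_rep S V" and Y: "is_species_rep S Y" and f: "f \<in> species_rep_hom S V Y"
      by (simp_all add: rep_ob_iff Hom_rep)
    have "f i v \<in> hcomp (sspace Y i) z" if "i \<in> I" "v \<in> hcomp (sspace V i) z" for i v z
      using hom_component[OF f that(1)] that(2) by (auto simp: graded_hom_def)
    then show ?case using sub[OF V]
      by (auto simp: quiver_functor_def quiver_hom_of_def rep_quiver_def rep_superspecies_def fun_eq_iff verts_iff compose_def
          restrict_def subset_iff)
  qed
qed

lemma quiver_functor_faithful:
  assumes V: "is_species_rep S V" and W: "is_species_rep S W"
  shows "inj_on (quiver_hom_of V) (species_rep_hom S V W)"
proof
  fix \<alpha> \<beta> assume ab: "\<alpha> \<in> species_rep_hom S V W" "\<beta> \<in> species_rep_hom S V W"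
    and eq: "quiver_hom_of V \<alpha> = quiver_hom_of V \<beta>"
  have "\<alpha> i v = \<beta> i v" if i: "i \<in> I" for i v
  proof (cases "v \<in> carrier (sspace V i)")
    case True
    interpret superdivision_module_pair K "D i" "sspace V i" "sspace W i"
      using module_pair[OF i rep_module[OF V i] rep_module[OF W i]] .
    show ?thesis
    proof (rule graded_hom_eqI[OF hom_component[OF ab(1) i] hom_component[OF ab(2) i] _ True])
      fix z x assume "z = 0 \<or> purely_even (D i)" "x \<in> hcomp (sspace V i) z"
      then show "\<alpha> i x = \<beta> i x"
        using quiver_hom_of_apply[of i z x V \<alpha>] quiver_hom_of_apply[of i z x V \<beta>] eq i
        by (simp add: verts_iff ground_def)
    qed
  next
    case False
    have "\<alpha> i \<in> extensional (carrier (sspace V i))" "\<beta> i \<in> extensional (carrier (sspace V i))"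
      using ab i by (simp_all add: species_rep_hom_def PiE_iff)
    then show ?thesis using False by (simp add: extensional_def)
  qed
  moreover have "\<alpha> i = \<beta> i" if "i \<notin> I" for i
  proof -
    have "\<alpha> \<in> extensional (I)" "\<beta> \<in> extensional (I)"
      using ab by (simp_all add: species_rep_hom_def PiE_iff)
    then show ?thesis using that by (simp add: extensional_def)
  qed
  ultimately have "\<alpha> i = \<beta> i" for i by (cases "i \<in> I") auto
  then show "\<alpha> = \<beta>" by (rule ext)
qed

text \<open>The maps at the vertices extend to graded module maps.  Applying them before or after the
  structure map gives two balanced maps, which agree on the basis and the components at the vertices
  because there the shift can be cancelled from the compatibility with the arrows.\<close>

lemma quiver_functor_full:
  assumes V: "is_species_rep S V" and W: "is_species_rep S W"
    and \<beta>: "\<beta> \<in> quiver_rep_hom K Q (quiver_rep_of V) (quiver_rep_of W)"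
  shows "\<exists>\<alpha>\<in>species_rep_hom S V W. quiver_hom_of V \<alpha> = \<beta>"
proof -
  have "\<exists>f\<in>graded_hom (D i) (sspace V i) (sspace W i).
      \<forall>z x. z = 0 \<or> ground i \<longrightarrow> x \<in> hcomp (sspace V i) z \<longrightarrow> f x = \<beta> (i, z) x" if i: "i \<in> I" for i
  proof -
    interpret superdivision_module_pair K "D i" "sspace V i" "sspace W i"
      using module_pair[OF i rep_module[OF V i] rep_module[OF W i]] .
    have "\<beta> (i, z) \<in> module_hom K (piece (D i) (sspace V i) z) (piece (D i) (sspace W i) z)"
      if "z = 0 \<or> ground i" for z
    proof -
      have "(i, z) \<in> verts Q" using i that by (simp add: verts_iff)
      then show ?thesis using \<beta> by (auto simp: quiver_rep_hom_def PiE_iff)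
    qed
    then show ?thesis using extend_vertex_pieces[of "\<lambda>z. \<beta> (i, z)"] unfolding ground_def by blast
  qed
  then obtain f where f: "\<And>i. i \<in> I \<Longrightarrow> f i \<in> graded_hom (D i) (sspace V i) (sspace W i)"
    and f\<beta>: "\<And>i z x. i \<in> I \<Longrightarrow> z = 0 \<or> ground i \<Longrightarrow> x \<in> hcomp (sspace V i) z \<Longrightarrow> f i x = \<beta> (i, z) x"
    by metis
  define \<alpha> where "\<alpha> = (\<lambda>i\<in>I. restrict (f i) (carrier (sspace V i)))"
  have \<alpha>g: "\<alpha> i \<in> graded_hom (D i) (sspace V i) (sspace W i)" if i: "i \<in> I" for i
  proof -
    interpret superdivision_module_pair K "D i" "sspace V i" "sspace W i"
      using module_pair[OF i rep_module[OF V i] rep_module[OF W i]] .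
    show ?thesis using graded_hom_restrict[OF f[OF i]] i by (simp add: \<alpha>_def)
  qed
  have \<alpha>\<beta>: "\<alpha> i x = \<beta> (i, z) x" if i: "i \<in> I" and "z = 0 \<or> ground i" "x \<in> hcomp (sspace V i) z" for i z x
  proof -
    interpret superdivision_module_pair K "D i" "sspace V i" "sspace W i"
      using module_pair[OF i rep_module[OF V i] rep_module[OF W i]] .
    show ?thesis using f\<beta>[OF that] that by (simp add: \<alpha>_def)
  qed
  have comm: "act W j i x (\<alpha> i v) = \<alpha> j (act V j i x v)" if i: "i \<in> I" and j: "j \<in> I"
    and x: "x \<in> carrier (bimod S j i)" and v: "v \<in> carrier (sspace V i)" for i j x v
  proof -
    interpret arrow_data K "D j" "D i" "bimod S j i" "sspace V i" "L j i" "m j i" "sspace W j"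
      by (rule arrow_data[OF i j rep_module[OF V i] rep_module[OF W j]])
    interpret VW: superdivision_module_pair K "D j" "sspace V j" "sspace W j"
      using module_pair[OF j rep_module[OF V j] rep_module[OF W j]] .
    note sV = shift_props[OF i j rep_module[OF V j]] and sW = shift_props[OF i j rep_module[OF W j]]
    show ?thesis
    proof (rule bihom_eqI[OF tensor_bihom_pre[OF act_bihom[OF W i j] \<alpha>g[OF i]]
          tensor_bihom_post[OF act_bihom[OF V i j] \<alpha>g[OF j]] _ x v])
      fix l z v assume l: "l \<in> L j i" and z': "z = 0 \<or> purely_even (D i)"
        and v: "v \<in> hcomp (sspace V i) z"
      then have z: "z = 0 \<or> ground i" by (simp add: ground_def)
      let ?s = "shift j i z" and ?y = "act V j i (m j i l) v" and ?y' = "act W j i (m j i l) (\<alpha> i v)"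
      have \<alpha>v: "\<alpha> i v \<in> hcomp (sspace W i) z" using \<alpha>g[OF i] v by (auto simp: graded_hom_def)
      have y: "?y \<in> carrier (sspace V j)" using act_graded[OF V i j l v] by simp
      have y': "?y' \<in> carrier (sspace W j)" using act_graded[OF W i j l \<alpha>v] by simp
      have a: "(j, i, l, z) \<in> arcs Q" using i j l z by (simp add: arcs_iff)
      have "qmap (quiver_rep_of W) (j, i, l, z) (\<beta> (i, z) v) = \<beta> (j, target j i l z) (qmap (quiver_rep_of V) (j, i, l, z) v)"
        using \<beta> a v unfolding quiver_rep_hom_def by (fastforce simp: tail_eq head_eq[OF i j])
      then have "?s \<odot>\<^bsub>sspace W j\<^esub> ?y' = \<alpha> j (?s \<odot>\<^bsub>sspace V j\<^esub> ?y)"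
        using \<alpha>\<beta>[OF i z v] \<alpha>\<beta>[OF j head_vert[OF i j l z] sV(3)[OF l z act_graded[OF V i j l v]]] by simp
      also have "\<dots> = ?s \<odot>\<^bsub>sspace W j\<^esub> \<alpha> j ?y"
        using sV(1) y by (simp add: VW.graded_homD(3)[OF \<alpha>g[OF j]])
      finally have "?s \<odot>\<^bsub>sspace W j\<^esub> (?s \<odot>\<^bsub>sspace W j\<^esub> ?y') = ?s \<odot>\<^bsub>sspace W j\<^esub> (?s \<odot>\<^bsub>sspace W j\<^esub> \<alpha> j ?y)" by simp
      then show "?y' = \<alpha> j ?y" using sW(2) y y' VW.graded_homD(1)[OF \<alpha>g[OF j] y] by simp
    qed
  qed
  have "\<alpha> \<in> species_rep_hom S V W"
    unfolding species_rep_hom_iff[OF V W] using \<alpha>g comm by (auto simp: \<alpha>_def)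
  moreover have "quiver_hom_of V \<alpha> = \<beta>"
  proof
    fix x :: "nat \<times> bit"
    obtain i z where x: "x = (i, z)" by (cases x)
    show "quiver_hom_of V \<alpha> x = \<beta> x"
    proof (cases "x \<in> verts Q")
      case True
      then have "\<beta> x \<in> extensional (carrier (qspace (quiver_rep_of V) x))"
        using \<beta> by (simp add: quiver_rep_hom_def PiE_iff)
      then have "\<beta> x \<in> extensional (hcomp (sspace V i) z)" by (simp add: x)
      then show ?thesis using True \<alpha>\<beta>[of i z] by (auto simp: x quiver_hom_of_def verts_iff fun_eq_iff extensional_def)
    next
      case False
      moreover have "\<beta> \<in> extensional (verts Q)" using \<beta> by (simp add: quiver_rep_hom_def PiE_iff)
      ultimately show ?thesis by (cases x) (simp add: quiver_hom_of_def extensional_def)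
    qed
  qed
  ultimately show ?thesis by blast
qed

end

section \<open>Essential surjectivity\<close>

lemma iso_hom_symmetric: "iso_hom C V Y f \<Longrightarrow> \<exists>g. iso_hom C Y V g"
  unfolding iso_hom_def by blast

text \<open>This pairing turns a direct sum of two spaces carried by subsets of \<open>'v\<close> into a space of the same
  kind.\<close>

lemma infinite_pairing:
  assumes "infinite (UNIV :: 'v set)"
  obtains p :: "'v \<times> 'v \<Rightarrow> 'v" where "inj p"
proof -
  have "|UNIV \<times> UNIV :: ('v \<times> 'v) set| =o |UNIV :: 'v set|"
    using card_of_Times_same_infinite[OF assms] by simp
  then show thesis using that unfolding card_of_ordIso[symmetric] bij_betw_def by auto
qed

context superspecies_setup
begin

text \<open>Glue the spaces at the vertices to graded modules.  The prescribed values are the maps of \<open>U\<close>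
  followed by the shift; as the shift is its own inverse, the functor recovers the maps of \<open>U\<close>.\<close>

lemma quiver_functor_essentially_surjective:
  fixes U :: "('k, nat \<times> bit, nat \<times> nat \<times> 'l \<times> bit, 'v) quiver_rep"
  assumes inf: "infinite (UNIV :: 'v set)" and U: "U \<in> Ob (rep_quiver K Q)"
  shows "\<exists>V\<in>Ob (rep_superspecies K S). \<exists>f. iso_hom (rep_quiver K Q) (quiver_rep_of V) U f"
proof -
  obtain p :: "'v \<times> 'v \<Rightarrow> 'v" where p: "inj p" using infinite_pairing[OF inf] .
  have Uv: "vectorspace K (qspace U x)" and Uf: "vectorspace.fin_dim K (qspace U x)" if "x \<in> verts Q" for x
    using U that by (auto simp: rep_quiver_def is_quiver_rep_def)
  have Ua: "qmap U (j, i, l, z) \<in> module_hom K (qspace U (i, z)) (qspace U (j, target j i l z))"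
    if "i \<in> I" "j \<in> I" "l \<in> L j i" "z = 0 \<or> ground i" for j i l z
  proof -
    have "(j, i, l, z) \<in> arcs Q" using that by (simp add: arcs_iff)
    then have "qmap U (j, i, l, z) \<in> module_hom K (qspace U (tail Q (j, i, l, z))) (qspace U (head Q (j, i, l, z)))"
      using U unfolding rep_quiver_def is_quiver_rep_def by (simp del: split_paired_All)
    then show ?thesis using that by (simp add: tail_eq head_eq)
  qed
  define U0 where "U0 i = qspace U (i, 0)" for i
  define U1 where "U1 i = qspace U (i, if ground i then 1 else 0)" for i
  define N where "N i = pair_module p K (D i) (U0 i) (U1 i)" for i
  define inc where "inc i = pair_module_data.inc (U0 i) (U1 i) p" for i
  have pm: "pair_module_data K (D i) (U0 i) (U1 i) p" if i: "i \<in> I" for i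
    using dalg_closed[OF i] Uv[of "(i, 0)"] Uv[of "(i, 1)"] p i
    by (auto simp: pair_module_data_def pair_module_data_axioms_def U0_def U1_def verts_iff ground_def)
  have Uz: "pair_module_data.U (U0 i) (U1 i) z = qspace U (i, z)" if "i \<in> I" "z = 0 \<or> ground i" for i z
    unfolding pair_module_data.U_def[OF pm[OF that(1)]] using that(2) by (auto simp: U0_def U1_def)
  have N: "graded_left_module (D i) (N i)" if "i \<in> I" for i
    unfolding N_def using pair_module_data.graded_left_module_P[OF pm[OF that]] .
  have inc_hom: "inc i z \<in> module_hom K (qspace U (i, z)) (piece (D i) (N i) z)"
    and inc_bij: "bij_betw (inc i z) (carrier (qspace U (i, z))) (hcomp (N i) z)"
    if "i \<in> I" "z = 0 \<or> ground i" for i z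
    using pair_module_data.inc_hom[OF pm[OF that(1)], of z] pair_module_data.inc_bij[OF pm[OF that(1)], of z]
    by (simp_all add: Uz[OF that] inc_def N_def)
  define good where "good i j \<phi> \<longleftrightarrow>
      \<phi> \<in> graded_hom (D j) (tensor (D i) (bimod S j i) (N i)) (N j) \<and>
      (\<forall>l\<in>L j i. \<forall>z. z = 0 \<or> ground i \<longrightarrow> (\<forall>u\<in>carrier (qspace U (i, z)).
        \<phi> (pure_tensor (D i) (bimod S j i) (N i) (m j i l) (inc i z u)) =
        shift j i z \<odot>\<^bsub>N j\<^esub> inc j (target j i l z) (qmap U (j, i, l, z) u)))" for i j \<phi>
  have good_ex: "\<exists>\<phi>. good i j \<phi>"
    if i: "i \<in> I" and j: "j \<in> I" for i j
  proof -
    define f where "f z l u = shift j i z \<odot>\<^bsub>N j\<^esub> inc j (target j i l z) (qmap U (j, i, l, z) u)" for z l u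
    note s = shift_props[OF i j N[OF j]]
    interpret Nj: superdivision_module K "D j" "N j"
      using dalg_closed[OF j] N[OF j] by (simp add: superdivision_module_def)
    have in_closed: "inc j t w \<in> hcomp (N j) t" if "w \<in> carrier (qspace U (j, t))" "t = 0 \<or> ground j" for t w
      using module_hom_closed[OF inc_hom[OF j that(2)]] that(1) by auto
    have qm: "qmap U (j, i, l, z) u \<in> carrier (qspace U (j, target j i l z))"
      if "z = 0 \<or> ground i" "l \<in> L j i" "u \<in> carrier (qspace U (i, z))" for z l u
      using module_hom_closed[OF Ua[OF i j that(2,1)]] that(3) by auto
    have "pair_arrow K (D j) (D i) (bimod S j i) (U0 i) (U1 i) p (L j i) (m j i) (N j) f"
    proof (intro pair_arrow.intro pair_arrow_axioms.intro)
      show "pair_module_data K (D i) (U0 i) (U1 i) p" by (rule pm[OF i])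
      show "arrow_data K (D j) (D i) (bimod S j i) (pair_module p K (D i) (U0 i) (U1 i)) (L j i) (m j i) (N j)"
        using arrow_data[OF i j N[OF i] N[OF j]] by (simp add: N_def)
    next
      fix z l u
      assume z: "z = 0 \<or> purely_even (D i)" and l: "l \<in> L j i"
        and u: "u \<in> carrier (pair_module_data.U (U0 i) (U1 i) z)"
      have z': "z = 0 \<or> ground i" using z by (simp add: ground_def)
      have u: "u \<in> carrier (qspace U (i, z))" using u Uz[OF i z'] by simp
      note t = head_vert[OF i j l z']
      note iq = in_closed[OF qm[OF z' l u] t]
      show "f z l u \<in> hcomp (N j) (z + deg (bimod S j i) (m j i l))"
        unfolding f_def using s(4)[OF l z' iq] by (simp add: add.commute)
      fix u' assume "u' \<in> carrier (pair_module_data.U (U0 i) (U1 i) z)"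
      then have u': "u' \<in> carrier (qspace U (i, z))" using Uz[OF i z'] by simp
      note iq' = in_closed[OF qm[OF z' l u'] t]
      show "f z l (u \<oplus>\<^bsub>pair_module_data.U (U0 i) (U1 i) z\<^esub> u') = f z l u \<oplus>\<^bsub>N j\<^esub> f z l u'"
        unfolding f_def Uz[OF i z'] module_hom_add[OF Ua[OF i j l z'] u u']
          module_hom_add[OF inc_hom[OF j t] qm[OF z' l u] qm[OF z' l u']]
        using s(1) iq iq' by (simp add: Nj.V.smult_r_distr)
    next
      fix z l c u
      assume z: "z = 0 \<or> purely_even (D i)" and l: "l \<in> L j i" and c: "c \<in> carrier K"
        and u: "u \<in> carrier (pair_module_data.U (U0 i) (U1 i) z)"
      have z': "z = 0 \<or> ground i" using z by (simp add: ground_def)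
      have u: "u \<in> carrier (qspace U (i, z))" using u Uz[OF i z'] by simp
      note t = head_vert[OF i j l z']
      note iq = in_closed[OF qm[OF z' l u] t]
      show "f z l (c \<odot>\<^bsub>pair_module_data.U (U0 i) (U1 i) z\<^esub> u) = (c \<odot>\<^bsub>D j\<^esub> \<one>\<^bsub>D j\<^esub>) \<odot>\<^bsub>N j\<^esub> f z l u"
        unfolding f_def Uz[OF i z'] module_hom_smult[OF Ua[OF i j l z'] c u]
          module_hom_smult[OF inc_hom[OF j t] c qm[OF z' l u]]
        using s(5)[OF c] iq by simp
    qed
    then interpret PA: pair_arrow K "D j" "D i" "bimod S j i" "U0 i" "U1 i" p "L j i" "m j i" "N j" f .
    obtain \<phi> where \<phi>: "\<phi> \<in> graded_hom (D j) (tensor (D i) (bimod S j i) (N i)) (N j)"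
      "\<And>x v. x \<in> carrier (bimod S j i) \<Longrightarrow> v \<in> carrier (N i) \<Longrightarrow>
        \<phi> (pure_tensor (D i) (bimod S j i) (N i) x v) = PA.glue x v"
      using PA.hom_of_bihom[OF N[OF j] PA.glue_bihom] unfolding N_def by blast
    have "\<phi> (pure_tensor (D i) (bimod S j i) (N i) (m j i l) (inc i z u)) = f z l u"
      if l: "l \<in> L j i" and z: "z = 0 \<or> ground i" and u: "u \<in> carrier (qspace U (i, z))" for l z u
    proof -
      have "inc i z u \<in> hcomp (N i) z" using module_hom_closed[OF inc_hom[OF i z]] u by auto
      then have "inc i z u \<in> carrier (N i)" using PA.AV.VG.hcompD by (simp add: N_def)
      then show ?thesis using PA.glue_basis[of z l u] \<phi>(2)[of "m j i l" "inc i z u"] l z u Uz[OF i z]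
        by (simp add: inc_def ground_def)
    qed
    then show ?thesis using \<phi>(1) unfolding f_def good_def by blast
  qed
  define \<phi> where "\<phi> j i = (SOME \<phi>. good i j \<phi>)" for j i
  have \<phi>_good: "good i j (\<phi> j i)" if "i \<in> I" "j \<in> I" for i j
    unfolding \<phi>_def by (rule someI_ex[OF good_ex[OF that]])
  have \<phi>: "\<phi> j i \<in> graded_hom (D j) (tensor (D i) (bimod S j i) (N i)) (N j)"
    if "i \<in> I" "j \<in> I" for i j
    using \<phi>_good[OF that] by (simp add: good_def)
  have \<phi>f: "\<phi> j i (pure_tensor (D i) (bimod S j i) (N i) (m j i l) (inc i z u)) =
        shift j i z \<odot>\<^bsub>N j\<^esub> inc j (target j i l z) (qmap U (j, i, l, z) u)"
    if "i \<in> I" "j \<in> I" "l \<in> L j i" "z = 0 \<or> ground i" "u \<in> carrier (qspace U (i, z))"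
    for i j l z u
    using \<phi>_good[OF that(1,2)] that(3-) unfolding good_def by blast
  define V where "V = \<lparr>sspace = N, smap = \<phi>\<rparr>"
  have V: "is_species_rep S V" unfolding is_species_rep_def V_def using N \<phi> by simp
  have "fin_dim_module K (D i) (N i)" if i: "i \<in> I" for i
  proof -
    have "vectorspace.fin_dim K (U0 i)" "vectorspace.fin_dim K (U1 i)"
      using i Uf[of "(i, 0)"] Uf[of "(i, 1)"] by (auto simp: U0_def U1_def verts_iff)
    then show ?thesis using pair_module_data.fin_dim_P[OF pm[OF i]] by (simp add: N_def)
  qed
  then have V_ob: "V \<in> Ob (rep_superspecies K S)" using V by (simp add: rep_ob_iff) (simp add: V_def)
  define \<iota> where "\<iota> = restrict (\<lambda>(i, z). restrict (inc i z) (carrier (qspace U (i, z)))) (verts Q)"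
  have \<iota>_hom: "\<iota> \<in> quiver_rep_hom K Q U (quiver_rep_of V)"
  proof -
    have "\<iota> x \<in> module_hom K (qspace U x) (qspace (quiver_rep_of V) x) \<inter> extensional (carrier (qspace U x))"
      if x: "x \<in> verts Q" for x
    proof -
      obtain i z where iz: "x = (i, z)" "i \<in> I" "z = 0 \<or> ground i"
        using x by (cases x) (auto simp: verts_iff)
      interpret Ux: vectorspace K "qspace U (i, z)" using Uv[of "(i, z)"] x iz by simp
      show ?thesis using inc_hom[OF iz(2,3)] x
        by (auto simp: iz(1) \<iota>_def module_hom_def V_def)
    qed
    moreover have "qmap (quiver_rep_of V) a (\<iota> (tail Q a) u) = \<iota> (head Q a) (qmap U a u)"
      if a: "a \<in> arcs Q" and u: "u \<in> carrier (qspace U (tail Q a))" for a u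
    proof -
      obtain j i l z where a': "a = (j, i, l, z)" and i: "i \<in> I" and j: "j \<in> I"
        and l: "l \<in> L j i" and z: "z = 0 \<or> ground i" using a by (cases a) (auto simp: arcs_iff)
      have u: "u \<in> carrier (qspace U (i, z))" using u by (simp add: a' tail_eq)
      note t = head_vert[OF i j l z]
      have qu: "qmap U (j, i, l, z) u \<in> carrier (qspace U (j, target j i l z))"
        using module_hom_closed[OF Ua[OF i j l z]] u by auto
      interpret Nj: superdivision_module K "D j" "N j"
        using dalg_closed[OF j] N[OF j] by (simp add: superdivision_module_def)
      have iq: "inc j (target j i l z) (qmap U (j, i, l, z) u) \<in> carrier (N j)"
        using module_hom_closed[OF inc_hom[OF j t]] qu by auto
      have "qmap (quiver_rep_of V) a (\<iota> (tail Q a) u) =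
          shift j i z \<odot>\<^bsub>N j\<^esub> \<phi> j i (pure_tensor (D i) (bimod S j i) (N i) (m j i l) (inc i z u))"
        using u i z by (simp add: a' tail_eq \<iota>_def verts_iff act_def V_def)
      also have "\<dots> = inc j (target j i l z) (qmap U (j, i, l, z) u)"
        using \<phi>f[OF i j l z u] shift_props(2)[OF i j N[OF j] iq] by simp
      also have "\<dots> = \<iota> (head Q a) (qmap U a u)"
        using qu j t by (simp add: a' head_eq[OF i j] \<iota>_def verts_iff)
      finally show ?thesis .
    qed
    ultimately show ?thesis unfolding quiver_rep_hom_def by (auto simp: \<iota>_def)
  qed
  have \<iota>_bij: "bij_betw (\<iota> x) (carrier (qspace U x)) (carrier (qspace (quiver_rep_of V) x))" if x: "x \<in> verts Q" for x
  proof -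
    obtain i z where iz: "x = (i, z)" "i \<in> I" "z = 0 \<or> ground i"
      using x by (cases x) (auto simp: verts_iff)
    then show ?thesis using inc_bij[OF iz(2,3)] x by (simp add: \<iota>_def V_def)
  qed
  have iso: "iso_hom (rep_quiver K Q) U (quiver_rep_of V) \<iota>"
    by (rule iso_rep_quiverI[OF wf_quiver U quiver_rep_of_ob[OF V_ob] \<iota>_hom \<iota>_bij])
  show ?thesis using iso_hom_symmetric[OF iso] V_ob by blast
qed

end

theorem theorem6p1:
  fixes K :: "('k, 'r) ring_scheme"
    and S :: "('k, 'a, 'm) superspecies"
    and L :: "nat \<Rightarrow> nat \<Rightarrow> 'l set"
    and m :: "nat \<Rightarrow> nat \<Rightarrow> 'l \<Rightarrow> 'm"
  assumes "algebraically_closed K"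
    and "is_superspecies K S"
    and "admissible_bases K S L m"
    and "infinite (UNIV :: 'v set)"
  shows "equivalent_categories
    (rep_superspecies K S :: (('a, 'm, 'v) species_rep, nat \<Rightarrow> 'v \<Rightarrow> 'v) cat)
    (rep_quiver K (superspecies_quiver K S L m) ::
      (('k, nat \<times> bit, nat \<times> nat \<times> 'l \<times> bit, 'v) quiver_rep, nat \<times> bit \<Rightarrow> 'v \<Rightarrow> 'v) cat)"
proof -
  interpret superspecies_setup K S L m using assms(1-3) by (rule superspecies_setup.intro)
  show ?thesis
  proof (rule full_faithful_surjective_imp_equivalent[OF quiver_functor_is_functor])
    fix V Y :: "('a, 'm, 'v) species_rep"
    assume "V \<in> Ob (rep_superspecies K S)" "Y \<in> Ob (rep_superspecies K S)"
    then have VY: "is_species_rep S V" "is_species_rep S Y" by (simp_all add: rep_ob_iff)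
    have "quiver_hom_of V ` species_rep_hom S V Y = quiver_rep_hom K Q (quiver_rep_of V) (quiver_rep_of Y)"
      using quiver_hom_of_hom[OF VY] quiver_functor_full[OF VY] by blast
    then show "bij_betw (on_hom quiver_functor V Y) (Hom (rep_superspecies K S) V Y)
        (Hom (rep_quiver K Q) (on_ob quiver_functor V) (on_ob quiver_functor Y))"
      using quiver_functor_faithful[OF VY]
      by (simp add: bij_betw_def quiver_functor_def Hom_rep) (simp add: rep_quiver_def)
  next
    fix U :: "('k, nat \<times> bit, nat \<times> nat \<times> 'l \<times> bit, 'v) quiver_rep"
    assume "U \<in> Ob (rep_quiver K Q)"
    then show "\<exists>V\<in>Ob (rep_superspecies K S). \<exists>f. iso_hom (rep_quiver K Q) (on_ob quiver_functor V) U f"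
      using quiver_functor_essentially_surjective[OF assms(4)] by (simp add: quiver_functor_def)
  qed
qed

end
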